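(* Let $(R,\mathfrak m)$ be a Noetherian local ring of dimension $d\ge 2$. Then $$\sup_{\substack{I\subsetneq J\\ \sqrt I=\mathfrak m}}\left\{\frac{\mathrm e(I)-\mathrm e(J)}{\ell(R/I)-\ell(R/J)}\right\}=\infty,$$ the supremum being over all pairs of ideals $I\subsetneq J$ of $R$ with $I$ $\mathfrak m$-primary. If, in addition, $R/\mathfrak m$ is algebraically closed, then $$\sup_{\substack{I\subsetneq J,\ \sqrt I=\mathfrak m\\ I=\overline I,\ J=\overline J}}\left\{\frac{\mathrm e(I)-\mathrm e(J)}{\ell(R/I)-\ell(R/J)}\right\}=\infty,$$ the supremum being over all pairs of integrally closed ideals $I\subsetneq J$ of $R$ with $I$ $\mathfrak m$-primary.
   Context: Rings are commutative with identity; $\ell$ denotes length. For an $\mathfrak m$-primary ideal $I$ of a Noetherian local ring $(R,\mathfrak m)$ of dimension $d$, the Hilbert--Samuel multiplicity is $\mathrm e(I)=\lim_{n\to\infty} d!\,\ell(R/I^n)/n^d$ (the same formula gives the value $0$ for the unit ideal). The integral closure $\overline I$ is the set of $x\in R$ satisfying an equation $x^n+a_1x^{n-1}+\cdots+a_n=0$ with $a_k\in I^k$; $I$ is integrally closed if $I=\overline I$. *)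

theory Defs
  imports "HOL-Algebra.Algebra" "HOL-Library.Extended_Real"
begin

locale noetherian_local_ring = cring R + noetherian_ring R for R (structure) +
  fixes m
  assumes maximal: "maximalideal m R"
    and unique_maximal: "maximalideal M R \<Longrightarrow> M = m"

definition krull_dim :: "('a, 'b) ring_scheme \<Rightarrow> enat" where
  "krull_dim R = (SUP n \<in> {n. \<exists>P. (\<forall>i\<le>n. primeideal (P i) R) \<and> (\<forall>i<n. P i \<subset> P (Suc i))}. enat n)"

definition ideal_radical :: "('a, 'b) ring_scheme \<Rightarrow> 'a set \<Rightarrow> 'a set" where
  "ideal_radical R I = {x \<in> carrier R. \<exists>n::nat. n \<ge> 1 \<and> x [^]\<^bsub>R\<^esub> n \<in> I}"

(* The power is taken in the monoid of ideals under the ideal product, so the 0-th power is R. *)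
definition ideal_pow :: "('a, 'b) ring_scheme \<Rightarrow> 'a set \<Rightarrow> nat \<Rightarrow> 'a set" where
  "ideal_pow R I n = I [^]\<^bsub>ideals_set R\<^esub> n"

definition integral_closure :: "('a, 'b) ring_scheme \<Rightarrow> 'a set \<Rightarrow> 'a set" where
  "integral_closure R I =
     {x \<in> carrier R. \<exists>n a. n \<ge> 1 \<and> (\<forall>k\<in>{1..n}. a k \<in> ideal_pow R I k) \<and>
        x [^]\<^bsub>R\<^esub> n \<oplus>\<^bsub>R\<^esub> (\<Oplus>\<^bsub>R\<^esub>k\<in>{1..n}. a k \<otimes>\<^bsub>R\<^esub> x [^]\<^bsub>R\<^esub> (n - k)) = \<zero>\<^bsub>R\<^esub>}"

definition module_length :: "('a, 'c) ring_scheme \<Rightarrow> ('a, 'b, 'd) module_scheme \<Rightarrow> enat" where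
  "module_length R M =
     (SUP n \<in> {n. \<exists>N. (\<forall>i\<le>n. submodule (N i) R M) \<and> (\<forall>i<n. N i \<subset> N (Suc i))}. enat n)"

(* R/I as an R-module. Module records extend ring records, whence the multiplicative fields. *)
definition quotient_module :: "('a, 'b) ring_scheme \<Rightarrow> 'a set \<Rightarrow> ('a, 'a set) module" where
  "quotient_module R I =
     \<lparr>carrier = carrier (R Quot I), monoid.mult = monoid.mult (R Quot I), one = one (R Quot I),
      ring.zero = ring.zero (R Quot I), ring.add = ring.add (R Quot I),
      smult = (\<lambda>r A. (I +>\<^bsub>R\<^esub> r) \<otimes>\<^bsub>R Quot I\<^esub> A)\<rparr>"

lemma (in cring) quotient_module_is_module:
  assumes "ideal I R"
  shows "module R (quotient_module R I)"
proof -
  interpret I: ideal I R by fact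
  interpret Q: cring "R Quot I"
    using I.quotient_is_cring[OF is_cring] .
  have h: "(\<lambda>x. I +> x) \<in> ring_hom R (R Quot I)"
    by (rule I.rcos_ring_hom)
  have g: "abelian_group (quotient_module R I)"
  proof (rule abelian_groupI)
    fix x assume "x \<in> carrier (quotient_module R I)"
    then have "x \<in> carrier (R Quot I)" by (simp add: quotient_module_def)
    then show "\<exists>y\<in>carrier (quotient_module R I).
        y \<oplus>\<^bsub>quotient_module R I\<^esub> x = \<zero>\<^bsub>quotient_module R I\<^esub>"
      using Q.l_neg Q.a_inv_closed by (force simp: quotient_module_def)
  qed (simp_all add: quotient_module_def Q.add.m_ac)
  show ?thesis
    by (rule moduleI[OF is_cring g])
      (simp_all add: quotient_module_def ring_hom_closed[OF h] ring_hom_add[OF h]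
        ring_hom_mult[OF h] ring_hom_one[OF h] Q.l_distr Q.r_distr Q.m_assoc)
qed

(* The length of R/I as a real number; the_enat is unspecified at infinity, so this is
   meaningful only for quotients of finite length. *)
definition quotient_length :: "('a, 'b) ring_scheme \<Rightarrow> 'a set \<Rightarrow> real" where
  "quotient_length R I = real (the_enat (module_length R (quotient_module R I)))"

definition multiplicity_of_ideal :: "('a, 'b) ring_scheme \<Rightarrow> 'a set \<Rightarrow> real" where
  "multiplicity_of_ideal R I =
     (let d = the_enat (krull_dim R)
      in lim (\<lambda>n. fact d * quotient_length R (ideal_pow R I n) / real n ^ d))"

end

theory Submission
  imports Defs "HOL-Library.List_Lexorder"
begin

text \<open>
  Let \<open>Q\<close> be generated by a system of parameters \<open>x\<^sub>1, \<dots>, x\<^sub>d\<close>. Since \<open>\<ell>(R/Q\<^sup>n)\<close> grows like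
  \<open>n\<^sup>d\<close>, the parameters are analytically independent, that is, \<open>F(x) \<in> Q\<^sup>r - m Q\<^sup>r\<close> for every form
  \<open>F\<close> of degree \<open>r\<close> with a unit coefficient, and the elements of the sets \<open>Q\<^sup>r - m Q\<^sup>r\<close> are closed
  under multiplication. As in Berkovich's proof that spectra are non-empty, a minimal submultiplicative
  non-archimedean norm \<open>N\<close> with value \<open>2\<^bsup>-r\<^esup>\<close> on \<open>Q\<^sup>r - m Q\<^sup>r\<close> is multiplicative.

  Take \<open>I = {N < 2\<^bsup>-n\<^esup>}\<close> and \<open>J = I + (x\<^sub>1\<^sup>n)\<close>. Then \<open>\<ell>(J/I) = 1\<close>, as \<open>m x\<^sub>1\<^sup>n \<subseteq> I\<close>. The ideal \<open>I\<close>
  is integrally closed because \<open>N\<close> is multiplicative. So is \<open>J\<close> when \<open>R/m\<close> is algebraically closed: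
  modulo elements of smaller norm, an equation of integral dependence of \<open>g\<close> over \<open>J\<close> reads
  \<open>\<Prod>(g - \<lambda>\<^sub>i x\<^sub>1\<^sup>n) = 0\<close>, which forces some \<open>g - \<lambda>\<^sub>i x\<^sub>1\<^sup>n\<close> into \<open>I\<close>.

  The Hilbert-Samuel bound prevents the values of \<open>N\<close> from accumulating below \<open>2\<^bsup>-n\<^esup>\<close>: there is a
  constant \<open>E\<close> with \<open>N \<le> 2\<^bsup>-n-1/E\<^esup>\<close> on \<open>I\<close>. Hence the elements \<open>x\<^sub>1\<^bsup>n(j-b)\<^esup> F(x)\<close> of \<open>J\<^sup>j\<close>, for \<open>F\<close> of
  degree \<open>(n+1)b\<close> and \<open>b < j/E\<close>, are independent modulo \<open>I\<^sup>j\<close>; counting them gives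
  \<open>e(I) - e(J) \<ge> C (n+1)\<^bsup>d-1\<^esup>\<close> with \<open>C > 0\<close> independent of \<open>n\<close>.
\<close>

no_notation Sum_Type.Plus (infixr \<open><+>\<close> 65)

section \<open>Lengths of intervals of ideals\<close>

text \<open>The obstacle is that the \<open>Q\<close>-adic order is only submultiplicative: the
  associated graded ring of \<open>Q\<close> may have zero divisors, and \<open>R\<close> need not
  be a domain. Only the special fibre ring, the sum of the \<open>Q^n / m Q^n\<close>, is known to
  be a polynomial ring, so the values of the norm are prescribed on representatives of its nonzero
  forms. Minimality then replaces the existence of valuations: for a multiplicative set of elements
  s with weights w, the infimum of N(s x) / w is again an admissible norm below N, hence equals N.
  This is applied to the forms and to the powers of one element; the latter needs N(x^j) = N(x)^j,
  which comes from the spectral norm. The values of N might a priori accumulate, so the gap 1/E has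
  to be proved. E is chosen from \<open>colength Q\<close> and d alone, and its independence of n is
  what lets the difference of multiplicities grow. The factor (n+1)^(d-1) reflects the number of
  monomials of degree (n+1) b in d variables; it is unbounded because d is at least 2. The residue
  field enters through J: modulo smaller norm an integral equation over J is a polynomial over R/m,
  and its roots must lift to R.\<close>

definition (in ring) ideal_chain :: "'a set \<Rightarrow> 'a set \<Rightarrow> nat \<Rightarrow> (nat \<Rightarrow> 'a set) \<Rightarrow> bool" where
  "ideal_chain B A n N \<longleftrightarrow>
     (\<forall>i\<le>n. ideal (N i) R \<and> B \<subseteq> N i \<and> N i \<subseteq> A) \<and> (\<forall>i<n. N i \<subset> N (Suc i))"

definition (in ring) ideal_length :: "'a set \<Rightarrow> 'a set \<Rightarrow> enat" where
  "ideal_length B A = (SUP n \<in> {n. \<exists>N. ideal_chain B A n N}. enat n)"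

definition (in ring) colon :: "'a set \<Rightarrow> 'a \<Rightarrow> 'a set" where
  "colon B x = {r \<in> carrier R. r \<otimes> x \<in> B}"

lemma enat_SUP_attained:
  assumes "S \<noteq> {}" and "(SUP n\<in>S. enat n) = enat k"
  shows "k \<in> S"
proof -
  have le: "n \<le> k" if "n \<in> S" for n
    using assms(2) SUP_upper[OF that, of enat] by simp
  have "\<not> (\<forall>n\<in>S. n < k)"
  proof
    assume *: "\<forall>n\<in>S. n < k"
    with assms(1) have "k > 0" by auto
    have "(SUP n\<in>S. enat n) \<le> enat (k - 1)"
      using * by (intro SUP_least) auto
    with assms(2) \<open>k > 0\<close> show False by simp
  qed
  with le show ?thesis by (auto simp: not_less dest: antisym)
qed

context ring
begin

lemma ideal_a_closed: "ideal I R \<Longrightarrow> x \<in> I \<Longrightarrow> y \<in> I \<Longrightarrow> x \<oplus> y \<in> I"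
  by (simp add: additive_subgroup.a_closed ideal.axioms(1))

lemma ideal_a_inv_closed: "ideal I R \<Longrightarrow> x \<in> I \<Longrightarrow> \<ominus> x \<in> I"
  by (simp add: additive_subgroup.a_inv_closed ideal.axioms(1))

lemma ideal_zero_closed: "ideal I R \<Longrightarrow> \<zero> \<in> I"
  by (simp add: additive_subgroup.zero_closed ideal.axioms(1))

lemma ideal_minus_closed: "ideal I R \<Longrightarrow> x \<in> I \<Longrightarrow> y \<in> I \<Longrightarrow> x \<ominus> y \<in> I"
  by (simp add: minus_eq ideal_a_closed ideal_a_inv_closed)

lemma ideal_subset_carrier: "ideal I R \<Longrightarrow> I \<subseteq> carrier R"
  by (auto dest: ideal.Icarr)

lemma ideal_a_cancel_left:
  assumes "ideal I R" "x \<in> I" "x \<oplus> y \<in> I" "y \<in> carrier R"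
  shows "y \<in> I"
proof -
  have "y = (x \<oplus> y) \<ominus> x"
    using assms(1,2,4) ideal.Icarr[OF assms(1,2)] by algebra
  then show ?thesis using ideal_minus_closed[OF assms(1,3,2)] by simp
qed

lemma ideal_a_cancel_right:
  assumes "ideal I R" "y \<in> I" "x \<oplus> y \<in> I" "x \<in> carrier R"
  shows "x \<in> I"
  using ideal_a_cancel_left[OF assms(1,2), of x] assms a_comm ideal.Icarr[OF assms(1,2)] by simp

lemma idealI_closed:
  assumes "I \<subseteq> carrier R" "\<zero> \<in> I" "\<And>x y. x \<in> I \<Longrightarrow> y \<in> I \<Longrightarrow> x \<oplus> y \<in> I"
    and "\<And>r x. r \<in> carrier R \<Longrightarrow> x \<in> I \<Longrightarrow> r \<otimes> x \<in> I"
    and "\<And>r x. r \<in> carrier R \<Longrightarrow> x \<in> I \<Longrightarrow> x \<otimes> r \<in> I"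
  shows "ideal I R"
proof (rule idealI)
  show "subgroup I (add_monoid R)"
  proof (rule add.subgroupI)
    show "I \<noteq> {}" using assms(2) by auto
    fix a assume a: "a \<in> I"
    have "\<ominus> \<one> \<otimes> a = \<ominus> a" using a assms(1) by (simp add: l_minus subset_iff)
    then show "\<ominus> a \<in> I" using assms(4)[of "\<ominus> \<one>" a] a by simp
  qed (use assms in auto)
qed (use assms ring_axioms in auto)

lemma ideal_inter: "ideal I R \<Longrightarrow> ideal J R \<Longrightarrow> ideal (I \<inter> J) R"
  by (rule i_intersect)

lemma ideal_length_chain: "ideal_chain B A n N \<Longrightarrow> enat n \<le> ideal_length B A"
  unfolding ideal_length_def by (rule SUP_upper) auto

lemma ideal_length_least:
  "(\<And>n N. ideal_chain B A n N \<Longrightarrow> enat n \<le> u) \<Longrightarrow> ideal_length B A \<le> u"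
  unfolding ideal_length_def by (rule SUP_least) auto

lemma ideal_length_attained:
  assumes "ideal B R" "B \<subseteq> A" "ideal_length B A = enat n"
  shows "\<exists>N. ideal_chain B A n N"
proof -
  have "ideal_chain B A 0 (\<lambda>_. B)" using assms by (simp add: ideal_chain_def)
  then show ?thesis
    using enat_SUP_attained[of "{n. \<exists>N. ideal_chain B A n N}" n] assms(3)
    unfolding ideal_length_def by blast
qed

lemma ideal_length_mono: "B \<subseteq> B' \<Longrightarrow> A' \<subseteq> A \<Longrightarrow> ideal_length B' A' \<le> ideal_length B A"
proof (rule ideal_length_least)
  fix n N assume sub: "B \<subseteq> B'" "A' \<subseteq> A" and N: "ideal_chain B' A' n N"
  then have "ideal_chain B A n N"
    unfolding ideal_chain_def by (meson subset_trans)
  then show "enat n \<le> ideal_length B A" by (rule ideal_length_chain)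
qed

lemma ideal_length_ge_1:
  assumes "ideal B R" "ideal A R" "B \<subset> A" shows "1 \<le> ideal_length B A"
proof -
  have "ideal_chain B A 1 (\<lambda>i. if i = 0 then B else A)"
    using assms by (auto simp: ideal_chain_def)
  then show ?thesis by (metis ideal_length_chain one_enat_def)
qed

lemma ideal_length_strict_mono_map:
  assumes "\<And>N. ideal N R \<Longrightarrow> B \<subseteq> N \<Longrightarrow> N \<subseteq> A \<Longrightarrow> ideal (f N) R \<and> B' \<subseteq> f N \<and> f N \<subseteq> A'"
    and "\<And>N N'. ideal N R \<Longrightarrow> ideal N' R \<Longrightarrow> B \<subseteq> N \<Longrightarrow> N \<subset> N' \<Longrightarrow> N' \<subseteq> A \<Longrightarrow> f N \<subset> f N'"
  shows "ideal_length B A \<le> ideal_length B' A'"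
proof (rule ideal_length_least)
  fix n N assume N: "ideal_chain B A n N"
  have "ideal_chain B' A' n (\<lambda>i. f (N i))"
    using N assms unfolding ideal_chain_def by (simp add: Suc_le_eq)
  then show "enat n \<le> ideal_length B' A'" by (rule ideal_length_chain)
qed

text \<open>Intersecting a strict chain with an ideal, or adding an ideal to it, creates
  repetitions; this counts the steps that survive. The induction also records that the thinned chain
  ends in \<open>N n\<close>, so that the next proper step can be appended.\<close>

lemma ideal_length_weak_chain:
  assumes "\<And>i. i \<le> n \<Longrightarrow> ideal (N i) R \<and> B \<subseteq> N i \<and> N i \<subseteq> A"
    and "\<And>i. i < n \<Longrightarrow> N i \<subseteq> N (Suc i)"
  shows "enat (card {i. i < n \<and> N i \<noteq> N (Suc i)}) \<le> ideal_length B A"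
proof -
  have "\<exists>K. ideal_chain B A (card {i. i < n \<and> N i \<noteq> N (Suc i)}) K \<and>
          K (card {i. i < n \<and> N i \<noteq> N (Suc i)}) = N n"
    using assms
  proof (induction n)
    case 0
    then show ?case by (intro exI[of _ N]) (auto simp: ideal_chain_def)
  next
    case (Suc n)
    let ?c = "card {i. i < n \<and> N i \<noteq> N (Suc i)}"
    obtain K where K: "ideal_chain B A ?c K" "K ?c = N n" using Suc by auto
    show ?case
    proof (cases "N n = N (Suc n)")
      case True
      then have "{i. i < Suc n \<and> N i \<noteq> N (Suc i)} = {i. i < n \<and> N i \<noteq> N (Suc i)}"
        by (auto simp: less_Suc_eq)
      with True K show ?thesis by auto
    next
      case False
      then have "{i. i < Suc n \<and> N i \<noteq> N (Suc i)} = insert n {i. i < n \<and> N i \<noteq> N (Suc i)}"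
        by (auto simp: less_Suc_eq)
      then have c: "card {i. i < Suc n \<and> N i \<noteq> N (Suc i)} = Suc ?c" by simp
      have lt: "N n \<subset> N (Suc n)" using False Suc.prems(2)[of n] by auto
      have "ideal_chain B A (Suc ?c) (K(Suc ?c := N (Suc n)))"
        unfolding ideal_chain_def
      proof (intro conjI allI impI)
        fix i assume "i < Suc ?c"
        then consider "i < ?c" | "i = ?c" by linarith
        then show "(K(Suc ?c := N (Suc n))) i \<subset> (K(Suc ?c := N (Suc n))) (Suc i)"
          using K lt by cases (simp_all add: ideal_chain_def)
      qed (use K Suc.prems(1)[of "Suc n"] in \<open>simp_all add: ideal_chain_def\<close>)
      moreover have "(K(Suc ?c := N (Suc n))) (Suc ?c) = N (Suc n)" by (rule fun_upd_same)
      ultimately show ?thesis unfolding c by (intro exI conjI)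
    qed
  qed
  then show ?thesis using ideal_length_chain by blast
qed

lemma mem_set_add: "x \<in> A <+> B \<longleftrightarrow> (\<exists>a\<in>A. \<exists>b\<in>B. x = a \<oplus> b)"
  by (auto simp: set_add_def')

lemma set_add_mono: "A \<subseteq> A' \<Longrightarrow> B \<subseteq> B' \<Longrightarrow> A <+> B \<subseteq> A' <+> B'"
  unfolding subset_iff mem_set_add by blast

lemma subset_set_add_left: "ideal A R \<Longrightarrow> ideal B R \<Longrightarrow> A \<subseteq> A <+> B"
  by (metis Un_subset_iff genideal_self ideal_subset_carrier union_genideal)

lemma subset_set_add_right: "ideal A R \<Longrightarrow> ideal B R \<Longrightarrow> B \<subseteq> A <+> B"
  by (metis Un_subset_iff genideal_self ideal_subset_carrier union_genideal)

lemma set_add_least: "ideal C R \<Longrightarrow> A \<subseteq> C \<Longrightarrow> B \<subseteq> C \<Longrightarrow> A <+> B \<subseteq> C"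
  by (rule subsetI) (auto simp: mem_set_add subset_iff ideal_a_closed)

text \<open>The modular law in the form that makes lengths additive: a proper inclusion stays proper
  after intersecting with \<open>B\<close> or after adding \<open>B\<close>.\<close>

lemma ideal_modular_cancel:
  assumes N: "ideal N R" "ideal N' R" "ideal B R" and sub: "N \<subseteq> N'"
    and "N' \<inter> B \<subseteq> N" "N' \<subseteq> N <+> B"
  shows "N' \<subseteq> N"
proof
  fix x assume x: "x \<in> N'"
  with assms(6) have "x \<in> N <+> B" by blast
  then obtain n b where nb: "n \<in> N" "b \<in> B" "x = n \<oplus> b"
    by (auto simp: mem_set_add)
  then have "b \<in> N'" using ideal_a_cancel_left[OF N(2), of n b] x sub
    by (auto dest: ideal.Icarr[OF N(3)])
  with nb assms(5) show "x \<in> N" using ideal_a_closed[OF N(1)] by auto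
qed

text \<open>For the upper bound a chain is both intersected with \<open>B\<close> and enlarged by
  \<open>B\<close>; by the modular law every proper step survives in at least one of the two. For
  the lower bound two attained chains are concatenated.\<close>

lemma ideal_length_add:
  assumes "ideal C R" "ideal B R" "ideal A R" and CB: "C \<subseteq> B" and BA: "B \<subseteq> A"
  shows "ideal_length C A = ideal_length C B + ideal_length B A"
proof (rule antisym)
  show "ideal_length C A \<le> ideal_length C B + ideal_length B A"
  proof (rule ideal_length_least)
    fix n N assume N: "ideal_chain C A n N"
    define S1 where "S1 = {i. i < n \<and> N i \<inter> B \<noteq> N (Suc i) \<inter> B}"
    define S2 where "S2 = {i. i < n \<and> N i <+> B \<noteq> N (Suc i) <+> B}"
    have idl: "ideal (N i) R" "C \<subseteq> N i" "N i \<subseteq> A" if "i \<le> n" for i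
      using N that by (auto simp: ideal_chain_def)
    have step: "N i \<subset> N (Suc i)" if "i < n" for i using N that by (auto simp: ideal_chain_def)
    have "enat (card S1) \<le> ideal_length C B"
      unfolding S1_def
    proof (intro ideal_length_weak_chain conjI)
      fix i assume "i \<le> n"
      then show "ideal (N i \<inter> B) R" "C \<subseteq> N i \<inter> B" using idl[of i] CB assms(2) ideal_inter by simp_all
    next
      fix i assume "i < n"
      then show "N i \<inter> B \<subseteq> N (Suc i) \<inter> B" using step[of i] by blast
    qed simp
    moreover have "enat (card S2) \<le> ideal_length B A"
      unfolding S2_def
    proof (intro ideal_length_weak_chain conjI)
      fix i assume "i < n" then show "N i <+> B \<subseteq> N (Suc i) <+> B"
        using step[of i] by (fastforce simp: mem_set_add)
    next
      fix i assume "i \<le> n"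
      then show "ideal (N i <+> B) R" "B \<subseteq> N i <+> B" "N i <+> B \<subseteq> A"
        using idl[of i] add_ideals[of "N i" B] subset_set_add_right[of "N i" B]
          set_add_least[of A "N i" B] assms by simp_all
    qed
    moreover have "{i. i < n} \<subseteq> S1 \<union> S2"
    proof
      fix i assume i: "i \<in> {i. i < n}"
      show "i \<in> S1 \<union> S2"
      proof (rule ccontr)
        assume "i \<notin> S1 \<union> S2"
        with i have e: "N i \<inter> B = N (Suc i) \<inter> B" "N i <+> B = N (Suc i) <+> B"
          by (auto simp: S1_def S2_def)
        have "N (Suc i) \<subseteq> N i"
        proof (rule ideal_modular_cancel[of _ _ B])
          show "ideal (N i) R" "ideal (N (Suc i)) R" "ideal B R" "N i \<subseteq> N (Suc i)"
            using i idl[of i] idl[of "Suc i"] step[of i] assms(2) by simp_all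
          then show "N (Suc i) \<subseteq> N i <+> B"
            unfolding e(2) by (intro subset_set_add_left)
          show "N (Suc i) \<inter> B \<subseteq> N i" using e(1) by blast
        qed
        with step[of i] i show False by auto
      qed
    qed
    then have "n \<le> card (S1 \<union> S2)"
      using card_mono[of "S1 \<union> S2" "{i. i < n}"] by (simp add: S1_def S2_def)
    then have "n \<le> card S1 + card S2" using card_Un_le[of S1 S2] by simp
    then have "enat n \<le> enat (card S1) + enat (card S2)" by simp
    ultimately show "enat n \<le> ideal_length C B + ideal_length B A"
      using add_mono[of "enat (card S1)" "ideal_length C B"] order_trans by blast
  qed
next
  show "ideal_length C B + ideal_length B A \<le> ideal_length C A"
  proof (cases "ideal_length C B = \<infinity> \<or> ideal_length B A = \<infinity>")
    case True
    then show ?thesis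
      using ideal_length_mono[of C C B A] ideal_length_mono[of C B A A] CB BA by auto
  next
    case False
    then obtain p q where pq: "ideal_length C B = enat p" "ideal_length B A = enat q" by auto
    obtain N M where N: "ideal_chain C B p N" and M: "ideal_chain B A q M"
      using ideal_length_attained[of C B p] ideal_length_attained[of B A q] pq assms by blast
    let ?K = "\<lambda>i. if i \<le> p then N i else M (i - p)"
    have NB: "N i \<subseteq> B" if "i \<le> p" for i using N that by (auto simp: ideal_chain_def)
    have "ideal_chain C A (p + q) ?K"
      unfolding ideal_chain_def
    proof (intro conjI allI impI)
      fix i assume "i < p + q"
      consider "i < p" | "i = p" | "i > p" by linarith
      then show "?K i \<subset> ?K (Suc i)"
      proof cases
        case 1
        with N show ?thesis by (auto simp: ideal_chain_def)
      next
        case 2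
        then have "0 < q" using \<open>i < p + q\<close> by simp
        then have "B \<subseteq> M 0" "M 0 \<subset> M 1" using M by (auto simp: ideal_chain_def)
        with NB[of p] 2 show ?thesis by auto
      next
        case 3
        then have "Suc i - p = Suc (i - p)" "i - p < q" using \<open>i < p + q\<close> by auto
        with M 3 show ?thesis by (auto simp: ideal_chain_def)
      qed
    next
      fix i assume "i \<le> p + q"
      then have "ideal (?K i) R \<and> C \<subseteq> ?K i \<and> ?K i \<subseteq> A"
      proof (cases "i \<le> p")
        case True
        then show ?thesis using N BA unfolding ideal_chain_def by auto
      next
        case False
        then have "i - p \<le> q" using \<open>i \<le> p + q\<close> by simp
        then have "ideal (M (i - p)) R" "B \<subseteq> M (i - p)" "M (i - p) \<subseteq> A"
          using M unfolding ideal_chain_def by blast+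
        with False CB show ?thesis by auto
      qed
      then show "ideal (?K i) R" "C \<subseteq> ?K i" "?K i \<subseteq> A" by blast+
    qed
    then show ?thesis using ideal_length_chain pq by fastforce
  qed
qed

lemma ideal_length_self: "ideal B R \<Longrightarrow> ideal_length B B = 0"
proof -
  assume B: "ideal B R"
  have "ideal_length B B \<le> 0"
  proof (rule ideal_length_least)
    fix n N assume N: "ideal_chain B B n N"
    have "n = 0"
    proof (rule ccontr)
      assume "n \<noteq> 0"
      with N have "N 0 \<subset> N 1" "B \<subseteq> N 0" "N 1 \<subseteq> B" by (auto simp: ideal_chain_def)
      then show False by auto
    qed
    then show "enat n \<le> 0" by (simp add: zero_enat_def)
  qed
  then show ?thesis by simp
qed

lemma ideal_length_maximal:
  assumes "maximalideal M R" shows "ideal_length M (carrier R) = 1"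
proof (rule antisym)
  interpret M: maximalideal M R by fact
  show "ideal_length M (carrier R) \<le> 1"
  proof (rule ideal_length_least)
    fix n N assume N: "ideal_chain M (carrier R) n N"
    have "n \<le> 1"
    proof (rule ccontr)
      assume "\<not> n \<le> 1"
      with N have "M \<subseteq> N 0" "N 0 \<subset> N 1" "N 1 \<subset> N 2" "N 2 \<subseteq> carrier R" "ideal (N 1) R"
        by (auto simp: ideal_chain_def numeral_2_eq_2)
      with M.I_maximal[of "N 1"] show False by auto
    qed
    then show "enat n \<le> 1" by (simp add: one_enat_def)
  qed
  show "1 \<le> ideal_length M (carrier R)"
    using M.is_ideal oneideal M.I_notcarr M.a_subset by (intro ideal_length_ge_1) auto
qed

lemma Idl_ideal: "ideal I R \<Longrightarrow> Idl I = I"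
  by (metis genideal_minimal genideal_self ideal_subset_carrier subset_antisym subset_refl)

lemma Idl_mono: "S \<subseteq> T \<Longrightarrow> T \<subseteq> carrier R \<Longrightarrow> Idl S \<subseteq> Idl T"
  by (rule subset_Idl_subset)

lemma Idl_Un_Idl:
  assumes "S \<subseteq> carrier R" "T \<subseteq> carrier R"
  shows "Idl (S \<union> T) = Idl S <+> Idl T"
proof -
  have "Idl (Idl S \<union> Idl T) = Idl (S \<union> T)"
  proof (rule antisym)
    show "Idl (Idl S \<union> Idl T) \<subseteq> Idl (S \<union> T)"
      using assms by (intro genideal_minimal genideal_ideal Un_least Idl_mono) auto
    show "Idl (S \<union> T) \<subseteq> Idl (Idl S \<union> Idl T)"
      using assms genideal_self[of S] genideal_self[of T] genideal_ideal ideal_subset_carrier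
      by (intro Idl_mono) auto
  qed
  then show ?thesis using assms union_genideal[OF genideal_ideal genideal_ideal] by simp
qed

end

section \<open>Colon ideals and lengths of cyclic quotients\<close>

context cring
begin

lemma idealI_cring:
  assumes "I \<subseteq> carrier R" "\<zero> \<in> I" "\<And>x y. x \<in> I \<Longrightarrow> y \<in> I \<Longrightarrow> x \<oplus> y \<in> I"
    and "\<And>r x. r \<in> carrier R \<Longrightarrow> x \<in> I \<Longrightarrow> r \<otimes> x \<in> I"
  shows "ideal I R"
proof (rule idealI_closed)
  fix r x assume "r \<in> carrier R" "x \<in> I"
  then show "x \<otimes> r \<in> I" using assms(4)[of r x] assms(1) m_comm[of r x] by auto
qed (use assms in auto)

lemma colon_ideal:
  assumes B: "ideal B R" and x: "x \<in> carrier R"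
  shows "ideal (colon B x) R"
proof (rule idealI_cring)
  fix r y assume "r \<in> carrier R" "y \<in> colon B x"
  then show "r \<otimes> y \<in> colon B x"
    using x ideal.I_l_closed[OF B, of "y \<otimes> x" r] by (simp add: colon_def m_assoc)
qed (use x ideal_zero_closed[OF B] ideal_a_closed[OF B] in \<open>auto simp: colon_def l_distr\<close>)

lemma subset_colon: "ideal B R \<Longrightarrow> x \<in> carrier R \<Longrightarrow> B \<subseteq> colon B x"
  by (auto simp: colon_def ideal.Icarr ideal.I_r_closed)

lemma mem_Idl_insert:
  assumes A: "A \<subseteq> carrier R" and x: "x \<in> carrier R"
  shows "y \<in> Idl (insert x A) \<longleftrightarrow> (\<exists>a\<in>Idl A. \<exists>r\<in>carrier R. y = a \<oplus> r \<otimes> x)"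
proof -
  have "Idl (insert x A) = Idl A <+> Idl {x}"
    using Idl_Un_Idl[OF A, of "{x}"] x by simp
  also have "Idl {x} = PIdl x" using cgenideal_eq_genideal[OF x] by simp
  finally show ?thesis by (auto simp: mem_set_add cgenideal_def)
qed

lemma ideal_scaled_sum:
  assumes "ideal B R" "ideal K R" "x \<in> carrier R"
  shows "ideal {b \<oplus> k \<otimes> x | b k. b \<in> B \<and> k \<in> K} R" (is "ideal ?S R")
proof (rule idealI_cring)
  have Bc: "\<And>b. b \<in> B \<Longrightarrow> b \<in> carrier R" and Kc: "\<And>k. k \<in> K \<Longrightarrow> k \<in> carrier R"
    using assms by (auto dest: ideal.Icarr)
  show "?S \<subseteq> carrier R" using Bc Kc assms(3) by auto
  show "\<zero> \<in> ?S"
    using ideal_zero_closed[OF assms(1)] ideal_zero_closed[OF assms(2)] assms(3)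
    by (intro CollectI exI[of _ \<zero>]) simp
  show "y \<oplus> z \<in> ?S" if yz: "y \<in> ?S" "z \<in> ?S" for y z
  proof -
    from yz obtain b k b' k' where
      e: "y = b \<oplus> k \<otimes> x" "z = b' \<oplus> k' \<otimes> x" "b \<in> B" "k \<in> K" "b' \<in> B" "k' \<in> K" by blast
    have "y \<oplus> z = (b \<oplus> b') \<oplus> (k \<oplus> k') \<otimes> x"
      using e Bc Kc assms(3) by algebra
    moreover have "b \<oplus> b' \<in> B" "k \<oplus> k' \<in> K" using e ideal_a_closed assms by simp_all
    ultimately show ?thesis by blast
  qed
  show "r \<otimes> y \<in> ?S" if r: "r \<in> carrier R" and y: "y \<in> ?S" for r y
  proof -
    from y obtain b k where e: "y = b \<oplus> k \<otimes> x" "b \<in> B" "k \<in> K" by blast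
    have "r \<otimes> y = r \<otimes> b \<oplus> (r \<otimes> k) \<otimes> x"
      using e Bc Kc assms(3) r by algebra
    moreover have "r \<otimes> b \<in> B" "r \<otimes> k \<in> K" using e r ideal.I_l_closed assms by metis+
    ultimately show ?thesis by blast
  qed
qed

text \<open>\<open>R/(B : x)\<close> is isomorphic to \<open>(B + R x)/B\<close>. Only the strictly
  monotone maps between the ideal lattices are needed, sending \<open>N\<close> to
  \<open>(N : x)\<close> and \<open>K\<close> to \<open>B + K x\<close>.\<close>

lemma ideal_length_colon:
  assumes B: "ideal B R" and x: "x \<in> carrier R"
  shows "ideal_length B (Idl (insert x B)) = ideal_length (colon B x) (carrier R)"
proof (rule antisym)
  have Bc: "B \<subseteq> carrier R" using B ideal_subset_carrier by auto
  have mem: "y \<in> Idl (insert x B) \<longleftrightarrow> (\<exists>a\<in>B. \<exists>r\<in>carrier R. y = a \<oplus> r \<otimes> x)" for y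
    using mem_Idl_insert[OF Bc x] Idl_ideal[OF B] by simp
  show "ideal_length B (Idl (insert x B)) \<le> ideal_length (colon B x) (carrier R)"
  proof (rule ideal_length_strict_mono_map[where f = "\<lambda>N. colon N x"])
    fix N assume "ideal N R" "B \<subseteq> N"
    then show "ideal (colon N x) R \<and> colon B x \<subseteq> colon N x \<and> colon N x \<subseteq> carrier R"
      using colon_ideal x by (auto simp: colon_def)
  next
    fix N N' assume N: "ideal N R" "ideal N' R" "B \<subseteq> N" "N \<subset> N'" "N' \<subseteq> Idl (insert x B)"
    have "\<not> colon N' x \<subseteq> colon N x"
    proof
      assume sub: "colon N' x \<subseteq> colon N x"
      have "N' \<subseteq> N"
      proof
        fix y assume y: "y \<in> N'"
        with N(5) obtain b r where br: "b \<in> B" "r \<in> carrier R" "y = b \<oplus> r \<otimes> x"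
          using mem by blast
        then have "r \<otimes> x \<in> N'"
          using ideal_a_cancel_left[OF N(2), of b "r \<otimes> x"] y N x by auto
        with sub br have "r \<otimes> x \<in> N" by (auto simp: colon_def)
        with br N ideal_a_closed show "y \<in> N" by auto
      qed
      with N show False by auto
    qed
    with N show "colon N x \<subset> colon N' x" by (auto simp: colon_def)
  qed
  show "ideal_length (colon B x) (carrier R) \<le> ideal_length B (Idl (insert x B))"
  proof (rule ideal_length_strict_mono_map[where f = "\<lambda>K. {b \<oplus> k \<otimes> x | b k. b \<in> B \<and> k \<in> K}"])
    fix K assume K: "ideal K R"
    show "ideal {b \<oplus> k \<otimes> x | b k. b \<in> B \<and> k \<in> K} R \<and>
        B \<subseteq> {b \<oplus> k \<otimes> x | b k. b \<in> B \<and> k \<in> K} \<and>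
        {b \<oplus> k \<otimes> x | b k. b \<in> B \<and> k \<in> K} \<subseteq> Idl (insert x B)"
    proof (intro conjI subsetI)
      show "ideal {b \<oplus> k \<otimes> x | b k. b \<in> B \<and> k \<in> K} R" using ideal_scaled_sum B K x by simp
      fix b assume "b \<in> B"
      moreover then have "b = b \<oplus> \<zero> \<otimes> x" using x Bc by auto
      ultimately show "b \<in> {b \<oplus> k \<otimes> x | b k. b \<in> B \<and> k \<in> K}"
        using ideal_zero_closed[OF K] by blast
    next
      fix y assume "y \<in> {b \<oplus> k \<otimes> x | b k. b \<in> B \<and> k \<in> K}"
      then show "y \<in> Idl (insert x B)" using mem ideal.Icarr[OF K] by blast
    qed
  next
    fix K K' assume K: "ideal K R" "ideal K' R" "colon B x \<subseteq> K" "K \<subset> K'"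
    have "\<not> {b \<oplus> k \<otimes> x | b k. b \<in> B \<and> k \<in> K'} \<subseteq> {b \<oplus> k \<otimes> x | b k. b \<in> B \<and> k \<in> K}"
    proof
      assume sub: "{b \<oplus> k \<otimes> x | b k. b \<in> B \<and> k \<in> K'} \<subseteq> {b \<oplus> k \<otimes> x | b k. b \<in> B \<and> k \<in> K}"
      have "K' \<subseteq> K"
      proof
        fix k assume k: "k \<in> K'"
        have "\<zero> \<oplus> k \<otimes> x \<in> {b \<oplus> k \<otimes> x | b k. b \<in> B \<and> k \<in> K'}"
          using k ideal_zero_closed[OF B] by blast
        with sub obtain b l where bl: "b \<in> B" "l \<in> K" "\<zero> \<oplus> k \<otimes> x = b \<oplus> l \<otimes> x" by blast
        note c = ideal.Icarr[OF K(2) k] ideal.Icarr[OF K(1) bl(2)] ideal.Icarr[OF B bl(1)]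
        have "(k \<ominus> l) \<otimes> x = (\<zero> \<oplus> k \<otimes> x) \<ominus> l \<otimes> x" using c x by algebra
        also have "\<dots> = b" unfolding bl(3) using c x by algebra
        finally have "k \<ominus> l \<in> K" using bl(1) c K(3) by (auto simp: colon_def)
        moreover have "k = l \<oplus> (k \<ominus> l)" using c by algebra
        ultimately show "k \<in> K" using ideal_a_closed[OF K(1) bl(2)] by metis
      qed
      with K show False by auto
    qed
    with K show "{b \<oplus> k \<otimes> x | b k. b \<in> B \<and> k \<in> K} \<subset> {b \<oplus> k \<otimes> x | b k. b \<in> B \<and> k \<in> K'}"
      by blast
  qed
qed

text \<open>The generators are adjoined one at a time, the largest index first; each step is a
  cyclic quotient whose annihilator is the colon ideal in the sum.\<close>

lemma ideal_length_Idl_span: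
  fixes g :: "'i::linorder \<Rightarrow> 'a"
  assumes B: "ideal B R" and "finite S" and g: "\<And>i. i \<in> S \<Longrightarrow> g i \<in> carrier R"
  shows "ideal_length B (Idl (B \<union> g ` S)) =
    (\<Sum>i\<in>S. ideal_length (colon (Idl (B \<union> g ` {j\<in>S. i < j})) (g i)) (carrier R))"
  using assms(2,3)
proof (induction S rule: finite_linorder_min_induct)
  case empty
  then show ?case using B by (simp add: Idl_ideal ideal_length_self)
next
  case (insert b S)
  have Bc: "B \<subseteq> carrier R" using B ideal_subset_carrier by auto
  let ?D = "Idl (B \<union> g ` S)"
  have c: "B \<union> g ` S \<subseteq> carrier R" "g b \<in> carrier R" using insert Bc by auto
  have D: "ideal ?D R" using c by (intro genideal_ideal)
  have E: "Idl (B \<union> g ` insert b S) = Idl (insert (g b) ?D)"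
  proof (rule antisym)
    show "Idl (B \<union> g ` insert b S) \<subseteq> Idl (insert (g b) ?D)"
      using genideal_self[OF c(1)] c(2) ideal_subset_carrier[OF D] by (intro Idl_mono) auto
    have 1: "ideal (Idl (B \<union> g ` insert b S)) R" using c by (intro genideal_ideal) auto
    have 2: "B \<union> g ` insert b S \<subseteq> Idl (B \<union> g ` insert b S)"
      using c by (intro genideal_self) auto
    show "Idl (insert (g b) ?D) \<subseteq> Idl (B \<union> g ` insert b S)"
      using 1 2 by (intro genideal_minimal insert_subsetI) auto
  qed
  have "B \<subseteq> ?D" using genideal_self[OF c(1)] by auto
  moreover have "?D \<subseteq> Idl (insert (g b) ?D)" "ideal (Idl (insert (g b) ?D)) R"
    using genideal_self[of "insert (g b) ?D"] genideal_ideal[of "insert (g b) ?D"] c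
      ideal_subset_carrier[OF D] by auto
  ultimately have "ideal_length B (Idl (B \<union> g ` insert b S)) =
      ideal_length B ?D + ideal_length (colon ?D (g b)) (carrier R)"
    unfolding E using ideal_length_add[OF B D] ideal_length_colon[OF D c(2)] by simp
  moreover have "{j \<in> insert b S. b < j} = S" using insert(2) by auto
  moreover have "{j \<in> insert b S. i < j} = {j \<in> S. i < j}" if "i \<in> S" for i
    using that insert(2) by (auto dest: bspec less_asym)
  moreover have "b \<notin> S" using insert(2) by auto
  ultimately show ?case using insert by (simp add: add.commute)
qed

end

section \<open>Exponent vectors\<close>

definition exponents :: "nat \<Rightarrow> nat \<Rightarrow> nat list set" where
  "exponents s n = {\<alpha>. length \<alpha> = s \<and> sum_list \<alpha> = n}"

definition exp_add :: "nat list \<Rightarrow> nat list \<Rightarrow> nat list" where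
  "exp_add = map2 (+)"

lemma exp_add_simps [simp]:
  "exp_add [] \<beta> = []" "exp_add \<alpha> [] = []" "exp_add (a # \<alpha>) (b # \<beta>) = (a + b) # exp_add \<alpha> \<beta>"
  by (simp_all add: exp_add_def)

lemma length_exp_add [simp]: "length (exp_add \<alpha> \<beta>) = min (length \<alpha>) (length \<beta>)"
  by (simp add: exp_add_def)

lemma sum_list_exp_add:
  "length \<alpha> = length \<beta> \<Longrightarrow> sum_list (exp_add \<alpha> \<beta>) = sum_list \<alpha> + sum_list \<beta>"
  by (induction \<alpha> \<beta> rule: list_induct2) simp_all

lemma exp_add_exponents:
  "\<alpha> \<in> exponents s n \<Longrightarrow> \<beta> \<in> exponents s k \<Longrightarrow> exp_add \<alpha> \<beta> \<in> exponents s (n + k)"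
  by (simp add: exponents_def sum_list_exp_add)

lemma exp_add_commute: "exp_add \<alpha> \<beta> = exp_add \<beta> \<alpha>"
proof (induction \<alpha> arbitrary: \<beta>)
  case (Cons a \<alpha>)
  then show ?case by (cases \<beta>) (simp_all add: add.commute)
qed simp

text \<open>The lexicographic order is a monomial order; all leading term arguments rest on
  this.\<close>

lemma exp_add_less_mono:
  "length \<alpha> = length \<beta> \<Longrightarrow> length \<beta> = length \<gamma> \<Longrightarrow> \<alpha> < \<beta> \<Longrightarrow> exp_add \<alpha> \<gamma> < exp_add \<beta> \<gamma>"
  by (induction \<alpha> \<beta> \<gamma> rule: list_induct3) auto

lemma exponents_subset_box: "\<alpha> \<in> exponents s n \<Longrightarrow> set \<alpha> \<subseteq> {..n}"
  by (auto simp: exponents_def member_le_sum_list)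

lemma finite_exponents [simp]: "finite (exponents s n)"
proof (rule finite_subset)
  show "exponents s n \<subseteq> {\<alpha>. set \<alpha> \<subseteq> {..n} \<and> length \<alpha> = s}"
    using exponents_subset_box by (auto simp: exponents_def)
qed (simp add: finite_lists_length_eq)

lemma card_exponents: "card (exponents s n) = (n + s - 1) choose n"
  unfolding exponents_def using card_length_sum_list[of s n] by simp

lemma exponents_0: "exponents 0 n = (if n = 0 then {[]} else {})"
  by (auto simp: exponents_def)

lemma exponents_Suc_Suc:
  "exponents (Suc s) (Suc n) =
     (#) 0 ` exponents s (Suc n) \<union> (\<lambda>\<alpha>. Suc (hd \<alpha>) # tl \<alpha>) ` exponents (Suc s) n"
proof (intro equalityI subsetI)
  fix \<alpha> assume \<alpha>: "\<alpha> \<in> exponents (Suc s) (Suc n)"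
  then obtain a \<beta> where ab: "\<alpha> = a # \<beta>" by (auto simp: exponents_def length_Suc_conv)
  show "\<alpha> \<in> (#) 0 ` exponents s (Suc n) \<union> (\<lambda>\<alpha>. Suc (hd \<alpha>) # tl \<alpha>) ` exponents (Suc s) n"
  proof (cases a)
    case 0
    with \<alpha> ab show ?thesis by (auto simp: exponents_def)
  next
    case (Suc b)
    with \<alpha> ab have "b # \<beta> \<in> exponents (Suc s) n" by (auto simp: exponents_def)
    moreover have "\<alpha> = (\<lambda>\<alpha>. Suc (hd \<alpha>) # tl \<alpha>) (b # \<beta>)" using ab Suc by simp
    ultimately show ?thesis by blast
  qed
qed (auto simp: exponents_def length_Suc_conv)

section \<open>Capped exponents and finiteness of monotone families\<close>

definition truncate_exp :: "nat \<Rightarrow> nat list \<Rightarrow> nat list" where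
  "truncate_exp M = map (\<lambda>a. min a M)"

lemma truncate_exp_simps [simp]:
  "truncate_exp M [] = []" "truncate_exp M (a # \<alpha>) = min a M # truncate_exp M \<alpha>"
  "length (truncate_exp M \<alpha>) = length \<alpha>"
  by (simp_all add: truncate_exp_def)

lemma truncate_exp_le: "list_all2 (\<le>) (truncate_exp M \<alpha>) \<alpha>"
  by (induction \<alpha>) simp_all

lemma truncate_exp_truncate_exp: "M \<le> M' \<Longrightarrow> truncate_exp M (truncate_exp M' \<alpha>) = truncate_exp M \<alpha>"
  by (auto simp: truncate_exp_def min_def)

lemma truncate_exp_box: "truncate_exp M \<alpha> \<in> {\<beta>. set \<beta> \<subseteq> {..M} \<and> length \<beta> = length \<alpha>}"
  by (auto simp: truncate_exp_def)

text \<open>A form of Dickson's lemma.\<close>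

lemma monotone_family_truncate:
  fixes f :: "nat list \<Rightarrow> 'c set"
  assumes "\<And>\<alpha>. length \<alpha> = s \<Longrightarrow> f \<alpha> \<in> L"
    and "\<And>\<alpha> \<beta>. length \<beta> = s \<Longrightarrow> list_all2 (\<le>) \<alpha> \<beta> \<Longrightarrow> f \<alpha> \<subseteq> f \<beta>"
    and acc: "\<And>h :: nat \<Rightarrow> 'c set. (\<And>k. h k \<in> L) \<Longrightarrow> (\<And>k. h k \<subseteq> h (Suc k)) \<Longrightarrow> \<exists>K. \<forall>k\<ge>K. h k = h K"
  shows "\<exists>M. \<forall>\<alpha>. length \<alpha> = s \<longrightarrow> f \<alpha> = f (truncate_exp M \<alpha>)"
  using assms(1,2)
proof (induction s arbitrary: f)
  case (Suc s)
  have fL: "f (k # \<alpha>) \<in> L" if "length \<alpha> = s" for k \<alpha> using Suc.prems(1) that by simp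
  have fm: "f (k # \<alpha>) \<subseteq> f (l # \<beta>)" if "length \<beta> = s" "k \<le> l" "list_all2 (\<le>) \<alpha> \<beta>" for k l \<alpha> \<beta>
    using Suc.prems(2)[of "l # \<beta>" "k # \<alpha>"] that by simp
  have refl: "list_all2 (\<le>) \<alpha> \<alpha>" for \<alpha> :: "nat list" by (rule list_all2_refl) simp
  have ex: "\<exists>K. \<forall>k\<ge>K. f (k # \<alpha>) = f (K # \<alpha>)" if "length \<alpha> = s" for \<alpha>
    using acc[of "\<lambda>k. f (k # \<alpha>)"] fL[OF that] fm[OF that _ refl] by auto
  \<comment> \<open>\<open>g\<close> is the stable value of \<open>f (k # \<alpha>)\<close> for
    large \<open>k\<close>, again a monotone family in \<open>L\<close> but with one coordinate
    less.\<close>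
  define g where "g \<alpha> = (\<Union>k. f (k # \<alpha>))" for \<alpha>
  have gK: "g \<alpha> = f (K # \<alpha>)" if "length \<alpha> = s" "\<forall>k\<ge>K. f (k # \<alpha>) = f (K # \<alpha>)" for K \<alpha>
  proof -
    have "f (k # \<alpha>) \<subseteq> f (K # \<alpha>)" for k
      using that fm[OF that(1), of k "max k K" \<alpha>] refl by (metis max.cobounded1 max.cobounded2)
    then show ?thesis unfolding g_def by auto
  qed
  obtain M where M: "\<And>\<alpha>. length \<alpha> = s \<Longrightarrow> g \<alpha> = g (truncate_exp M \<alpha>)"
  proof -
    have "\<exists>M. \<forall>\<alpha>. length \<alpha> = s \<longrightarrow> g \<alpha> = g (truncate_exp M \<alpha>)"
    proof (rule Suc.IH)
      show "g \<alpha> \<in> L" if "length \<alpha> = s" for \<alpha> using ex[OF that] gK[OF that] fL[OF that] by metis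
      show "g \<alpha> \<subseteq> g \<beta>" if "length \<beta> = s" "list_all2 (\<le>) \<alpha> \<beta>" for \<alpha> \<beta>
        unfolding g_def using fm[OF that(1) order_refl that(2)] by fast
    qed
    then show ?thesis using that by blast
  qed
  let ?B = "{\<beta>. set \<beta> \<subseteq> {..M} \<and> length \<beta> = s}"
  \<comment> \<open>By the choice of \<open>M\<close> only the finitely many tails in the box
    matter, so one threshold \<open>K\<close> serves for all of them.\<close>
  have "\<exists>K. \<forall>\<beta>\<in>?B. \<forall>k\<ge>K. f (k # \<beta>) = g \<beta>"
  proof -
    have "\<forall>\<beta>\<in>?B. \<exists>K. \<forall>k\<ge>K. f (k # \<beta>) = g \<beta>"
      using ex gK by (metis (mono_tags, lifting) mem_Collect_eq)
    then obtain Kf where Kf: "\<And>\<beta> k. \<beta> \<in> ?B \<Longrightarrow> k \<ge> Kf \<beta> \<Longrightarrow> f (k # \<beta>) = g \<beta>" by metis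
    have fin: "finite (Kf ` ?B)" by (simp add: finite_lists_length_eq)
    have "f (k # \<beta>) = g \<beta>" if "\<beta> \<in> ?B" "k \<ge> Max (insert 0 (Kf ` ?B))" for k \<beta>
      using Kf[OF that(1), of k] that fin by simp
    then show ?thesis by blast
  qed
  then obtain K where K: "\<And>\<beta> k. \<beta> \<in> ?B \<Longrightarrow> k \<ge> K \<Longrightarrow> f (k # \<beta>) = g \<beta>" by blast
  have stab: "f (k # \<alpha>) = g \<alpha>" if \<alpha>: "length \<alpha> = s" and k: "k \<ge> K" for k \<alpha>
  proof
    show "f (k # \<alpha>) \<subseteq> g \<alpha>" unfolding g_def by auto
    have "g \<alpha> = f (k # truncate_exp M \<alpha>)"
      using M[OF \<alpha>] K[of "truncate_exp M \<alpha>" k] truncate_exp_box[of M \<alpha>] \<alpha> k by simp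
    also have "\<dots> \<subseteq> f (k # \<alpha>)" using fm[OF \<alpha> order_refl truncate_exp_le] .
    finally show "g \<alpha> \<subseteq> f (k # \<alpha>)" .
  qed
  \<comment> \<open>Slices with first entry below \<open>K\<close> need not be stable yet. Each gets
    its own cap from the induction hypothesis, and \<open>N\<close> below majorizes these finitely
    many caps together with \<open>M\<close> and \<open>K\<close>.\<close>
  have "\<forall>k. \<exists>M. \<forall>\<alpha>. length \<alpha> = s \<longrightarrow> f (k # \<alpha>) = f (k # truncate_exp M \<alpha>)"
  proof
    fix k show "\<exists>M. \<forall>\<alpha>. length \<alpha> = s \<longrightarrow> f (k # \<alpha>) = f (k # truncate_exp M \<alpha>)"
      by (rule Suc.IH) (use fL fm in auto)
  qed
  then obtain Mf where Mf: "\<And>k \<alpha>. length \<alpha> = s \<Longrightarrow> f (k # \<alpha>) = f (k # truncate_exp (Mf k) \<alpha>)" by metis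
  define N where "N = Max (insert (max M K) (Mf ` {..K}))"
  have N: "M \<le> N" "K \<le> N" by (auto simp: N_def Max_ge_iff)
  have Mf_le: "Mf k \<le> N" if "k \<le> K" for k unfolding N_def using that by (intro Max_ge) auto
  have trunc: "f (k # \<alpha>) = f (k # truncate_exp N \<alpha>)" if \<alpha>: "length \<alpha> = s" for k \<alpha>
  proof (cases "k \<ge> K")
    case True
    have "g \<alpha> = g (truncate_exp N \<alpha>)"
      using M[OF \<alpha>] M[of "truncate_exp N \<alpha>"] \<alpha> truncate_exp_truncate_exp[OF N(1)] by simp
    then show ?thesis using stab \<alpha> True by simp
  next
    case False
    then show ?thesis
      using Mf[OF \<alpha>, of k] Mf[of "truncate_exp N \<alpha>" k] \<alpha> truncate_exp_truncate_exp[OF Mf_le[of k]]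
      by simp
  qed
  have box: "f (k # \<alpha>) = f (min k N # truncate_exp N \<alpha>)" if \<alpha>: "length \<alpha> = s" for k \<alpha>
  proof (cases "k \<le> N")
    case True
    then show ?thesis using trunc[OF \<alpha>] by (simp add: min_absorb1)
  next
    case False
    then have "f (k # \<alpha>) = f (N # \<alpha>)" using stab[OF \<alpha>] N by simp
    with False show ?thesis using trunc[OF \<alpha>, of N] by (simp add: min_absorb2)
  qed
  have "f \<alpha> = f (truncate_exp N \<alpha>)" if \<alpha>: "length \<alpha> = Suc s" for \<alpha>
  proof -
    from \<alpha> obtain a \<beta> where "\<alpha> = a # \<beta>" "length \<beta> = s" by (auto simp: length_Suc_conv)
    then show ?thesis using box[of \<beta> a] by (metis truncate_exp_simps(2))
  qed
  then show ?case by blast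
qed (simp add: truncate_exp_def)

section \<open>Sequences of polynomial type\<close>

text \<open>Agreement for large arguments with a polynomial of degree less than \<open>r\<close>,
  expressed by the eventual vanishing of the \<open>r\<close>-th difference. Sums over exponents
  have simple differences, and the polynomial is only recovered later, in Newton form.\<close>

fun eventually_poly :: "nat \<Rightarrow> (nat \<Rightarrow> real) \<Rightarrow> bool" where
  "eventually_poly 0 f \<longleftrightarrow> (\<exists>N. \<forall>n\<ge>N. f n = 0)"
| "eventually_poly (Suc r) f \<longleftrightarrow> eventually_poly r (\<lambda>n. f (Suc n) - f n)"

lemma eventually_poly_Suc_shift: "eventually_poly r (\<lambda>n. f (Suc n)) \<longleftrightarrow> eventually_poly r f"
proof (induction r arbitrary: f)
  case 0
  show ?case
  proof
    assume "eventually_poly 0 (\<lambda>n. f (Suc n))"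
    then obtain N where "\<And>n. n \<ge> N \<Longrightarrow> f (Suc n) = 0" by auto
    then have "f n = 0" if "n \<ge> Suc N" for n using that by (metis Suc_le_D Suc_le_mono)
    then show "eventually_poly 0 f" by auto
  next
    assume "eventually_poly 0 f"
    then show "eventually_poly 0 (\<lambda>n. f (Suc n))" by (auto intro: le_SucI)
  qed
next
  case (Suc r)
  show ?case using Suc.IH[of "\<lambda>n. f (Suc n) - f n"] by simp
qed

lemma eventually_poly_add:
  "eventually_poly r f \<Longrightarrow> eventually_poly r g \<Longrightarrow> eventually_poly r (\<lambda>n. f n + g n)"
proof (induction r arbitrary: f g)
  case 0
  then obtain M N where "\<And>n. n \<ge> M \<Longrightarrow> f n = 0" "\<And>n. n \<ge> N \<Longrightarrow> g n = 0" by auto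
  then have "\<forall>n\<ge>max M N. f n + g n = 0" by simp
  then show ?case unfolding eventually_poly.simps by blast
next
  case (Suc r)
  then have "eventually_poly r (\<lambda>n. (f (Suc n) - f n) + (g (Suc n) - g n))" by simp
  then show ?case by (simp add: algebra_simps)
qed

lemma eventually_poly_mono: "eventually_poly r f \<Longrightarrow> r \<le> r' \<Longrightarrow> eventually_poly r' f"
proof (induction r arbitrary: f r')
  case 0
  then show ?case
  proof (induction r' arbitrary: f)
    case (Suc r')
    then obtain N where "\<And>n. n \<ge> N \<Longrightarrow> f n = 0" by auto
    then have "\<exists>N. \<forall>n\<ge>N. f (Suc n) - f n = 0" by (intro exI[of _ N]) simp
    then show ?case using Suc.IH by simp
  qed simp
next
  case (Suc r)
  then show ?case by (cases r') auto
qed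

text \<open>Newton's forward difference formula: the coefficients of the difference function move up
  by one index, and the new constant term is \<open>f N\<close>.\<close>

lemma eventually_poly_newton:
  "eventually_poly r f \<Longrightarrow> \<exists>N a. \<forall>n. f (n + N) = (\<Sum>i<r. a i * real (n choose i))"
proof (induction r arbitrary: f)
  case 0
  then show ?case by (metis eventually_poly.simps(1) le_add2 lessThan_0 sum.empty)
next
  case (Suc r)
  then have "\<exists>N a. \<forall>n. f (Suc (n + N)) - f (n + N) = (\<Sum>i<r. a i * real (n choose i))"
    using Suc.IH[of "\<lambda>n. f (Suc n) - f n"] by simp
  then obtain N a where a: "\<And>n. f (Suc (n + N)) - f (n + N) = (\<Sum>i<r. a i * real (n choose i))"
    by blast
  define b where "b i = (case i of 0 \<Rightarrow> f N | Suc j \<Rightarrow> a j)" for i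
  have "f (n + N) = (\<Sum>i<Suc r. b i * real (n choose i))" for n
  proof (induction n)
    case 0
    show ?case by (simp add: b_def sum.lessThan_Suc_shift del: sum.lessThan_Suc)
  next
    case (Suc n)
    have "f (Suc n + N) = f (n + N) + (\<Sum>i<r. a i * real (n choose i))" using a[of n] by simp
    also have "\<dots> = b 0 + (\<Sum>i<r. a i * real (n choose Suc i)) + (\<Sum>i<r. a i * real (n choose i))"
      unfolding Suc by (simp add: b_def sum.lessThan_Suc_shift del: sum.lessThan_Suc)
    also have "\<dots> = b 0 + (\<Sum>i<r. a i * real (Suc n choose Suc i))"
      by (simp add: algebra_simps sum.distrib)
    also have "\<dots> = (\<Sum>i<Suc r. b i * real (Suc n choose i))"
      by (simp add: b_def sum.lessThan_Suc_shift del: sum.lessThan_Suc binomial_Suc_Suc)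
    finally show ?case .
  qed
  then show ?case by blast
qed

lemma binomial_asymp: "(\<lambda>n. real (n choose i) / real n ^ i) \<longlonglongrightarrow> 1 / fact i"
proof (induction i)
  case 0
  have "\<forall>\<^sub>F n in sequentially. real (n choose 0) / real n ^ 0 = 1 / fact 0" by simp
  then show ?case by (simp add: tendsto_eventually)
next
  case (Suc i)
  have "(\<lambda>n. (real n - real i) / real n) \<longlonglongrightarrow> 1"
  proof (rule Lim_transform_eventually)
    show "(\<lambda>n. 1 - real i / real n) \<longlonglongrightarrow> 1"
      using tendsto_diff[OF tendsto_const lim_const_over_n[of "real i"], of 1] by simp
    show "\<forall>\<^sub>F n in sequentially. 1 - real i / real n = (real n - real i) / real n"
      using eventually_gt_at_top[of 0] by eventually_elim (simp add: field_simps)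
  qed
  from tendsto_mult[OF Suc this]
  have "(\<lambda>n. real (n choose i) / real n ^ i * ((real n - real i) / real n) / real (Suc i))
      \<longlonglongrightarrow> 1 / fact i * 1 / real (Suc i)" by (intro tendsto_divide) auto
  moreover have "real (n choose Suc i) / real n ^ Suc i =
      real (n choose i) / real n ^ i * ((real n - real i) / real n) / real (Suc i)" for n
  proof -
    have "real (Suc i) * real (n choose Suc i) = (real n - real i) * real (n choose i)"
    proof (cases "i \<le> n")
      case True
      have "Suc i * (n choose Suc i) = (n - i) * (n choose i)"
        using binomial_absorb_comp[of n i] binomial_absorption[of i n] by simp
      then have "real (Suc i * (n choose Suc i)) = real ((n - i) * (n choose i))" by (rule arg_cong)
      then show ?thesis by (simp only: of_nat_mult of_nat_diff[OF True])
    qed (simp add: binomial_eq_0)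
    then have "real (n choose Suc i) = (real n - real i) * real (n choose i) / real (Suc i)"
      by (simp add: field_simps)
    then show ?thesis by (simp add: mult_ac del: of_nat_Suc)
  qed
  ultimately show ?case by (simp add: field_simps)
qed

text \<open>A polynomial bounded by a \<open>d\<close>-th power has degree at most \<open>d\<close>:
  for \<open>r > d\<close> the quotients by \<open>n ^ r\<close> tend to
  \<open>a r / fact r\<close>, while the bound forces them to 0. The summand \<open>c\<close> leaves
  room for a shift of the argument.\<close>

lemma newton_sum_convergent:
  fixes a :: "nat \<Rightarrow> real"
  assumes bound: "\<And>n. \<bar>\<Sum>i<r. a i * real (n choose i)\<bar> \<le> C * (real n + c) ^ d"
  shows "convergent (\<lambda>n. (\<Sum>i<r. a i * real (n choose i)) / real n ^ d)"
  using assms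
proof (induction r)
  case 0
  then show ?case by (simp add: convergent_const)
next
  case (Suc r)
  have lower: "(\<lambda>n. real (n choose i) / real n ^ e) \<longlonglongrightarrow> 0" if "i < e" for i e
  proof -
    have "(\<lambda>n. real (n choose i) / real n ^ i * (1 / real n) ^ (e - i)) \<longlonglongrightarrow> 1 / fact i * 0 ^ (e - i)"
      by (intro tendsto_mult binomial_asymp tendsto_power lim_1_over_n)
    moreover have "\<forall>\<^sub>F n in sequentially. real (n choose i) / real n ^ i * (1 / real n) ^ (e - i) =
        real (n choose i) / real n ^ e"
      using eventually_gt_at_top[of 0]
      by eventually_elim (use that in \<open>simp add: power_one_over field_simps flip: power_add\<close>)
    ultimately show ?thesis using that by (simp add: tendsto_cong power_0_left)
  qed
  have lower': "convergent (\<lambda>n. real (n choose i) / real n ^ e)" if "i \<le> e" for i e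
    using lower[of i e] binomial_asymp[of i] that by (cases "i = e") (auto simp: convergent_def)
  show ?case
  proof (cases "r \<le> d")
    case True
    have "convergent (\<lambda>n. \<Sum>i<Suc r. a i * (real (n choose i) / real n ^ d))"
      using True lower' by (intro convergent_sum convergent_mult convergent_const) auto
    then show ?thesis by (simp add: sum_divide_distrib add_divide_distrib)
  next
    case False
    have "(\<lambda>n. \<Sum>i<Suc r. a i * (real (n choose i) / real n ^ r)) \<longlonglongrightarrow>
        (\<Sum>i<r. a i * 0) + a r * (1 / fact r)"
      unfolding sum.lessThan_Suc
      by (intro tendsto_add tendsto_sum tendsto_mult tendsto_const binomial_asymp lower) simp
    then have 1: "(\<lambda>n. (\<Sum>i<Suc r. a i * real (n choose i)) / real n ^ r) \<longlonglongrightarrow> a r / fact r"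
      by (simp add: sum_divide_distrib add_divide_distrib)
    have 2: "(\<lambda>n. (\<Sum>i<Suc r. a i * real (n choose i)) / real n ^ r) \<longlonglongrightarrow> 0"
    proof (rule tendsto_0_le[where K = 1])
      show "\<forall>\<^sub>F n in sequentially. norm ((\<Sum>i<Suc r. a i * real (n choose i)) / real n ^ r) \<le>
          norm (C * (1 + c / real n) ^ d * (1 / real n) ^ (r - d)) * 1"
        using eventually_gt_at_top[of 0]
      proof eventually_elim
        case (elim n)
        have "real n ^ r = real n ^ d * real n ^ (r - d)"
          using False by (simp flip: power_add)
        then have "C * (real n + c) ^ d / real n ^ r = C * (1 + c / real n) ^ d * (1 / real n) ^ (r - d)"
          using elim by (simp add: field_simps flip: power_mult_distrib)
        moreover have "norm ((\<Sum>i<Suc r. a i * real (n choose i)) / real n ^ r)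
            \<le> C * (real n + c) ^ d / real n ^ r"
          using Suc.prems[of n] by (simp add: divide_right_mono)
        ultimately show ?case by simp
      qed
      have "(\<lambda>n. C * (1 + c / real n) ^ d * (1 / real n) ^ (r - d)) \<longlonglongrightarrow> C * (1 + 0) ^ d * 0 ^ (r - d)"
        by (intro tendsto_mult tendsto_const tendsto_power tendsto_add lim_1_over_n lim_const_over_n)
      then show "(\<lambda>n. C * (1 + c / real n) ^ d * (1 / real n) ^ (r - d)) \<longlonglongrightarrow> 0"
        using False by (simp add: power_0_left)
    qed
    have "a r = 0" using LIMSEQ_unique[OF 1 2] by simp
    with Suc show ?thesis by simp
  qed
qed

text \<open>The Newton form describes only \<open>f (n + N)\<close>; returning to \<open>f\<close>
  costs the factor \<open>(n / (n + N)) ^ d\<close>, which tends to 1.\<close>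

lemma eventually_poly_convergent:
  assumes "eventually_poly r f" and "\<And>n. \<bar>f n\<bar> \<le> C * real n ^ d"
  shows "convergent (\<lambda>n. f n / real n ^ d)"
proof -
  obtain N a where a: "\<And>n. f (n + N) = (\<Sum>i<r. a i * real (n choose i))"
    using eventually_poly_newton[OF assms(1)] by blast
  have "convergent (\<lambda>n. (\<Sum>i<r. a i * real (n choose i)) / real n ^ d)"
    by (rule newton_sum_convergent[where C = C and c = "real N"]) (use assms(2)[of "_ + N"] a in simp)
  then obtain L where L: "(\<lambda>n. f (n + N) / real n ^ d) \<longlonglongrightarrow> L"
    unfolding a convergent_def by blast
  have "(\<lambda>n. 1 / (1 + real N / real n) ^ d) \<longlonglongrightarrow> 1 / (1 + 0) ^ d"
    by (intro tendsto_intros lim_const_over_n) simp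
  from tendsto_mult[OF L this]
  have "(\<lambda>n. f (n + N) / real n ^ d * (1 / (1 + real N / real n) ^ d)) \<longlonglongrightarrow> L" by simp
  moreover have "\<forall>\<^sub>F n in sequentially. f (n + N) / real n ^ d * (1 / (1 + real N / real n) ^ d) =
      f (n + N) / real (n + N) ^ d"
    using eventually_gt_at_top[of 0]
  proof eventually_elim
    case (elim n)
    then have "real n * (1 + real N / real n) = real (n + N)" by (simp add: field_simps)
    then have "real n ^ d * (1 + real N / real n) ^ d = real (n + N) ^ d"
      by (metis power_mult_distrib)
    then show ?case by (metis mult.right_neutral times_divide_times_eq)
  qed
  ultimately have "(\<lambda>n. f (n + N) / real (n + N) ^ d) \<longlonglongrightarrow> L" by (rule Lim_transform_eventually)
  then have "(\<lambda>n. f n / real n ^ d) \<longlonglongrightarrow> L" by (rule LIMSEQ_offset)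
  then show ?thesis by (auto simp: convergent_def)
qed

lemma sum_exponents_Suc:
  fixes w :: "nat list \<Rightarrow> real"
  shows "sum w (exponents (Suc s) (Suc n)) =
    (\<Sum>\<alpha>\<in>exponents s (Suc n). w (0 # \<alpha>)) + (\<Sum>\<alpha>\<in>exponents (Suc s) n. w (Suc (hd \<alpha>) # tl \<alpha>))"
proof -
  have "inj_on (\<lambda>\<alpha>. Suc (hd \<alpha>) # tl \<alpha>) (exponents (Suc s) n)"
  proof (rule inj_onI)
    fix \<alpha> \<beta> assume "\<alpha> \<in> exponents (Suc s) n" "\<beta> \<in> exponents (Suc s) n"
      "Suc (hd \<alpha>) # tl \<alpha> = Suc (hd \<beta>) # tl \<beta>"
    then show "\<alpha> = \<beta>" by (cases \<alpha>; cases \<beta>) (simp_all add: exponents_def)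
  qed
  then have "sum w ((\<lambda>\<alpha>. Suc (hd \<alpha>) # tl \<alpha>) ` exponents (Suc s) n) =
      (\<Sum>\<alpha>\<in>exponents (Suc s) n. w (Suc (hd \<alpha>) # tl \<alpha>))"
    by (simp add: sum.reindex)
  moreover have "sum w ((#) 0 ` exponents s (Suc n)) = (\<Sum>\<alpha>\<in>exponents s (Suc n). w (0 # \<alpha>))"
    by (simp add: sum.reindex)
  ultimately show ?thesis
    unfolding exponents_Suc_Suc by (subst sum.union_disjoint) auto
qed

text \<open>This takes the place of the Hilbert-Serre theorem: with \<open>w\<close> the length
  attached to a leading coefficient ideal, the sums are the values of a Hilbert function.\<close>

lemma sum_exponents_eventually_poly:
  fixes w :: "nat list \<Rightarrow> real"
  assumes "\<And>\<alpha>. length \<alpha> = s \<Longrightarrow> w \<alpha> = w (truncate_exp M \<alpha>)"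
  shows "\<exists>r. eventually_poly r (\<lambda>n. sum w (exponents s n))"
  using assms
proof (induction s arbitrary: w)
  case 0
  have "eventually_poly 0 (\<lambda>n. sum w (exponents 0 n))" by (auto simp: exponents_0 intro!: exI[of _ 1])
  then show ?case by blast
next
  case (Suc s)
  \<comment> \<open>Inner induction on the cap \<open>K\<close> of the first entry. For
    \<open>K = 0\<close> the weight ignores that entry, and the difference in \<open>n\<close> is a
    sum over one variable less; otherwise splitting off the vectors with first entry 0 lowers the
    cap by one.\<close>
  have "\<exists>r. eventually_poly r (\<lambda>n. sum w (exponents (Suc s) n))"
    if "\<And>a \<alpha>. length \<alpha> = s \<Longrightarrow> w (a # \<alpha>) = w (min a K # \<alpha>)"
      and "\<And>a \<alpha>. length \<alpha> = s \<Longrightarrow> w (a # \<alpha>) = w (a # truncate_exp M \<alpha>)" for K and w :: "nat list \<Rightarrow> real"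
    using that
  proof (induction K arbitrary: w)
    case (0 w)
    obtain r where r: "eventually_poly r (\<lambda>n. \<Sum>\<alpha>\<in>exponents s n. w (0 # \<alpha>))"
      using Suc.IH[of "\<lambda>\<alpha>. w (0 # \<alpha>)"] 0(2) by blast
    have "w (Suc (hd \<alpha>) # tl \<alpha>) = w \<alpha>" if \<alpha>: "\<alpha> \<in> exponents (Suc s) n" for \<alpha> n
    proof -
      from \<alpha> obtain a \<beta> where "\<alpha> = a # \<beta>" "length \<beta> = s" by (auto simp: exponents_def length_Suc_conv)
      then show ?thesis using 0(1)[of \<beta> "Suc a"] 0(1)[of \<beta> a] by simp
    qed
    then have "sum w (exponents (Suc s) (Suc n)) - sum w (exponents (Suc s) n) =
        (\<Sum>\<alpha>\<in>exponents s (Suc n). w (0 # \<alpha>))" for n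
      by (simp add: sum_exponents_Suc)
    then have "eventually_poly (Suc r) (\<lambda>n. sum w (exponents (Suc s) n))"
      using eventually_poly_Suc_shift[THEN iffD2, OF r] by simp
    then show ?case by blast
  next
    case (Suc K w)
    obtain r where r: "eventually_poly r (\<lambda>n. \<Sum>\<alpha>\<in>exponents s n. w (0 # \<alpha>))"
      using Suc.IH(1) Suc.prems(2) \<open>\<And>w. (\<And>\<alpha>. length \<alpha> = s \<Longrightarrow> w \<alpha> = w (truncate_exp M \<alpha>)) \<Longrightarrow>
        \<exists>r. eventually_poly r (\<lambda>n. sum w (exponents s n))\<close>[of "\<lambda>\<alpha>. w (0 # \<alpha>)"] by blast
    have "\<exists>r. eventually_poly r (\<lambda>n. \<Sum>\<alpha>\<in>exponents (Suc s) n. w (Suc (hd \<alpha>) # tl \<alpha>))"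
    proof (rule Suc.IH)
      fix a and \<alpha> :: "nat list" assume \<alpha>: "length \<alpha> = s"
      show "w (Suc (hd (a # \<alpha>)) # tl (a # \<alpha>)) = w (Suc (hd (min a K # \<alpha>)) # tl (min a K # \<alpha>))"
        using Suc.prems(1)[OF \<alpha>, of "Suc a"] by simp
      show "w (Suc (hd (a # \<alpha>)) # tl (a # \<alpha>)) =
          w (Suc (hd (a # truncate_exp M \<alpha>)) # tl (a # truncate_exp M \<alpha>))"
        using Suc.prems(2)[OF \<alpha>, of "Suc a"] by simp
    qed
    then obtain r' where r': "eventually_poly r' (\<lambda>n. \<Sum>\<alpha>\<in>exponents (Suc s) n. w (Suc (hd \<alpha>) # tl \<alpha>))"
      by blast
    have "eventually_poly (max r r') (\<lambda>n. sum w (exponents (Suc s) (Suc n)))"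
      unfolding sum_exponents_Suc
      using eventually_poly_Suc_shift[THEN iffD2, OF r] r'
      by (intro eventually_poly_add) (auto elim: eventually_poly_mono)
    then show ?case using eventually_poly_Suc_shift by blast
  qed
  moreover have "w (a # \<alpha>) = w (min a M # \<alpha>)" "w (a # \<alpha>) = w (a # truncate_exp M \<alpha>)"
    if \<alpha>: "length \<alpha> = s" for a \<alpha>
  proof -
    have *: "w (b # \<beta>) = w (min b M # truncate_exp M \<beta>)" if "length \<beta> = s" for b \<beta>
      using Suc.prems[of "b # \<beta>"] that by simp
    show "w (a # \<alpha>) = w (min a M # \<alpha>)" using *[OF \<alpha>, of a] *[OF \<alpha>, of "min a M"] by simp
    show "w (a # \<alpha>) = w (a # truncate_exp M \<alpha>)"
      using *[OF \<alpha>, of a] *[of "truncate_exp M \<alpha>" a] \<alpha> truncate_exp_truncate_exp[of M M \<alpha>] by simp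
  qed
  ultimately show ?case by blast
qed

section \<open>Powers of ideals\<close>

context cring
begin

lemma ideal_pow_0 [simp]: "ideal_pow R I 0 = carrier R"
proof -
  interpret M: comm_monoid "ideals_set R" by (rule ideals_set_is_comm_monoid)
  show ?thesis unfolding ideal_pow_def by (simp add: ideals_set_def)
qed

lemma ideal_pow_Suc: "ideal_pow R I (Suc n) = ideal_pow R I n \<cdot> I"
proof -
  interpret M: comm_monoid "ideals_set R" by (rule ideals_set_is_comm_monoid)
  show ?thesis unfolding ideal_pow_def by (simp add: ideals_set_def)
qed

lemma ideal_pow_ideal: "ideal I R \<Longrightarrow> ideal (ideal_pow R I n) R"
  by (induction n) (simp_all add: ideal_pow_Suc ideal_prod_is_ideal oneideal)

lemma ideal_pow_add:
  assumes "ideal I R" shows "ideal_pow R I (m + n) = ideal_pow R I m \<cdot> ideal_pow R I n"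
proof -
  interpret M: comm_monoid "ideals_set R" by (rule ideals_set_is_comm_monoid)
  show ?thesis using M.nat_pow_mult[of I m n] assms unfolding ideal_pow_def by (simp add: ideals_set_def)
qed

lemma ideal_pow_1: "ideal I R \<Longrightarrow> ideal_pow R I 1 = I"
proof -
  assume I: "ideal I R"
  interpret M: comm_monoid "ideals_set R" by (rule ideals_set_is_comm_monoid)
  show ?thesis using M.nat_pow_eone[of I] I unfolding ideal_pow_def by (simp add: ideals_set_def)
qed

lemma ideal_pow_pow:
  assumes "ideal I R" shows "ideal_pow R (ideal_pow R I m) n = ideal_pow R I (m * n)"
proof -
  interpret M: comm_monoid "ideals_set R" by (rule ideals_set_is_comm_monoid)
  show ?thesis using M.nat_pow_pow[of I m n] assms unfolding ideal_pow_def by (simp add: ideals_set_def)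
qed

lemma ideal_prod_least:
  assumes "ideal K R" "\<And>a b. a \<in> I \<Longrightarrow> b \<in> J \<Longrightarrow> a \<otimes> b \<in> K"
  shows "I \<cdot> J \<subseteq> K"
proof
  fix x assume "x \<in> I \<cdot> J"
  then show "x \<in> K" by (induction rule: ideal_prod.induct) (use assms ideal_a_closed in auto)
qed

lemma ideal_prod_mono: "I \<subseteq> I' \<Longrightarrow> J \<subseteq> J' \<Longrightarrow> I \<cdot> J \<subseteq> I' \<cdot> J'"
proof
  fix x assume "I \<subseteq> I'" "J \<subseteq> J'" "x \<in> I \<cdot> J"
  from this(3,1,2) show "x \<in> I' \<cdot> J'"
    by (induction rule: ideal_prod.induct) (auto intro: ideal_prod.intros)
qed

lemma ideal_prod_subset_left: "ideal I R \<Longrightarrow> ideal J R \<Longrightarrow> I \<cdot> J \<subseteq> I"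
  using ideal_prod_inter by blast

lemma ideal_pow_mono: "I \<subseteq> J \<Longrightarrow> ideal_pow R I n \<subseteq> ideal_pow R J n"
  by (induction n) (simp_all add: ideal_pow_Suc ideal_prod_mono)

lemma ideal_pow_antimono:
  assumes I: "ideal I R" and "m \<le> n" shows "ideal_pow R I n \<subseteq> ideal_pow R I m"
  using ideal_pow_add[OF I, of m "n - m"] ideal_prod_subset_left ideal_pow_ideal[OF I] assms(2) by simp

lemma mult_mem_ideal_pow:
  "ideal I R \<Longrightarrow> a \<in> ideal_pow R I m \<Longrightarrow> b \<in> ideal_pow R I n \<Longrightarrow> a \<otimes> b \<in> ideal_pow R I (m + n)"
  by (simp add: ideal_pow_add ideal_prod.prod)

lemma nat_pow_mem_ideal_pow: "ideal I R \<Longrightarrow> a \<in> I \<Longrightarrow> a [^] n \<in> ideal_pow R I n"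
  by (induction n) (simp_all add: ideal_pow_Suc ideal_prod.prod)

lemma mem_colon_iff: "r \<in> colon B x \<longleftrightarrow> r \<in> carrier R \<and> r \<otimes> x \<in> B"
  by (simp add: colon_def)

section \<open>Monomials\<close>

definition monomial :: "'a list \<Rightarrow> nat list \<Rightarrow> 'a" where
  "monomial xs \<alpha> = foldr (\<otimes>) (map2 (\<lambda>x k. x [^] k) xs \<alpha>) \<one>"

lemma monomial_simps [simp]:
  "monomial [] \<alpha> = \<one>" "monomial (x # xs) (k # \<alpha>) = x [^] k \<otimes> monomial xs \<alpha>"
  by (simp_all add: monomial_def)

lemma monomial_closed [simp]: "set xs \<subseteq> carrier R \<Longrightarrow> monomial xs \<alpha> \<in> carrier R"
proof (induction xs arbitrary: \<alpha>)
  case (Cons x xs)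
  then show ?case by (cases \<alpha>) (simp_all add: monomial_def)
qed simp

lemma monomial_exp_add:
  assumes "length xs = length \<alpha>" "length \<alpha> = length \<beta>" "set xs \<subseteq> carrier R"
  shows "monomial xs (exp_add \<alpha> \<beta>) = monomial xs \<alpha> \<otimes> monomial xs \<beta>"
  using assms
proof (induction xs \<alpha> \<beta> rule: list_induct3)
  case (Cons x xs a \<alpha> b \<beta>)
  then have c: "x \<in> carrier R" "monomial xs \<alpha> \<in> carrier R" "monomial xs \<beta> \<in> carrier R"
    by simp_all
  have "monomial (x # xs) (exp_add (a # \<alpha>) (b # \<beta>)) =
      (x [^] a \<otimes> x [^] b) \<otimes> (monomial xs \<alpha> \<otimes> monomial xs \<beta>)"
    using Cons c by (simp add: nat_pow_mult)
  also have "\<dots> = (x [^] a \<otimes> monomial xs \<alpha>) \<otimes> (x [^] b \<otimes> monomial xs \<beta>)"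
    using c nat_pow_closed[OF c(1), of a] nat_pow_closed[OF c(1), of b] by algebra
  finally show ?case by simp
qed simp

lemma monomial_replicate_0: "set xs \<subseteq> carrier R \<Longrightarrow> monomial xs (replicate (length xs) 0) = \<one>"
  by (induction xs) simp_all

definition unit_exp :: "nat \<Rightarrow> nat \<Rightarrow> nat list" where
  "unit_exp s i = (replicate s 0)[i := 1]"

lemma unit_exp_exponents: "i < s \<Longrightarrow> unit_exp s i \<in> exponents s 1"
proof (induction s arbitrary: i)
  case (Suc s)
  then show ?case by (cases i) (auto simp: unit_exp_def exponents_def)
qed simp

lemma monomial_unit_exp:
  "set xs \<subseteq> carrier R \<Longrightarrow> i < length xs \<Longrightarrow> monomial xs (unit_exp (length xs) i) = xs ! i"
proof (induction xs arbitrary: i)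
  case (Cons x xs)
  then show ?case
    by (cases i) (auto simp: unit_exp_def monomial_replicate_0 subset_iff)
qed simp

lemma exp_add_unit_exp: "i < length \<alpha> \<Longrightarrow> exp_add \<alpha> (unit_exp (length \<alpha>) i) = \<alpha>[i := Suc (\<alpha> ! i)]"
  by (rule nth_equalityI)
    (auto simp: exp_add_def unit_exp_def nth_list_update)

lemma monomial_mem_ideal_pow:
  assumes "ideal I R" "set xs \<subseteq> I" "length \<alpha> = length xs"
  shows "monomial xs \<alpha> \<in> ideal_pow R I (sum_list \<alpha>)"
  using assms(2,3)
proof (induction xs arbitrary: \<alpha>)
  case (Cons x xs)
  then obtain k \<beta> where "\<alpha> = k # \<beta>" by (cases \<alpha>) auto
  with Cons show ?case
    by (simp add: mult_mem_ideal_pow[OF assms(1)] nat_pow_mem_ideal_pow[OF assms(1)])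
qed simp

text \<open>The hard inclusion runs through colon ideals twice: first the generators of
  \<open>Q\<close> are tested against one monomial, then the monomials against an arbitrary element
  of \<open>Q\<close>.\<close>

lemma ideal_pow_Idl:
  assumes xs: "set xs \<subseteq> carrier R"
  shows "ideal_pow R (Idl (set xs)) n = Idl (monomial xs ` exponents (length xs) n)"
proof (rule antisym)
  let ?Q = "Idl (set xs)" and ?E = "\<lambda>n. Idl (monomial xs ` exponents (length xs) n)"
  have Q: "ideal ?Q R" using xs by (rule genideal_ideal)
  have E: "ideal (?E n) R" for n using xs by (intro genideal_ideal) auto
  have memE: "monomial xs \<alpha> \<in> ?E n" if "\<alpha> \<in> exponents (length xs) n" for \<alpha> n
  proof -
    have "monomial xs ` exponents (length xs) n \<subseteq> carrier R" using xs by auto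
    from genideal_self[OF this] that show ?thesis by blast
  qed
  show "?E n \<subseteq> ideal_pow R ?Q n"
  proof (rule genideal_minimal)
    show "ideal (ideal_pow R ?Q n) R" using ideal_pow_ideal[OF Q] .
    show "monomial xs ` exponents (length xs) n \<subseteq> ideal_pow R ?Q n"
      using monomial_mem_ideal_pow[OF Q genideal_self[OF xs]] by (auto simp: exponents_def)
  qed
  show "ideal_pow R ?Q n \<subseteq> ?E n"
  proof (induction n)
    case 0
    have "replicate (length xs) 0 \<in> exponents (length xs) 0" by (simp add: exponents_def)
    then have "\<one> \<in> ?E 0" using memE[of "replicate (length xs) 0" 0] monomial_replicate_0[OF xs] by simp
    then show ?case using ideal.one_imp_carrier[OF E] by simp
  next
    case (Suc n)
    have 1: "?Q \<subseteq> colon (?E (Suc n)) (monomial xs \<alpha>)" if \<alpha>: "\<alpha> \<in> exponents (length xs) n" for \<alpha>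
    proof (rule genideal_minimal)
      show "ideal (colon (?E (Suc n)) (monomial xs \<alpha>)) R" using E xs by (intro colon_ideal) auto
      show "set xs \<subseteq> colon (?E (Suc n)) (monomial xs \<alpha>)"
      proof
        fix x assume "x \<in> set xs"
        then obtain i where i: "i < length xs" "x = xs ! i" by (metis in_set_conv_nth)
        have len: "length \<alpha> = length xs" using \<alpha> by (simp add: exponents_def)
        have "exp_add (unit_exp (length xs) i) \<alpha> \<in> exponents (length xs) (1 + n)"
          using exp_add_exponents[OF unit_exp_exponents[OF i(1)] \<alpha>] .
        moreover have "monomial xs (exp_add (unit_exp (length xs) i) \<alpha>) = x \<otimes> monomial xs \<alpha>"
          using monomial_exp_add[OF _ _ xs, of "unit_exp (length xs) i" \<alpha>] monomial_unit_exp[OF xs i(1)] i len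
          by (simp add: unit_exp_def)
        ultimately have "x \<otimes> monomial xs \<alpha> \<in> ?E (Suc n)"
          using memE[of "exp_add (unit_exp (length xs) i) \<alpha>" "Suc n"] by simp
        then show "x \<in> colon (?E (Suc n)) (monomial xs \<alpha>)"
          using \<open>x \<in> set xs\<close> xs by (auto simp: mem_colon_iff)
      qed
    qed
    have 2: "?E n \<subseteq> colon (?E (Suc n)) q" if q: "q \<in> ?Q" for q
    proof (rule genideal_minimal)
      have qc: "q \<in> carrier R" using q Q ideal.Icarr by metis
      show "ideal (colon (?E (Suc n)) q) R" using E qc by (intro colon_ideal) auto
      show "monomial xs ` exponents (length xs) n \<subseteq> colon (?E (Suc n)) q"
      proof (rule image_subsetI)
        fix \<alpha> assume "\<alpha> \<in> exponents (length xs) n"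
        with 1[of \<alpha>] q have "q \<otimes> monomial xs \<alpha> \<in> ?E (Suc n)" by (auto simp: mem_colon_iff)
        then show "monomial xs \<alpha> \<in> colon (?E (Suc n)) q"
          using qc xs by (simp add: mem_colon_iff m_comm)
      qed
    qed
    show ?case unfolding ideal_pow_Suc
    proof (rule ideal_prod_least[OF E])
      fix a b assume "a \<in> ideal_pow R ?Q n" "b \<in> ?Q"
      with Suc 2[of b] show "a \<otimes> b \<in> ?E (Suc n)" by (auto simp: mem_colon_iff)
    qed
  qed
qed

section \<open>Leading coefficient ideals of filtrations\<close>

definition tail_ideal :: "(nat \<Rightarrow> 'a set) \<Rightarrow> 'a list \<Rightarrow> nat list \<Rightarrow> 'a set" where
  "tail_ideal C xs \<alpha> =
     Idl (C (sum_list \<alpha>) \<union> monomial xs ` {\<beta>\<in>exponents (length xs) (sum_list \<alpha>). \<alpha> < \<beta>})"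

text \<open>The ideal of leading coefficients at \<open>\<alpha>\<close> of the elements of \<open>C |\<alpha>|\<close>, where the leading
  monomial of a form in \<open>xs\<close> is the lexicographically least one.\<close>

definition leading_colon :: "(nat \<Rightarrow> 'a set) \<Rightarrow> 'a list \<Rightarrow> nat list \<Rightarrow> 'a set" where
  "leading_colon C xs \<alpha> = colon (tail_ideal C xs \<alpha>) (monomial xs \<alpha>)"

text \<open>The axioms of a graded submodule of a polynomial ring over \<open>R\<close>, read inside
  \<open>R\<close>. Three instances occur: \<open>Q^n \<inter> B\<close> for Artin-Rees,
  \<open>Q^(n+1)\<close> for Hilbert-Samuel functions, and \<open>m Q^n\<close> for the special
  fibre ring.\<close>

definition monomial_filtration :: "(nat \<Rightarrow> 'a set) \<Rightarrow> 'a list \<Rightarrow> bool" where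
  "monomial_filtration C xs \<longleftrightarrow> set xs \<subseteq> carrier R \<and> (\<forall>n. ideal (C n) R) \<and>
     (\<forall>n k. \<forall>\<gamma>\<in>exponents (length xs) k. \<forall>c\<in>C n. c \<otimes> monomial xs \<gamma> \<in> C (n + k))"

lemma tail_ideal_ideal:
  assumes "monomial_filtration C xs" shows "ideal (tail_ideal C xs \<alpha>) R"
proof -
  have "set xs \<subseteq> carrier R" "C (sum_list \<alpha>) \<subseteq> carrier R"
    using assms ideal_subset_carrier by (auto simp: monomial_filtration_def)
  then show ?thesis unfolding tail_ideal_def by (intro genideal_ideal) auto
qed

lemma leading_colon_ideal:
  assumes "monomial_filtration C xs" shows "ideal (leading_colon C xs \<alpha>) R"
  unfolding leading_colon_def using tail_ideal_ideal[OF assms] assms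
  by (intro colon_ideal) (auto simp: monomial_filtration_def)

text \<open>The order is invariant under translation by \<gamma>, so multiplication by
  \<open>monomial xs \<gamma>\<close> moves later monomials to later monomials, and it respects the
  filtration.\<close>

lemma tail_ideal_exp_add:
  assumes C: "monomial_filtration C xs" and len: "length \<alpha> = length xs" "length \<gamma> = length xs"
  shows "tail_ideal C xs \<alpha> \<subseteq> colon (tail_ideal C xs (exp_add \<alpha> \<gamma>)) (monomial xs \<gamma>)"
proof -
  let ?s = "length xs" let ?n = "sum_list \<alpha>" let ?k = "sum_list \<gamma>"
  let ?D = "Idl (C ?n \<union> monomial xs ` {\<beta>\<in>exponents ?s ?n. \<alpha> < \<beta>})"
  let ?D' = "Idl (C (?n + ?k) \<union> monomial xs ` {\<beta>\<in>exponents ?s (?n + ?k). exp_add \<alpha> \<gamma> < \<beta>})"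
  have xs: "set xs \<subseteq> carrier R" and Ci: "ideal (C n) R" for n
    using C by (auto simp: monomial_filtration_def)
  have Cc: "C n \<subseteq> carrier R" for n using Ci ideal_subset_carrier by auto
  have carr: "C (?n + ?k) \<union> monomial xs ` {\<beta>\<in>exponents ?s (?n + ?k). exp_add \<alpha> \<gamma> < \<beta>} \<subseteq> carrier R"
    using xs Cc by auto
  have D': "ideal ?D' R" using carr by (rule genideal_ideal)
  have sub: "?D \<subseteq> colon ?D' (monomial xs \<gamma>)"
  proof (rule genideal_minimal)
    show "ideal (colon ?D' (monomial xs \<gamma>)) R" using D' xs by (intro colon_ideal) auto
    show "C ?n \<union> monomial xs ` {\<beta>\<in>exponents ?s ?n. \<alpha> < \<beta>} \<subseteq> colon ?D' (monomial xs \<gamma>)"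
    proof (rule Un_least)
      have \<gamma>: "\<gamma> \<in> exponents ?s ?k" using len by (simp add: exponents_def)
      have "c \<otimes> monomial xs \<gamma> \<in> C (?n + ?k)" if "c \<in> C ?n" for c
        using C \<gamma> that unfolding monomial_filtration_def by blast
      then show "C ?n \<subseteq> colon ?D' (monomial xs \<gamma>)"
        using genideal_self[OF carr] Cc[of ?n] unfolding mem_colon_iff subset_iff by blast
      show "monomial xs ` {\<beta>\<in>exponents ?s ?n. \<alpha> < \<beta>} \<subseteq> colon ?D' (monomial xs \<gamma>)"
      proof (rule image_subsetI)
        fix \<beta> assume \<beta>: "\<beta> \<in> {\<beta>\<in>exponents ?s ?n. \<alpha> < \<beta>}"
        then have "length \<beta> = ?s" by (simp add: exponents_def)
        then have "monomial xs (exp_add \<beta> \<gamma>) = monomial xs \<beta> \<otimes> monomial xs \<gamma>"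
          using len xs by (intro monomial_exp_add) auto
        moreover have "exp_add \<beta> \<gamma> \<in> {\<beta>\<in>exponents ?s (?n + ?k). exp_add \<alpha> \<gamma> < \<beta>}"
          using \<beta> \<gamma> exp_add_exponents exp_add_less_mono[of \<alpha> \<beta> \<gamma>] len \<open>length \<beta> = ?s\<close> by auto
        ultimately have "monomial xs \<beta> \<otimes> monomial xs \<gamma> \<in> ?D'"
          using genideal_self[OF carr] by (metis (no_types, lifting) UnI2 image_eqI subsetD)
        then show "monomial xs \<beta> \<in> colon ?D' (monomial xs \<gamma>)" using xs by (simp add: mem_colon_iff)
      qed
    qed
  qed
  then show ?thesis using len by (simp add: tail_ideal_def sum_list_exp_add)
qed

text \<open>Leading coefficients persist under multiplication by monomials. This monotonicity is
  what makes the finiteness principle for monotone families applicable.\<close>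

lemma leading_colon_exp_add:
  assumes C: "monomial_filtration C xs" and len: "length \<alpha> = length xs" "length \<gamma> = length xs"
  shows "leading_colon C xs \<alpha> \<subseteq> leading_colon C xs (exp_add \<alpha> \<gamma>)"
proof
  have xs: "set xs \<subseteq> carrier R" using C by (simp add: monomial_filtration_def)
  fix r assume "r \<in> leading_colon C xs \<alpha>"
  then have r: "r \<in> carrier R" "r \<otimes> monomial xs \<alpha> \<in> tail_ideal C xs \<alpha>"
    by (auto simp: leading_colon_def mem_colon_iff)
  have "r \<otimes> monomial xs (exp_add \<alpha> \<gamma>) = (r \<otimes> monomial xs \<alpha>) \<otimes> monomial xs \<gamma>"
    using monomial_exp_add[OF _ _ xs, of \<alpha> \<gamma>] len r(1) xs by (simp add: m_assoc)
  also have "\<dots> \<in> tail_ideal C xs (exp_add \<alpha> \<gamma>)"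
    using tail_ideal_exp_add[OF assms] r(2) by (auto simp: mem_colon_iff)
  finally show "r \<in> leading_colon C xs (exp_add \<alpha> \<gamma>)"
    using r(1) by (simp add: leading_colon_def mem_colon_iff)
qed

end

lemma exp_le_imp_exp_add:
  "list_all2 (\<le>) \<alpha> \<beta> \<Longrightarrow> \<exists>\<gamma>. length \<gamma> = length \<alpha> \<and> \<beta> = exp_add \<alpha> \<gamma>"
proof (induction rule: list_all2_induct)
  case (Cons a \<alpha> b \<beta>)
  then obtain \<gamma> where "length \<gamma> = length \<alpha>" "\<beta> = exp_add \<alpha> \<gamma>" by blast
  with Cons have "length ((b - a) # \<gamma>) = length (a # \<alpha>)" "b # \<beta> = exp_add (a # \<alpha>) ((b - a) # \<gamma>)"
    by simp_all
  then show ?case by blast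
qed simp

locale noetherian_cring = cring R + noetherian_ring R for R (structure)

sublocale noetherian_local_ring \<subseteq> noetherian_cring ..

context noetherian_cring
begin

lemma ideal_ascending_chain:
  fixes h :: "nat \<Rightarrow> 'a set"
  assumes "\<And>k. ideal (h k) R" "\<And>k. h k \<subseteq> h (Suc k)"
  shows "\<exists>K. \<forall>k\<ge>K. h k = h K"
proof -
  have mono: "h k \<subseteq> h l" if "k \<le> l" for k l using lift_Suc_mono_le[of h, OF assms(2) that] .
  have "subset.chain {I. ideal I R} (range h)"
    unfolding subset_chain_def
  proof (intro conjI ballI)
    fix x y assume "x \<in> range h" "y \<in> range h"
    then obtain k l where "x = h k" "y = h l" by blast
    then show "x \<subseteq> y \<or> y \<subseteq> x" using mono[of k l] mono[of l k] by (cases "k \<le> l") auto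
  qed (use assms(1) in blast)
  then have "\<Union>(range h) \<in> range h" by (intro ideal_chain_is_trivial) auto
  then obtain K where "\<Union>(range h) = h K" by auto
  then have "h k = h K" if "k \<ge> K" for k using mono[OF that] by blast
  then show ?thesis by blast
qed

text \<open>All leading coefficient ideals already occur in a finite box of exponents. This
  substitutes for Noetherianity of the Rees algebra.\<close>

lemma leading_colon_truncate:
  assumes C: "monomial_filtration C xs"
  shows "\<exists>M. \<forall>\<alpha>. length \<alpha> = length xs \<longrightarrow>
    leading_colon C xs \<alpha> = leading_colon C xs (truncate_exp M \<alpha>)"
proof (rule monotone_family_truncate[where L = "{I. ideal I R}"])
  fix \<alpha> \<beta> :: "nat list" assume "length \<beta> = length xs" and le: "list_all2 (\<le>) \<alpha> \<beta>"
  then show "leading_colon C xs \<alpha> \<subseteq> leading_colon C xs \<beta>"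
    using exp_le_imp_exp_add[OF le] leading_colon_exp_add[OF C] list_all2_lengthD[OF le] by auto
qed (use leading_colon_ideal[OF C] ideal_ascending_chain in auto)

section \<open>Artin-Rees\<close>

text \<open>Division with remainder: in degrees above \<open>length xs * M\<close> every exponent
  has an entry exceeding the cap, so a leading coefficient at \<alpha> already occurs one degree
  lower, and the leading term is cancelled by a multiple of some \<open>xs ! i\<close>.\<close>

lemma monomial_filtration_stable:
  assumes C: "monomial_filtration C xs"
    and sub: "\<And>n. C n \<subseteq> ideal_pow R (Idl (set xs)) n"
  shows "\<exists>n0. \<forall>n\<ge>n0. C (Suc n) \<subseteq> C n \<cdot> (Idl (set xs))"
proof -
  let ?s = "length xs" let ?Q = "Idl (set xs)"
  have xs: "set xs \<subseteq> carrier R" and Ci: "ideal (C n) R" for n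
    using C by (auto simp: monomial_filtration_def)
  have Cc: "C n \<subseteq> carrier R" for n using Ci ideal_subset_carrier by auto
  have Q: "ideal ?Q R" using xs by (rule genideal_ideal)
  obtain M where M: "\<And>\<alpha>. length \<alpha> = ?s \<Longrightarrow> leading_colon C xs \<alpha> = leading_colon C xs (truncate_exp M \<alpha>)"
    using leading_colon_truncate[OF C] by blast
  have "C (Suc n) \<subseteq> C n \<cdot> ?Q" if n: "n \<ge> ?s * M" for n
  proof -
    \<comment> \<open>Induction over final segments \<open>U\<close> of the exponents of degree
      \<open>Suc n\<close>: once the term at the smallest exponent is cancelled, the rest is spanned
      by the larger ones.\<close>
    have ind: "C (Suc n) \<inter> Idl (monomial xs ` U) \<subseteq> C n \<cdot> ?Q"
      if "finite U" "U \<subseteq> exponents ?s (Suc n)"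
        "\<And>\<alpha> \<beta>. \<alpha> \<in> U \<Longrightarrow> \<beta> \<in> exponents ?s (Suc n) \<Longrightarrow> \<alpha> < \<beta> \<Longrightarrow> \<beta> \<in> U" for U
      using that
    proof (induction U rule: finite_linorder_min_induct)
      case empty
      have "ideal (C n \<cdot> ?Q) R" using Ci Q by (rule ideal_prod_is_ideal)
      moreover have "Idl (monomial xs ` {}) \<subseteq> {\<zero>}" by (rule genideal_minimal[OF zeroideal]) auto
      ultimately show ?case using ideal_zero_closed by blast
    next
      case (insert \<alpha> U)
      have \<alpha>: "\<alpha> \<in> exponents ?s (Suc n)" "length \<alpha> = ?s" "sum_list \<alpha> = Suc n"
        using insert.prems by (auto simp: exponents_def)
      have U: "U = {\<beta>\<in>exponents ?s (Suc n). \<alpha> < \<beta>}"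
        using insert.hyps(2) insert.prems(1) insert.prems(2)[of \<alpha>] by auto
      have Uc: "monomial xs ` U \<subseteq> carrier R" using xs by auto
      have IH: "C (Suc n) \<inter> Idl (monomial xs ` U) \<subseteq> C n \<cdot> ?Q"
      proof (rule insert.IH)
        show "U \<subseteq> exponents ?s (Suc n)" using insert.prems(1) by simp
        fix \<beta> \<gamma> assume "\<beta> \<in> U" "\<gamma> \<in> exponents ?s (Suc n)" "\<beta> < \<gamma>"
        then show "\<gamma> \<in> U" unfolding U by (auto intro: less_trans)
      qed
      have "\<exists>i<?s. \<alpha> ! i > M"
      proof (rule ccontr)
        assume "\<not> (\<exists>i<?s. \<alpha> ! i > M)"
        then have "\<And>a. a \<in> set \<alpha> \<Longrightarrow> a \<le> M" using \<alpha>(2) by (metis in_set_conv_nth not_less)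
        then have "sum_list \<alpha> \<le> ?s * M"
          using sum_list_mono[of \<alpha> "\<lambda>x. x" "\<lambda>_. M"] \<alpha>(2) by (simp add: sum_list_triv)
        with \<alpha>(3) n show False by simp
      qed
      then obtain i where i: "i < ?s" "\<alpha> ! i > M" by blast
      define \<alpha>' where "\<alpha>' = \<alpha>[i := \<alpha> ! i - 1]"
      let ?e = "unit_exp ?s i"
      have len': "length \<alpha>' = ?s" using \<alpha> by (simp add: \<alpha>'_def)
      have e: "?e \<in> exponents ?s 1" "length ?e = ?s" "sum_list ?e = 1"
        using unit_exp_exponents[OF i(1)] by (auto simp: exponents_def)
      have add: "exp_add \<alpha>' ?e = \<alpha>"
        using exp_add_unit_exp[of i \<alpha>'] i \<alpha> by (simp add: \<alpha>'_def)
      have sum': "sum_list \<alpha>' = n" using sum_list_exp_add[of \<alpha>' ?e] add e len' \<alpha>(3) by simp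
      \<comment> \<open>As \<open>\<alpha> ! i > M\<close>, the lowered entry is still at least
        \<open>M\<close> and is capped to the same value.\<close>
      have "truncate_exp M \<alpha>' = truncate_exp M \<alpha>"
        using i \<alpha> by (auto simp: truncate_exp_def \<alpha>'_def map_update list_update_same_conv min_def)
      then have same: "leading_colon C xs \<alpha>' = leading_colon C xs \<alpha>"
        using M[of \<alpha>] M[of \<alpha>'] \<alpha> len' by simp
      let ?T = "monomial xs ` {\<beta>\<in>exponents ?s n. \<alpha>' < \<beta>}"
      have Tc: "?T \<subseteq> carrier R" using xs by auto
      have mx: "monomial xs \<alpha> = monomial xs \<alpha>' \<otimes> xs ! i"
        using monomial_exp_add[OF _ _ xs, of \<alpha>' ?e] add monomial_unit_exp[OF xs i(1)] len' e by simp
      have xi: "xs ! i \<in> set xs" "xs ! i \<in> carrier R" using i xs by auto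
      have "Idl ?T \<subseteq> colon (Idl (monomial xs ` U)) (xs ! i)"
      proof (rule genideal_minimal)
        show "ideal (colon (Idl (monomial xs ` U)) (xs ! i)) R"
          using Uc xi by (intro colon_ideal genideal_ideal) auto
        show "?T \<subseteq> colon (Idl (monomial xs ` U)) (xs ! i)"
        proof (rule image_subsetI)
          fix \<beta> assume \<beta>: "\<beta> \<in> {\<beta>\<in>exponents ?s n. \<alpha>' < \<beta>}"
          then have lb: "length \<beta> = ?s" by (simp add: exponents_def)
          have "exp_add \<beta> ?e \<in> exponents ?s (n + 1)" using \<beta> e by (intro exp_add_exponents) auto
          moreover have "\<alpha> < exp_add \<beta> ?e"
            using exp_add_less_mono[of \<alpha>' \<beta> ?e] \<beta> lb len' e add by auto
          ultimately have "monomial xs (exp_add \<beta> ?e) \<in> Idl (monomial xs ` U)"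
            using genideal_self[OF Uc] unfolding U by auto
          moreover have "monomial xs (exp_add \<beta> ?e) = monomial xs \<beta> \<otimes> xs ! i"
            using monomial_exp_add[OF _ _ xs, of \<beta> ?e] lb monomial_unit_exp[OF xs i(1)] e by simp
          ultimately show "monomial xs \<beta> \<in> colon (Idl (monomial xs ` U)) (xs ! i)"
            using xs by (simp add: mem_colon_iff)
        qed
      qed
      note shift = this
      show ?case
      proof
        fix g assume g: "g \<in> C (Suc n) \<inter> Idl (monomial xs ` insert \<alpha> U)"
        have IU: "ideal (Idl (monomial xs ` U)) R" using Uc by (rule genideal_ideal)
        from g obtain h r where hr: "h \<in> Idl (monomial xs ` U)" "r \<in> carrier R"
            "g = h \<oplus> r \<otimes> monomial xs \<alpha>"
          using mem_Idl_insert[OF Uc, of "monomial xs \<alpha>" g] xs by auto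
        have c: "h \<in> carrier R" "monomial xs \<alpha> \<in> carrier R" "monomial xs \<alpha>' \<in> carrier R" "g \<in> carrier R"
          using ideal.Icarr[OF IU hr(1)] xs subsetD[OF Cc[of "Suc n"], of g] g by simp_all
        have "r \<otimes> monomial xs \<alpha> = g \<ominus> h" unfolding hr(3) using c hr(2) by algebra
        moreover have "g \<ominus> h \<in> Idl (C (Suc n) \<union> monomial xs ` U)"
        proof (rule ideal_minus_closed)
          show "ideal (Idl (C (Suc n) \<union> monomial xs ` U)) R" using Cc Uc by (intro genideal_ideal) auto
          show "g \<in> Idl (C (Suc n) \<union> monomial xs ` U)"
            using genideal_self[of "C (Suc n) \<union> monomial xs ` U"] Cc Uc g by auto
          show "h \<in> Idl (C (Suc n) \<union> monomial xs ` U)"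
            using Idl_mono[of "monomial xs ` U" "C (Suc n) \<union> monomial xs ` U"] Cc Uc hr(1) by auto
        qed
        ultimately have "r \<in> leading_colon C xs \<alpha>"
          using hr(2) \<alpha> by (simp add: leading_colon_def tail_ideal_def mem_colon_iff U)
        then have "r \<otimes> monomial xs \<alpha>' \<in> Idl (C n \<union> ?T)"
          using same sum' by (auto simp: leading_colon_def tail_ideal_def mem_colon_iff)
        then have "r \<otimes> monomial xs \<alpha>' \<in> C n <+> Idl ?T"
          using Idl_Un_Idl[OF Cc Tc] Idl_ideal[OF Ci] by simp
        then obtain g' h' where gh: "g' \<in> C n" "h' \<in> Idl ?T" "r \<otimes> monomial xs \<alpha>' = g' \<oplus> h'"
          by (auto simp: mem_set_add)
        have c': "g' \<in> carrier R" "h' \<in> carrier R"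
          using gh Cc ideal_subset_carrier[OF genideal_ideal[OF Tc]] by auto
        have "r \<otimes> monomial xs \<alpha> = (r \<otimes> monomial xs \<alpha>') \<otimes> xs ! i"
          unfolding mx using hr c xi by (simp add: m_assoc)
        also have "\<dots> = g' \<otimes> xs ! i \<oplus> h' \<otimes> xs ! i"
          unfolding gh(3) using c' xi by (simp add: l_distr)
        \<comment> \<open>The term at \<alpha> has cancelled, so the induction hypothesis applies to
          this difference.\<close>
        finally have "g \<ominus> g' \<otimes> xs ! i = h \<oplus> h' \<otimes> xs ! i"
          unfolding hr(3) using c c' hr(2) xi by algebra
        moreover have "h \<oplus> h' \<otimes> xs ! i \<in> Idl (monomial xs ` U)"
          using hr(1) shift gh(2) ideal_a_closed[OF IU] by (auto simp: mem_colon_iff)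
        moreover have "g' \<otimes> xs ! i \<in> C (n + 1)"
          using C e(1) gh(1) monomial_unit_exp[OF xs i(1)] unfolding monomial_filtration_def by metis
        then have "g \<ominus> g' \<otimes> xs ! i \<in> C (Suc n)" using g ideal_minus_closed[OF Ci] by simp
        ultimately have "g \<ominus> g' \<otimes> xs ! i \<in> C n \<cdot> ?Q" using IH by auto
        moreover have "g' \<otimes> xs ! i \<in> C n \<cdot> ?Q"
          using gh(1) genideal_self[OF xs] xi by (intro ideal_prod.prod) auto
        ultimately have "(g \<ominus> g' \<otimes> xs ! i) \<oplus> g' \<otimes> xs ! i \<in> C n \<cdot> ?Q" by (rule ideal_prod.sum)
        also have "(g \<ominus> g' \<otimes> xs ! i) \<oplus> g' \<otimes> xs ! i = g" using c c' xi by algebra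
        finally show "g \<in> C n \<cdot> ?Q" .
      qed
    qed
    show ?thesis
      using ind[of "exponents ?s (Suc n)"] sub[of "Suc n"] ideal_pow_Idl[OF xs, of "Suc n"] by auto
  qed
  then show ?thesis by blast
qed

text \<open>Stability of the filtration \<open>Q^n \<inter> B\<close>; the Artin-Rees constant is
  the degree from which it is stable.\<close>

lemma artin_rees:
  assumes xs: "set xs \<subseteq> carrier R" and B: "ideal B R"
  shows "\<exists>c. \<forall>n. ideal_pow R (Idl (set xs)) (n + c) \<inter> B \<subseteq> B \<cdot> ideal_pow R (Idl (set xs)) n"
proof -
  let ?Q = "Idl (set xs)"
  have Q: "ideal ?Q R" using xs by (rule genideal_ideal)
  note Qn = ideal_pow_ideal[OF Q]
  let ?C = "\<lambda>n. ideal_pow R ?Q n \<inter> B"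
  have C: "monomial_filtration ?C xs"
    unfolding monomial_filtration_def
  proof (intro conjI allI ballI)
    show "set xs \<subseteq> carrier R" by fact
    show "ideal (?C n) R" for n using Qn B by (rule i_intersect)
    show "c \<otimes> monomial xs \<gamma> \<in> ?C (n + k)"
      if "\<gamma> \<in> exponents (length xs) k" "c \<in> ?C n" for n k c \<gamma>
    proof -
      have "monomial xs \<gamma> \<in> ideal_pow R ?Q k"
        using monomial_mem_ideal_pow[OF Q genideal_self[OF xs], of \<gamma>] that by (simp add: exponents_def)
      then show ?thesis
        using that mult_mem_ideal_pow[OF Q] ideal.I_r_closed[OF B] xs by simp
    qed
  qed
  obtain n0 where n0: "\<And>n. n \<ge> n0 \<Longrightarrow> ?C (Suc n) \<subseteq> ?C n \<cdot> ?Q"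
    using monomial_filtration_stable[OF C] by blast
  have "?C (n + n0) \<subseteq> B \<cdot> ideal_pow R ?Q n" for n
  proof (induction n)
    case 0
    have "B \<subseteq> B \<cdot> carrier R" using ideal_prod.prod[of _ B \<one> "carrier R" R] B ideal.Icarr[OF B] by fastforce
    then show ?case by auto
  next
    case (Suc n)
    have "?C (Suc n + n0) \<subseteq> ?C (n + n0) \<cdot> ?Q" using n0[of "n + n0"] by simp
    also have "\<dots> \<subseteq> (B \<cdot> ideal_pow R ?Q n) \<cdot> ?Q" using Suc by (rule ideal_prod_mono) simp
    also have "\<dots> = B \<cdot> ideal_pow R ?Q (Suc n)"
      unfolding ideal_pow_Suc using B Qn Q by (intro ideal_prod_assoc) auto
    finally show ?case .
  qed
  then show ?thesis by blast
qed

end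

section \<open>Hilbert-Samuel functions\<close>

lemma real_the_enat_sum:
  fixes f :: "'i \<Rightarrow> enat"
  assumes "finite S" "\<And>i. i \<in> S \<Longrightarrow> f i < \<infinity>"
  shows "(\<Sum>i\<in>S. f i) < \<infinity> \<and> real (the_enat (\<Sum>i\<in>S. f i)) = (\<Sum>i\<in>S. real (the_enat (f i)))"
  using assms
proof (induction S rule: finite_induct)
  case (insert x F)
  then obtain a b where "f x = enat a" "sum f F = enat b"
    by (metis enat_ord_simps(4) insertI1 insertI2 not_enat_eq)
  with insert show ?case by auto
qed (simp add: zero_enat_def)

definition (in ring) colength :: "'a set \<Rightarrow> real" where
  "colength B = real (the_enat (ideal_length B (carrier R)))"

text \<open>The condition under which \<open>colength\<close> is a genuine length,
  \<open>the_enat\<close> being meaningless at infinity.\<close>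

definition (in ring) cofinite :: "'a set \<Rightarrow> bool" where
  "cofinite B \<longleftrightarrow> ideal B R \<and> ideal_length B (carrier R) < \<infinity>"

context ring
begin

lemma cofinite_superset: "cofinite B \<Longrightarrow> ideal A R \<Longrightarrow> B \<subseteq> A \<Longrightarrow> cofinite A"
  unfolding cofinite_def using ideal_length_mono[of B A "carrier R" "carrier R"] le_less_trans by blast

lemma colength_nonneg [simp]: "0 \<le> colength B"
  by (simp add: colength_def)

lemma colength_diff:
  assumes B: "cofinite B" and A: "ideal A R" and sub: "B \<subseteq> A"
  shows "ideal_length B A = enat (the_enat (ideal_length B A))"
    and "colength B = real (the_enat (ideal_length B A)) + colength A"
proof -
  have "ideal_length B (carrier R) = ideal_length B A + ideal_length A (carrier R)"
    using B A sub ideal_subset_carrier[OF A] by (intro ideal_length_add oneideal) (auto simp: cofinite_def)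
  moreover have "ideal_length B (carrier R) < \<infinity>" using B by (simp add: cofinite_def)
  ultimately obtain a b where ab: "ideal_length B A = enat a" "ideal_length A (carrier R) = enat b"
      "ideal_length B (carrier R) = enat (a + b)"
    by (cases "ideal_length B A"; cases "ideal_length A (carrier R)") auto
  then show "ideal_length B A = enat (the_enat (ideal_length B A))"
    "colength B = real (the_enat (ideal_length B A)) + colength A"
    by (simp_all add: colength_def)
qed

lemma colength_antimono: "cofinite B \<Longrightarrow> ideal A R \<Longrightarrow> B \<subseteq> A \<Longrightarrow> colength A \<le> colength B"
  using colength_diff(2)[of B A] by simp

lemma colength_carrier [simp]: "colength (carrier R) = 0"
  by (simp add: colength_def ideal_length_self oneideal zero_enat_def del: enat_0)

end

context noetherian_cring
begin

text \<open>The shift by one is deliberate: leading coefficients at \<alpha> then describe the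
  relations between the monomials in \<open>Q^n / Q^(n+1)\<close> with
  \<open>n = sum_list \<alpha>\<close>.\<close>

lemma monomial_filtration_ideal_pow:
  assumes xs: "set xs \<subseteq> carrier R"
  shows "monomial_filtration (\<lambda>n. ideal_pow R (Idl (set xs)) (Suc n)) xs"
  unfolding monomial_filtration_def
proof (intro conjI allI ballI)
  let ?Q = "Idl (set xs)"
  have Q: "ideal ?Q R" using xs by (rule genideal_ideal)
  show "set xs \<subseteq> carrier R" by fact
  show "ideal (ideal_pow R ?Q (Suc n)) R" for n using ideal_pow_ideal[OF Q] .
  fix n k \<gamma> c assume "\<gamma> \<in> exponents (length xs) k" "c \<in> ideal_pow R ?Q (Suc n)"
  then show "c \<otimes> monomial xs \<gamma> \<in> ideal_pow R ?Q (Suc (n + k))"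
    using mult_mem_ideal_pow[OF Q, of c "Suc n" "monomial xs \<gamma>" k]
      monomial_mem_ideal_pow[OF Q genideal_self[OF xs], of \<gamma>] by (auto simp: exponents_def)
qed

abbreviation hilbert_colon :: "'a list \<Rightarrow> nat list \<Rightarrow> 'a set" where
  "hilbert_colon xs \<equiv> leading_colon (\<lambda>n. ideal_pow R (Idl (set xs)) (Suc n)) xs"

text \<open>The monomials of degree \<open>n\<close> generate \<open>Q^n\<close> over
  \<open>Q^(n+1)\<close>; adjoining them from the lexicographically largest downwards gives cyclic
  quotients by the leading coefficient ideals.\<close>

lemma ideal_length_pow_Suc:
  assumes xs: "set xs \<subseteq> carrier R"
  shows "ideal_length (ideal_pow R (Idl (set xs)) (Suc n)) (ideal_pow R (Idl (set xs)) n) =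
    (\<Sum>\<alpha>\<in>exponents (length xs) n. ideal_length (hilbert_colon xs \<alpha>) (carrier R))"
proof -
  let ?Q = "Idl (set xs)" let ?E = "exponents (length xs) n"
  let ?B = "ideal_pow R ?Q (Suc n)"
  have Q: "ideal ?Q R" using xs by (rule genideal_ideal)
  have B: "ideal ?B R" using ideal_pow_ideal[OF Q] .
  have mc: "monomial xs ` ?E \<subseteq> carrier R" using xs by auto
  have "Idl (?B \<union> monomial xs ` ?E) = ideal_pow R ?Q n"
  proof (rule antisym)
    show "Idl (?B \<union> monomial xs ` ?E) \<subseteq> ideal_pow R ?Q n"
      using ideal_pow_ideal[OF Q] ideal_pow_antimono[OF Q, of n "Suc n"]
        monomial_mem_ideal_pow[OF Q genideal_self[OF xs]]
      by (intro genideal_minimal) (auto simp: exponents_def)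
    show "ideal_pow R ?Q n \<subseteq> Idl (?B \<union> monomial xs ` ?E)"
      unfolding ideal_pow_Idl[OF xs, of n] using mc ideal_subset_carrier[OF B] by (intro Idl_mono) auto
  qed
  then have "ideal_length ?B (ideal_pow R ?Q n) =
      (\<Sum>\<alpha>\<in>?E. ideal_length (colon (Idl (?B \<union> monomial xs ` {j \<in> ?E. \<alpha> < j})) (monomial xs \<alpha>)) (carrier R))"
    using ideal_length_Idl_span[OF B finite_exponents, of "length xs" n "monomial xs"] xs by simp
  also have "\<dots> = (\<Sum>\<alpha>\<in>?E. ideal_length (hilbert_colon xs \<alpha>) (carrier R))"
    by (intro sum.cong) (auto simp: leading_colon_def tail_ideal_def exponents_def)
  finally show ?thesis .
qed

lemma Idl_subset_hilbert_colon:
  assumes xs: "set xs \<subseteq> carrier R" and len: "length \<alpha> = length xs"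
  shows "Idl (set xs) \<subseteq> hilbert_colon xs \<alpha>"
proof
  let ?Q = "Idl (set xs)" let ?T = "monomial xs ` {\<beta>\<in>exponents (length xs) (sum_list \<alpha>). \<alpha> < \<beta>}"
  have Q: "ideal ?Q R" using xs by (rule genideal_ideal)
  fix q assume q: "q \<in> ?Q"
  have "q \<otimes> monomial xs \<alpha> \<in> ideal_pow R ?Q (1 + sum_list \<alpha>)"
    using mult_mem_ideal_pow[OF Q, of q 1 "monomial xs \<alpha>" "sum_list \<alpha>"] q ideal_pow_1[OF Q]
      monomial_mem_ideal_pow[OF Q genideal_self[OF xs] len] by simp
  moreover have "ideal_pow R ?Q (Suc (sum_list \<alpha>)) \<union> ?T \<subseteq> carrier R"
    using ideal_subset_carrier[OF ideal_pow_ideal[OF Q]] xs by auto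
  note genideal_self[OF this]
  ultimately show "q \<in> hilbert_colon xs \<alpha>"
    using q ideal.Icarr[OF Q] by (auto simp: leading_colon_def tail_ideal_def mem_colon_iff)
qed

text \<open>The graded lengths are sums over exponents of weights that depend on capped exponents
  only, whence polynomiality. For the last bound, each weight is at most the colength of
  \<open>Q\<close>, because \<open>Q\<close> lies in every leading coefficient ideal, and the
  exponents of degree below \<open>n\<close> lie in a cube of side \<open>n\<close>.\<close>

lemma hilbert_samuel:
  assumes xs: "set xs \<subseteq> carrier R" and fin: "cofinite (Idl (set xs))"
  shows hilbert_samuel_cofinite: "cofinite (ideal_pow R (Idl (set xs)) n)"
    and hilbert_samuel_Suc: "colength (ideal_pow R (Idl (set xs)) (Suc n)) =
      colength (ideal_pow R (Idl (set xs)) n) + (\<Sum>\<alpha>\<in>exponents (length xs) n. colength (hilbert_colon xs \<alpha>))"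
    and hilbert_samuel_eventually_poly:
      "\<exists>r. eventually_poly r (\<lambda>n. colength (ideal_pow R (Idl (set xs)) n))"
    and hilbert_samuel_le: "colength (ideal_pow R (Idl (set xs)) n) \<le>
      colength (Idl (set xs)) * real n ^ length xs"
proof -
  let ?Q = "Idl (set xs)" let ?E = "exponents (length xs)"
  have Q: "ideal ?Q R" using xs by (rule genideal_ideal)
  note C = monomial_filtration_ideal_pow[OF xs]
  have Lfin: "cofinite (hilbert_colon xs \<alpha>)" and Lle: "colength (hilbert_colon xs \<alpha>) \<le> colength ?Q"
    if "\<alpha> \<in> ?E n" for \<alpha> n
    using cofinite_superset[OF fin] leading_colon_ideal[OF C] colength_antimono[OF fin]
      Idl_subset_hilbert_colon[OF xs, of \<alpha>] that by (auto simp: exponents_def)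
  have sub: "ideal_pow R ?Q (Suc n) \<subseteq> ideal_pow R ?Q n" for n
    using ideal_pow_antimono[OF Q] by simp
  have S: "ideal_length (ideal_pow R ?Q (Suc n)) (ideal_pow R ?Q n) < \<infinity> \<and>
      real (the_enat (ideal_length (ideal_pow R ?Q (Suc n)) (ideal_pow R ?Q n))) =
      (\<Sum>\<alpha>\<in>?E n. colength (hilbert_colon xs \<alpha>))" for n
    unfolding ideal_length_pow_Suc[OF xs] colength_def
    using Lfin by (intro real_the_enat_sum) (auto simp: cofinite_def)
  show fin': "cofinite (ideal_pow R ?Q n)" for n
  proof (induction n)
    case 0
    then show ?case by (simp add: cofinite_def oneideal ideal_length_self)
  next
    case (Suc n)
    have "ideal_length (ideal_pow R ?Q (Suc n)) (carrier R) =
        ideal_length (ideal_pow R ?Q (Suc n)) (ideal_pow R ?Q n) + ideal_length (ideal_pow R ?Q n) (carrier R)"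
      using ideal_pow_ideal[OF Q] sub ideal_subset_carrier by (intro ideal_length_add oneideal) auto
    then show ?case using S[of n] Suc ideal_pow_ideal[OF Q, of "Suc n"]
      unfolding cofinite_def by (auto simp: plus_eq_infty_iff_enat less_infinityE)
  qed
  show Suc: "colength (ideal_pow R ?Q (Suc n)) =
      colength (ideal_pow R ?Q n) + (\<Sum>\<alpha>\<in>?E n. colength (hilbert_colon xs \<alpha>))" for n
    using colength_diff(2)[OF fin'[of "Suc n"] ideal_pow_ideal[OF Q] sub] S[of n] by simp
  obtain M where M: "\<And>\<alpha>. length \<alpha> = length xs \<Longrightarrow> hilbert_colon xs \<alpha> = hilbert_colon xs (truncate_exp M \<alpha>)"
    using leading_colon_truncate[OF C] by blast
  have "\<exists>r. eventually_poly r (\<lambda>n. sum (\<lambda>\<alpha>. colength (hilbert_colon xs \<alpha>)) (?E n))"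
    by (rule sum_exponents_eventually_poly[of _ _ M]) (rule arg_cong[OF M])
  then obtain r where "eventually_poly (Suc r) (\<lambda>n. colength (ideal_pow R ?Q n))"
    using Suc by auto
  then show "\<exists>r. eventually_poly r (\<lambda>n. colength (ideal_pow R ?Q n))" by blast
  have "colength (ideal_pow R ?Q n) \<le> colength ?Q * real (card (\<Union>k<n. ?E k))" for n
  proof (induction n)
    case (Suc n)
    have "(\<Sum>\<alpha>\<in>?E n. colength (hilbert_colon xs \<alpha>)) \<le> colength ?Q * real (card (?E n))"
      using sum_bounded_above[of "?E n" "\<lambda>\<alpha>. colength (hilbert_colon xs \<alpha>)" "colength ?Q"] Lle
      by (simp add: mult.commute)
    moreover have "card (\<Union>k<Suc n. ?E k) = card (\<Union>k<n. ?E k) + card (?E n)"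
    proof -
      have "(\<Union>k<Suc n. ?E k) = (\<Union>k<n. ?E k) \<union> ?E n" by (auto simp: less_Suc_eq)
      moreover have "(\<Union>k<n. ?E k) \<inter> ?E n = {}" by (auto simp: exponents_def)
      ultimately show ?thesis by (simp add: card_Un_disjoint)
    qed
    ultimately show ?case
      using Suc \<open>\<And>n. colength (ideal_pow R ?Q (Suc n)) =
        colength (ideal_pow R ?Q n) + (\<Sum>\<alpha>\<in>?E n. colength (hilbert_colon xs \<alpha>))\<close>[of n]
      by (simp add: algebra_simps)
  qed simp
  also have "colength ?Q * real (card (\<Union>k<n. ?E k)) \<le> colength ?Q * real n ^ length xs"
  proof -
    have "(\<Union>k<n. ?E k) \<subseteq> {\<alpha>. set \<alpha> \<subseteq> {..<n} \<and> length \<alpha> = length xs}"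
      using exponents_subset_box by (fastforce simp: exponents_def)
    then have "card (\<Union>k<n. ?E k) \<le> n ^ length xs"
      using card_mono[OF finite_lists_length_eq[of "{..<n}"]] by (simp add: card_lists_length_eq)
    then have "real (card (\<Union>k<n. ?E k)) \<le> real n ^ length xs" by (metis of_nat_le_iff of_nat_power)
    then show ?thesis by (intro mult_left_mono) auto
  qed
  finally show "colength (ideal_pow R ?Q n) \<le> colength ?Q * real n ^ length xs" .
qed

lemma ideal_eq_Idl_set: "ideal I R \<Longrightarrow> \<exists>xs. set xs \<subseteq> carrier R \<and> I = Idl (set xs)"
  using finetely_gen by (metis finite_list)

end

section \<open>Primes over an ideal\<close>

context noetherian_cring
begin

lemma noetherian_induct [consumes 1, case_names step]:
  assumes "ideal I R" and "\<And>I. ideal I R \<Longrightarrow> (\<And>J. ideal J R \<Longrightarrow> I \<subset> J \<Longrightarrow> P J) \<Longrightarrow> P I"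
  shows "P I"
proof (rule ccontr)
  assume "\<not> P I"
  have ex: "\<exists>J. (ideal J R \<and> \<not> P J) \<and> I \<subset> J" if "ideal I R \<and> \<not> P I" for I
    using assms(2) that by blast
  obtain h where h: "\<And>n::nat. ideal (h n) R \<and> \<not> P (h n)" "\<And>n. h n \<subset> h (Suc n)"
    using dependent_nat_choice[of "\<lambda>_ I. ideal I R \<and> \<not> P I" "\<lambda>_ I J. I \<subset> J"] ex \<open>\<not> P I\<close> assms(1)
    by (metis (no_types, lifting))
  then obtain K where "\<And>k. k \<ge> K \<Longrightarrow> h k = h K" using ideal_ascending_chain[of h] by blast
  then show False using h(2)[of K] by (metis le_SucI order_refl psubset_eq)
qed

lemma not_primeE:
  assumes I: "ideal I R" "I \<noteq> carrier R" "\<not> primeideal I R"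
  obtains a b where "a \<in> carrier R" "b \<in> carrier R" "a \<otimes> b \<in> I" "a \<notin> I" "b \<notin> I"
  using I primeidealI[OF I(1) is_cring I(2)[symmetric]] that by blast

lemma Idl_insert_superset:
  assumes "ideal I R" "a \<in> carrier R" "a \<notin> I"
  shows "ideal (Idl (insert a I)) R" "I \<subset> Idl (insert a I)"
proof -
  have "insert a I \<subseteq> carrier R" using assms ideal_subset_carrier by auto
  then show "ideal (Idl (insert a I)) R" "I \<subset> Idl (insert a I)"
    using genideal_ideal genideal_self[of "insert a I"] assms(3) by auto
qed

text \<open>If \<open>a \<otimes> b \<in> I\<close>, every prime over \<open>I\<close> contains
  \<open>a\<close> or \<open>b\<close>, so the lists found for the two enlarged ideals can be
  united. The members need not be minimal primes; it suffices that every prime over \<open>I\<close>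
  contains one of them.\<close>

lemma finite_primes_over:
  "ideal I R \<Longrightarrow> \<exists>S. finite S \<and> (\<forall>P\<in>S. primeideal P R \<and> I \<subseteq> P) \<and>
     (\<forall>P. primeideal P R \<and> I \<subseteq> P \<longrightarrow> (\<exists>P'\<in>S. P' \<subseteq> P))"
proof (induction I rule: noetherian_induct)
  case (step I)
  consider "I = carrier R" | "primeideal I R" | "I \<noteq> carrier R" "\<not> primeideal I R" by blast
  then show ?case
  proof cases
    case 1
    then have "\<not> (primeideal P R \<and> I \<subseteq> P)" for P
      using primeideal.I_notcarr[of P R] ideal_subset_carrier[of P] primeideal.axioms(1) by blast
    then show ?thesis by (intro exI[of _ "{}"]) auto
  next
    case 2
    then show ?thesis by (intro exI[of _ "{I}"]) auto
  next
    case 3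
    then obtain a b where ab: "a \<in> carrier R" "b \<in> carrier R" "a \<otimes> b \<in> I" "a \<notin> I" "b \<notin> I"
      using not_primeE[OF step(1)] by blast
    note A = Idl_insert_superset[OF step(1) ab(1,4)] and B = Idl_insert_superset[OF step(1) ab(2,5)]
    obtain S where S: "finite S" "\<forall>P\<in>S. primeideal P R \<and> Idl (insert a I) \<subseteq> P"
        "\<forall>P. primeideal P R \<and> Idl (insert a I) \<subseteq> P \<longrightarrow> (\<exists>P'\<in>S. P' \<subseteq> P)"
      using step(2)[OF A] by blast
    obtain T where T: "finite T" "\<forall>P\<in>T. primeideal P R \<and> Idl (insert b I) \<subseteq> P"
        "\<forall>P. primeideal P R \<and> Idl (insert b I) \<subseteq> P \<longrightarrow> (\<exists>P'\<in>T. P' \<subseteq> P)"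
      using step(2)[OF B] by blast
    have "\<exists>P'\<in>S \<union> T. P' \<subseteq> P" if P: "primeideal P R" "I \<subseteq> P" for P
    proof -
      have "a \<in> P \<or> b \<in> P" using primeideal.I_prime[OF P(1)] ab P(2) by blast
      then have "Idl (insert a I) \<subseteq> P \<or> Idl (insert b I) \<subseteq> P"
        using P genideal_minimal[OF primeideal.axioms(1)[OF P(1)]] by (meson insert_subset)
      then show ?thesis
      proof
        assume "Idl (insert a I) \<subseteq> P"
        with S(3) P(1) show ?thesis by (meson UnI1)
      next
        assume "Idl (insert b I) \<subseteq> P"
        with T(3) P(1) show ?thesis by (meson UnI2)
      qed
    qed
    moreover have "primeideal P R \<and> I \<subseteq> P" if "P \<in> S \<union> T" for P
      using that
    proof
      assume "P \<in> S"
      with S(2) A(2) show ?thesis by (meson psubset_imp_subset subset_trans)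
    next
      assume "P \<in> T"
      with T(2) B(2) show ?thesis by (meson psubset_imp_subset subset_trans)
    qed
    ultimately show ?thesis using S(1) T(1) by (intro exI[of _ "S \<union> T"]) simp
  qed
qed

text \<open>The same Noetherian induction: the product of the ideals obtained by adjoining
  \<open>a\<close> and \<open>b\<close> lies in \<open>I\<close> when \<open>a \<otimes> b\<close>
  does, so the two exponents are added.\<close>

lemma ideal_pow_subset_of_unique_prime:
  assumes M: "ideal M R"
  shows "ideal I R \<Longrightarrow> (\<And>P. primeideal P R \<Longrightarrow> I \<subseteq> P \<Longrightarrow> P = M) \<Longrightarrow> \<exists>k. ideal_pow R M k \<subseteq> I"
proof (induction I rule: noetherian_induct)
  case (step I)
  consider "I = carrier R" | "primeideal I R" | "I \<noteq> carrier R" "\<not> primeideal I R" by blast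
  then show ?case
  proof cases
    case 1
    then show ?thesis by (intro exI[of _ 0]) simp
  next
    case 2
    then have "I = M" using step(3) by blast
    then show ?thesis using ideal_pow_1[OF M] by (intro exI[of _ 1]) simp
  next
    case 3
    then obtain a b where ab: "a \<in> carrier R" "b \<in> carrier R" "a \<otimes> b \<in> I" "a \<notin> I" "b \<notin> I"
      using not_primeE[OF step(1)] by blast
    note A = Idl_insert_superset[OF step(1) ab(1,4)] and B = Idl_insert_superset[OF step(1) ab(2,5)]
    obtain k where k: "ideal_pow R M k \<subseteq> Idl (insert a I)" using step(2)[OF A] step(3) A(2) by blast
    obtain l where l: "ideal_pow R M l \<subseteq> Idl (insert b I)" using step(2)[OF B] step(3) B(2) by blast
    have Ic: "I \<subseteq> carrier R" using step(1) ideal_subset_carrier by auto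
    have "ideal_pow R M (k + l) \<subseteq> I" unfolding ideal_pow_add[OF M]
    proof (rule ideal_prod_least[OF step(1)])
      fix x y assume "x \<in> ideal_pow R M k" "y \<in> ideal_pow R M l"
      then obtain i r j t where xy: "i \<in> I" "r \<in> carrier R" "x = i \<oplus> r \<otimes> a"
          "j \<in> I" "t \<in> carrier R" "y = j \<oplus> t \<otimes> b"
        using k l mem_Idl_insert[OF Ic ab(1)] mem_Idl_insert[OF Ic ab(2)] Idl_ideal[OF step(1)] by blast
      have ij: "i \<in> carrier R" "j \<in> carrier R" using xy Ic by auto
      have "x \<otimes> y = i \<otimes> y \<oplus> ((r \<otimes> a) \<otimes> j \<oplus> (r \<otimes> t) \<otimes> (a \<otimes> b))"
        using xy ij ab by algebra
      also have "\<dots> \<in> I"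
        using xy ij ab ideal.I_l_closed[OF step(1)] ideal.I_r_closed[OF step(1)]
        by (intro ideal_a_closed[OF step(1)]) auto
      finally show "x \<otimes> y \<in> I" .
    qed
    then show ?thesis by blast
  qed
qed

lemma prime_prod_not_mem:
  assumes P: "primeideal P R" and A: "ideal A R" "\<not> A \<subseteq> P" and "finite S"
    and "\<And>Q. Q \<in> S \<Longrightarrow> ideal Q R \<and> \<not> Q \<subseteq> P"
  shows "\<exists>y\<in>A. y \<notin> P \<and> (\<forall>Q\<in>S. y \<in> Q)"
  using assms(4,5)
proof (induction S rule: finite_induct)
  case empty
  then show ?case using A by auto
next
  case (insert Q S)
  then obtain y where y: "y \<in> A" "y \<notin> P" "\<forall>Q\<in>S. y \<in> Q" by blast
  obtain q where q: "q \<in> Q" "q \<notin> P" using insert.prems[of Q] by auto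
  have c: "q \<in> carrier R" "y \<in> carrier R"
    using ideal.Icarr[of Q R q] insert.prems[of Q] q ideal.Icarr[OF A(1) y(1)] by simp_all
  have "y \<otimes> q \<notin> P" using primeideal.I_prime[OF P c(2) c(1)] y q by blast
  moreover have "y \<otimes> q \<in> A" "y \<otimes> q \<in> Q"
    using c y q insert.prems[of Q] ideal.I_r_closed[OF A(1) y(1) c(1)] ideal.I_l_closed[of Q R q y] by auto
  moreover have "y \<otimes> q \<in> Q'" if "Q' \<in> S" for Q'
    using insert.prems[of Q'] y(3) that c ideal.I_r_closed[of Q' R y q] by auto
  ultimately show ?case by blast
qed

lemma prime_avoidance:
  assumes A: "ideal A R" and "finite S" and "\<And>P. P \<in> S \<Longrightarrow> primeideal P R \<and> \<not> A \<subseteq> P"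
  shows "\<exists>x\<in>A. \<forall>P\<in>S. x \<notin> P"
  using assms(2,3)
proof (induction S rule: finite_psubset_induct)
  case (psubset S)
  show ?case
  proof (cases "\<exists>P\<in>S. \<exists>Q\<in>S. Q \<noteq> P \<and> Q \<subseteq> P")
    case True
    then obtain P Q where PQ: "P \<in> S" "Q \<in> S" "Q \<noteq> P" "Q \<subseteq> P" by blast
    then obtain x where "x \<in> A" "\<forall>P\<in>S - {Q}. x \<notin> P" using psubset.IH[of "S - {Q}"] psubset.prems by blast
    with PQ show ?thesis by blast
  next
    case False
    show ?thesis
    proof (cases "S = {}")
      case True
      then show ?thesis using ideal_zero_closed[OF A] by auto
    next
      case False
      then obtain P where P: "P \<in> S" by blast
      then obtain x where x: "x \<in> A" "\<forall>P\<in>S - {P}. x \<notin> P"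
        using psubset.IH[of "S - {P}"] psubset.prems by blast
      have Pp: "primeideal P R" "\<not> A \<subseteq> P" using P psubset.prems by auto
      \<comment> \<open>Adding such a \<open>y\<close> moves \<open>x\<close> out of
        \<open>P\<close> without moving it into any of the other primes.\<close>
      have "\<exists>y\<in>A. y \<notin> P \<and> (\<forall>Q\<in>S - {P}. y \<in> Q)"
      proof (rule prime_prod_not_mem[OF Pp(1) A Pp(2)])
        show "finite (S - {P})" using psubset.hyps by simp
        fix Q assume "Q \<in> S - {P}"
        then show "ideal Q R \<and> \<not> Q \<subseteq> P"
          using \<open>\<not> (\<exists>P\<in>S. \<exists>Q\<in>S. Q \<noteq> P \<and> Q \<subseteq> P)\<close> P psubset.prems[of Q] primeideal.axioms(1) by blast
      qed
      then obtain y where y: "y \<in> A" "y \<notin> P" "\<forall>Q\<in>S - {P}. y \<in> Q" by blast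
      have c: "x \<in> carrier R" "y \<in> carrier R" using x y A ideal.Icarr by metis+
      show ?thesis
      proof (cases "x \<in> P")
        case True
        have "x \<oplus> y \<notin> P"
          using ideal_a_cancel_left[of P x y] True y c Pp primeideal.axioms(1) by blast
        moreover have "x \<oplus> y \<notin> Q" if "Q \<in> S - {P}" for Q
          using ideal_a_cancel_right[of Q y x] that x y c psubset.prems[of Q] primeideal.axioms(1) by blast
        ultimately show ?thesis using ideal_a_closed[OF A x(1) y(1)] by blast
      next
        case False
        with x show ?thesis by blast
      qed
    qed
  qed
qed

end

section \<open>Dimension theory of local rings\<close>

context noetherian_local_ring
begin

lemma m_ideal: "ideal m R"
  using maximal maximalideal.axioms(1) by blast

lemma m_prime: "primeideal m R"
  using maximalideal_prime[OF maximal] .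

lemma m_proper: "\<one> \<notin> m" "m \<noteq> carrier R"
  using maximalideal.I_notcarr[OF maximal] ideal.one_imp_carrier[OF m_ideal] by auto

lemma m_subset_carrier: "m \<subseteq> carrier R"
  using ideal_subset_carrier[OF m_ideal] .

lemma proper_ideal_subset_m: "ideal I R \<Longrightarrow> I \<noteq> carrier R \<Longrightarrow> I \<subseteq> m"
proof (induction I rule: noetherian_induct)
  case (step I)
  show ?case
  proof (cases "maximalideal I R")
    case True
    then show ?thesis using unique_maximal by blast
  next
    case False
    then obtain J where "ideal J R" "I \<subset> J" "J \<noteq> carrier R"
      using maximalidealI[OF step(1)] step(3) by (metis psubsetI)
    with step(2) show ?thesis by blast
  qed
qed

lemma prime_subset_m: "primeideal P R \<Longrightarrow> P \<subseteq> m"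
  using proper_ideal_subset_m[of P] primeideal.axioms(1) primeideal.I_notcarr by blast

lemma ideal_not_subset_m: "ideal I R \<Longrightarrow> x \<in> I \<Longrightarrow> x \<notin> m \<Longrightarrow> I = carrier R"
  using proper_ideal_subset_m by blast

lemma unit_of_not_mem_m:
  assumes "x \<in> carrier R" "x \<notin> m"
  shows "\<exists>y\<in>carrier R. y \<otimes> x = \<one>"
proof -
  have "PIdl x = carrier R"
    using ideal_not_subset_m[OF cgenideal_ideal[OF assms(1)] cgenideal_self[OF assms(1)] assms(2)] .
  then have "\<one> \<in> PIdl x" by simp
  then obtain y where "y \<in> carrier R" "\<one> = y \<otimes> x" unfolding cgenideal_def by blast
  then show ?thesis by metis
qed

lemma cofinite_m: "cofinite m" "colength m = 1"
  using ideal_length_maximal[OF maximal] m_ideal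
  by (simp_all add: cofinite_def colength_def one_enat_def)

lemma cofinite_m_pow: "cofinite (ideal_pow R m k)"
  using ideal_eq_Idl_set[OF m_ideal] hilbert_samuel_cofinite cofinite_m by metis

lemma cofinite_m_primary: "ideal B R \<Longrightarrow> ideal_pow R m k \<subseteq> B \<Longrightarrow> cofinite B"
  using cofinite_superset[OF cofinite_m_pow] by blast

lemma colength_ge_1:
  assumes "cofinite B" "B \<subseteq> m" shows "1 \<le> colength B"
  using colength_antimono[OF assms(1) m_ideal assms(2)] cofinite_m(2) by simp

text \<open>Says that \<open>P\<close> has height at least \<open>n\<close>.\<close>

definition prime_chain_to :: "'a set \<Rightarrow> nat \<Rightarrow> bool" where
  "prime_chain_to P n \<longleftrightarrow>
     (\<exists>f. (\<forall>j\<le>n. primeideal (f j) R) \<and> (\<forall>j<n. f j \<subset> f (Suc j)) \<and> f n = P)"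

lemma prime_chain_to_Suc:
  assumes "prime_chain_to P n" "primeideal P' R" "P \<subset> P'"
  shows "prime_chain_to P' (Suc n)"
proof -
  obtain f where f: "\<And>j. j \<le> n \<Longrightarrow> primeideal (f j) R" "\<And>j. j < n \<Longrightarrow> f j \<subset> f (Suc j)" "f n = P"
    using assms(1) unfolding prime_chain_to_def by blast
  let ?g = "f(Suc n := P')"
  have "primeideal (?g j) R" if "j \<le> Suc n" for j using f(1)[of j] that assms(2) by simp
  moreover have "?g j \<subset> ?g (Suc j)" if "j < Suc n" for j
    using f(2)[of j] f(3) that assms(3) by (cases "j = n") simp_all
  moreover have "?g (Suc n) = P'" by simp
  ultimately show ?thesis unfolding prime_chain_to_def by blast
qed

text \<open>The next element is chosen by prime avoidance outside a finite set of primes that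
  controls all primes over the present ideal. The prime \<open>m\<close> cannot be avoided by an
  element of \<open>m\<close>, hence the exception \<open>P \<noteq> m\<close>.\<close>

lemma generators_of_height:
  "\<exists>xs. length xs = i \<and> set xs \<subseteq> m \<and>
     (\<forall>P. primeideal P R \<and> Idl (set xs) \<subseteq> P \<and> P \<noteq> m \<longrightarrow> prime_chain_to P i)"
proof (induction i)
  case 0
  have "prime_chain_to P 0" if "primeideal P R" for P
    unfolding prime_chain_to_def using that by (intro exI[of _ "\<lambda>_. P"]) simp
  then show ?case by (intro exI[of _ "[]"] conjI allI impI) auto
next
  case (Suc i)
  then obtain xs where xs: "length xs = i" "set xs \<subseteq> m"
    and chain: "\<And>P. primeideal P R \<Longrightarrow> Idl (set xs) \<subseteq> P \<Longrightarrow> P \<noteq> m \<Longrightarrow> prime_chain_to P i" by blast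
  have xsc: "set xs \<subseteq> carrier R" using xs(2) m_subset_carrier by auto
  obtain S where S: "finite S" "\<And>P. P \<in> S \<Longrightarrow> primeideal P R \<and> Idl (set xs) \<subseteq> P"
      "\<And>P. primeideal P R \<Longrightarrow> Idl (set xs) \<subseteq> P \<Longrightarrow> \<exists>P'\<in>S. P' \<subseteq> P"
    using finite_primes_over[OF genideal_ideal[OF xsc]] by metis
  have "\<exists>x\<in>m. \<forall>P\<in>S - {m}. x \<notin> P"
  proof (rule prime_avoidance[OF m_ideal])
    show "finite (S - {m})" using S(1) by simp
    fix P assume "P \<in> S - {m}"
    then show "primeideal P R \<and> \<not> m \<subseteq> P" using S(2)[of P] prime_subset_m[of P] by blast
  qed
  then obtain x where x: "x \<in> m" "\<forall>P\<in>S - {m}. x \<notin> P" by blast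
  have "prime_chain_to P (Suc i)" if P: "primeideal P R" "Idl (set (x # xs)) \<subseteq> P" "P \<noteq> m" for P
  proof -
    have sub: "set (x # xs) \<subseteq> carrier R" using xsc x(1) m_subset_carrier by auto
    have xP: "x \<in> P" using genideal_self[OF sub] P(2) by auto
    have "Idl (set xs) \<subseteq> P" using Idl_mono[of "set xs" "set (x # xs)"] sub P(2) by auto
    then obtain P' where P': "P' \<in> S" "P' \<subseteq> P" using S(3) P(1) by blast
    have "P' \<noteq> m" using P'(2) prime_subset_m[OF P(1)] P(3) by blast
    moreover then have "P' \<subset> P" using P' x(2) xP by blast
    ultimately show ?thesis using chain[of P'] S(2)[OF P'(1)] prime_chain_to_Suc[OF _ P(1)] by blast
  qed
  then show ?case using xs x by (intro exI[of _ "x # xs"]) auto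
qed

lemma prime_chain_le_krull_dim:
  "prime_chain_to P n \<Longrightarrow> enat n \<le> krull_dim R"
  unfolding krull_dim_def prime_chain_to_def by (rule SUP_upper) blast

text \<open>A prime other than \<open>m\<close> over the \<open>d\<close> elements would have height
  at least \<open>d\<close>, and appending \<open>m\<close> would give a chain of length
  \<open>d + 1\<close>.\<close>

lemma ex_parameters:
  assumes "krull_dim R = enat d"
  shows "\<exists>xs k. length xs = d \<and> set xs \<subseteq> m \<and> ideal_pow R m k \<subseteq> Idl (set xs)"
proof -
  obtain xs where xs: "length xs = d" "set xs \<subseteq> m"
    "\<And>P. primeideal P R \<Longrightarrow> Idl (set xs) \<subseteq> P \<Longrightarrow> P \<noteq> m \<Longrightarrow> prime_chain_to P d"
    using generators_of_height[of d] by blast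
  have "P = m" if P: "primeideal P R" "Idl (set xs) \<subseteq> P" for P
  proof (rule ccontr)
    assume "P \<noteq> m"
    with prime_subset_m[OF P(1)] have "P \<subset> m" by blast
    with xs(3)[OF P \<open>P \<noteq> m\<close>] have "prime_chain_to m (Suc d)" using m_prime prime_chain_to_Suc by blast
    then show False using prime_chain_le_krull_dim assms by fastforce
  qed
  moreover have "ideal (Idl (set xs)) R" using xs(2) m_subset_carrier by (intro genideal_ideal) auto
  ultimately have "\<exists>k. ideal_pow R m k \<subseteq> Idl (set xs)"
    by (intro ideal_pow_subset_of_unique_prime[OF m_ideal])
  then show ?thesis using xs(1,2) by blast
qed

lemma ex_prime_chain:
  assumes "krull_dim R = enat d"
  shows "\<exists>f. (\<forall>j\<le>d. primeideal (f j) R) \<and> (\<forall>j<d. f j \<subset> f (Suc j))"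
proof -
  let ?S = "{n. \<exists>P. (\<forall>i\<le>n. primeideal (P i) R) \<and> (\<forall>i<n. P i \<subset> P (Suc i))}"
  have "0 \<in> ?S" using m_prime by (auto intro!: exI[of _ "\<lambda>_. m"])
  then have "d \<in> ?S" using enat_SUP_attained[of ?S d] assms unfolding krull_dim_def by blast
  then show ?thesis by blast
qed

text \<open>Modulo \<open>P\<close> the element \<open>x\<close> is a nonzerodivisor, and Artin-Rees
  for the ideal generated by \<open>P\<close> and \<open>x\<close> bounds by a constant how much
  dividing by \<open>x\<close> can lower the \<open>Q\<close>-adic order.\<close>

lemma prime_colon_linear:
  assumes xs: "set xs \<subseteq> carrier R" and P: "primeideal P R" and x: "x \<in> carrier R" "x \<notin> P"
  shows "\<exists>c. \<forall>n. colon (P <+> ideal_pow R (Idl (set xs)) (n + c)) x \<subseteq> P <+> ideal_pow R (Idl (set xs)) n"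
proof -
  let ?Q = "Idl (set xs)" let ?B = "Idl (insert x P)"
  have Q: "ideal ?Q R" using xs by (rule genideal_ideal)
  note Qn = ideal_pow_ideal[OF Q]
  have Pi: "ideal P R" using P primeideal.axioms(1) by blast
  have Pc: "P \<subseteq> carrier R" using ideal_subset_carrier[OF Pi] .
  have B: "ideal ?B R" using Pc x by (intro genideal_ideal) auto
  have memB: "y \<in> ?B \<longleftrightarrow> (\<exists>p\<in>P. \<exists>r\<in>carrier R. y = p \<oplus> r \<otimes> x)" for y
    using mem_Idl_insert[OF Pc x(1)] Idl_ideal[OF Pi] by simp
  obtain c where c: "\<And>n. ideal_pow R ?Q (n + c) \<inter> ?B \<subseteq> ?B \<cdot> ideal_pow R ?Q n"
    using artin_rees[OF xs B] by blast
  have "colon (P <+> ideal_pow R ?Q (n + c)) x \<subseteq> P <+> ideal_pow R ?Q n" for n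
  proof
    fix a assume "a \<in> colon (P <+> ideal_pow R ?Q (n + c)) x"
    then obtain p g where a: "a \<in> carrier R" and pg: "p \<in> P" "g \<in> ideal_pow R ?Q (n + c)" "a \<otimes> x = p \<oplus> g"
      by (auto simp: mem_colon_iff mem_set_add)
    have cr: "p \<in> carrier R" "g \<in> carrier R"
      using pg Pc ideal.Icarr[OF Qn pg(2)] by auto
    have "g = \<ominus> p \<oplus> a \<otimes> x" unfolding pg(3) using cr by algebra
    then have "g \<in> ?B" using memB ideal_a_inv_closed[OF Pi pg(1)] a by blast
    then have "g \<in> ?B \<cdot> ideal_pow R ?Q n" using c pg(2) by blast
    moreover have "?B \<cdot> ideal_pow R ?Q n \<subseteq> {p \<oplus> b \<otimes> x | p b. p \<in> P \<and> b \<in> ideal_pow R ?Q n}"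
    proof (rule ideal_prod_least)
      show "ideal {p \<oplus> b \<otimes> x | p b. p \<in> P \<and> b \<in> ideal_pow R ?Q n} R"
        by (rule ideal_scaled_sum[OF Pi Qn x(1)])
      fix y q assume y: "y \<in> ?B" and q: "q \<in> ideal_pow R ?Q n"
      then obtain p r where pr: "p \<in> P" "r \<in> carrier R" "y = p \<oplus> r \<otimes> x" using memB by blast
      have qc: "q \<in> carrier R" "p \<in> carrier R" using ideal.Icarr[OF Qn q] pr(1) Pc by auto
      have "y \<otimes> q = p \<otimes> q \<oplus> (r \<otimes> q) \<otimes> x" unfolding pr(3) using qc pr(2) x(1) by algebra
      moreover have "p \<otimes> q \<in> P" "r \<otimes> q \<in> ideal_pow R ?Q n"
        using ideal.I_r_closed[OF Pi pr(1) qc(1)] ideal.I_l_closed[OF Qn q pr(2)] by auto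
      ultimately show "y \<otimes> q \<in> {p \<oplus> b \<otimes> x | p b. p \<in> P \<and> b \<in> ideal_pow R ?Q n}" by blast
    qed
    ultimately obtain p' b where pb: "p' \<in> P" "b \<in> ideal_pow R ?Q n" "g = p' \<oplus> b \<otimes> x" by blast
    have cr': "p' \<in> carrier R" "b \<in> carrier R" using pb Pc ideal.Icarr[OF Qn pb(2)] by auto
    have "(a \<ominus> b) \<otimes> x = a \<otimes> x \<ominus> b \<otimes> x" using a cr' x(1) by algebra
    also have "\<dots> = p \<oplus> p'" unfolding pg(3) pb(3) using cr cr' x(1) by algebra
    finally have "(a \<ominus> b) \<otimes> x \<in> P" using ideal_a_closed[OF Pi pg(1) pb(1)] by simp
    then have "a \<ominus> b \<in> P" using primeideal.I_prime[OF P, of "a \<ominus> b" x] a cr' x by simp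
    moreover have "a = (a \<ominus> b) \<oplus> b" using a cr' by algebra
    ultimately show "a \<in> P <+> ideal_pow R ?Q n" using pb(2) unfolding mem_set_add by blast
  qed
  then show ?thesis by blast
qed

lemma m_primary_pow:
  assumes Q: "ideal Q R" and k: "ideal_pow R m k \<subseteq> Q"
  shows "ideal_pow R m (k * n) \<subseteq> ideal_pow R Q n"
  using ideal_pow_mono[OF k, of n] ideal_pow_pow[OF m_ideal] by simp

text \<open>The inequality between dimension and degree of the Hilbert-Samuel polynomial, made
  effective: passing from \<open>f (Suc 0)\<close> down to \<open>f 0\<close> sums the previous
  lower bound over \<open>j\<close>, which raises the exponent by one.\<close>

lemma colength_growth:
  assumes xs: "set xs \<subseteq> m" and k: "ideal_pow R m k \<subseteq> Idl (set xs)"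
  shows "\<forall>j\<le>r. primeideal (f j) R \<Longrightarrow> \<forall>j<r. f j \<subset> f (Suc j) \<Longrightarrow>
    \<exists>c>0. \<exists>K\<ge>1. \<forall>j\<ge>1. c * real j ^ r \<le> colength (f 0 <+> ideal_pow R (Idl (set xs)) (K * j))"
proof (induction r arbitrary: f)
  let ?Q = "Idl (set xs)"
  have xsc: "set xs \<subseteq> carrier R" using xs m_subset_carrier by auto
  have Q: "ideal ?Q R" using xsc by (rule genideal_ideal)
  note Qn = ideal_pow_ideal[OF Q]
  have cof: "cofinite (P <+> ideal_pow R ?Q n)" if "ideal P R" for P n
    using cofinite_m_primary[OF add_ideals[OF that Qn], of "k * n" n] m_primary_pow[OF Q k]
      subset_set_add_right[OF that Qn] by blast
  {
    case 0
    have P: "primeideal (f 0) R" "ideal (f 0) R" using 0 primeideal.axioms(1)[of "f 0" R] by simp_all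
    have "1 \<le> colength (f 0 <+> ideal_pow R ?Q (1 * j))" if "j \<ge> 1" for j
    proof (rule colength_ge_1[OF cof[OF P(2)]])
      have "ideal_pow R ?Q (1 * j) \<subseteq> ?Q"
        using ideal_pow_antimono[OF Q, of 1 j] ideal_pow_1[OF Q] that by simp
      also have "\<dots> \<subseteq> m" using xs by (rule genideal_minimal[OF m_ideal])
      finally show "f 0 <+> ideal_pow R ?Q (1 * j) \<subseteq> m"
        using set_add_least[OF m_ideal prime_subset_m[OF P(1)]] by blast
    qed
    then show ?case by (intro exI[of _ 1] conjI) auto
  next
    case (Suc r f)
    have "\<exists>c>0. \<exists>K\<ge>1. \<forall>j\<ge>1. c * real j ^ r \<le> colength (f (Suc 0) <+> ideal_pow R ?Q (K * j))"
      by (rule Suc.IH[of "\<lambda>j. f (Suc j)"]) (use Suc.prems in auto)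
    then obtain c K where c: "c > 0" and K: "K \<ge> 1"
      and g: "\<And>j. j \<ge> 1 \<Longrightarrow> c * real j ^ r \<le> colength (f (Suc 0) <+> ideal_pow R ?Q (K * j))" by blast
    let ?P = "f 0" let ?P' = "f (Suc 0)"
    have P: "primeideal ?P R" "ideal ?P R" "primeideal ?P' R" "ideal ?P' R"
      using Suc.prems primeideal.axioms(1)[of "f 0" R] primeideal.axioms(1)[of "f (Suc 0)" R] by simp_all
    obtain x where x: "x \<in> ?P'" "x \<notin> ?P" using Suc.prems(2) by blast
    have xc: "x \<in> carrier R" using ideal.Icarr[OF P(4) x(1)] .
    obtain c0 where c0: "\<And>n. colon (?P <+> ideal_pow R ?Q (n + c0)) x \<subseteq> ?P <+> ideal_pow R ?Q n"
      using prime_colon_linear[OF xsc P(1) xc x(2)] by blast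
    \<comment> \<open>\<open>c0\<close> pays for the division by \<open>x\<close>, and
      \<open>K\<close> is the scale at which the bound for \<open>f (Suc 0)\<close> holds.\<close>
    define L where "L = K + c0"
    have mono: "colength (p <+> ideal_pow R ?Q a) \<le> colength (p <+> ideal_pow R ?Q b)"
      if "a \<le> b" "ideal p R" for p a b
      using set_add_mono[OF order_refl ideal_pow_antimono[OF Q that(1)], of p]
      by (intro colength_antimono cof that add_ideals Qn)
    \<comment> \<open>The ring modulo \<open>?P + Q^(n+L)\<close> is split at the ideal generated by
      \<open>x\<close>: the part above has length at least that modulo \<open>?P' + Q^(n+L)\<close>,
      and the part below is \<open>R\<close> modulo a colon ideal contained in
      \<open>?P + Q^n\<close>.\<close>
    have step: "colength (?P' <+> ideal_pow R ?Q (n + L)) + colength (?P <+> ideal_pow R ?Q n)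
        \<le> colength (?P <+> ideal_pow R ?Q (n + L))" for n
    proof -
      let ?D = "?P <+> ideal_pow R ?Q (n + L)" let ?D' = "?P' <+> ideal_pow R ?Q (n + L)"
      have D: "ideal ?D R" "ideal ?D' R" using add_ideals Qn P by auto
      have Dx: "ideal (Idl (insert x ?D)) R" "?D \<subseteq> Idl (insert x ?D)"
        using genideal_ideal[of "insert x ?D"] genideal_self[of "insert x ?D"] xc
          ideal_subset_carrier[OF D(1)] by auto
      have "colength ?D = real (the_enat (ideal_length ?D (Idl (insert x ?D)))) + colength (Idl (insert x ?D))"
        by (rule colength_diff(2)[OF cof[OF P(2)] Dx])
      also have "real (the_enat (ideal_length ?D (Idl (insert x ?D)))) = colength (colon ?D x)"
        unfolding ideal_length_colon[OF D(1) xc] colength_def ..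
      finally have e: "colength ?D = colength (colon ?D x) + colength (Idl (insert x ?D))" .
      have "colon ?D x \<subseteq> ?P <+> ideal_pow R ?Q n"
      proof -
        have "colon ?D x \<subseteq> ?P <+> ideal_pow R ?Q (n + K)"
          using c0[of "n + K"] by (simp add: L_def add.assoc)
        also have "\<dots> \<subseteq> ?P <+> ideal_pow R ?Q n"
          using ideal_pow_antimono[OF Q, of n "n + K"] by (intro set_add_mono) auto
        finally show ?thesis .
      qed
      then have "colength (?P <+> ideal_pow R ?Q n) \<le> colength (colon ?D x)"
        using cofinite_superset[OF cof[OF P(2), of "n + L"] colon_ideal[OF D(1) xc] subset_colon[OF D(1) xc]]
          add_ideals[OF P(2) Qn] by (intro colength_antimono) auto
      moreover have "Idl (insert x ?D) \<subseteq> ?D'"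
      proof (rule genideal_minimal[OF D(2)])
        have "?P \<subseteq> ?P'" using Suc.prems(2) by blast
        then have "?D \<subseteq> ?D'" by (intro set_add_mono) auto
        moreover have "x \<in> ?D'" using x(1) subset_set_add_left[OF P(4) Qn] by auto
        ultimately show "insert x ?D \<subseteq> ?D'" by simp
      qed
      then have "colength ?D' \<le> colength (Idl (insert x ?D))"
        using cofinite_superset[OF cof[OF P(2)] Dx] D(2) by (intro colength_antimono) auto
      ultimately show ?thesis using e by simp
    qed
    \<comment> \<open>Summation of \<open>step\<close>, using that
      \<open>(j+1)^(r+1) - j^(r+1)\<close> is at most \<open>(r+1) (j+1)^r\<close>.\<close>
    have "c / real (Suc r) * real j ^ Suc r \<le> colength (?P <+> ideal_pow R ?Q (L * j))" for j
    proof (induction j)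
      case 0
      then show ?case by simp
    next
      case (Suc j)
      have "real (Suc j) ^ Suc r - real j ^ Suc r =
          (\<Sum>i<Suc r. real j ^ (Suc r - Suc i) * real (Suc j) ^ i)"
        using power_diff_sumr2[of "real (Suc j)" "Suc r" "real j"] by simp
      also have "\<dots> \<le> (\<Sum>i<Suc r. real (Suc j) ^ r)"
      proof (rule sum_mono)
        fix i assume "i \<in> {..<Suc r}"
        then have "real j ^ (Suc r - Suc i) * real (Suc j) ^ i \<le> real (Suc j) ^ (Suc r - Suc i) * real (Suc j) ^ i"
          by (intro mult_right_mono power_mono) auto
        also have "\<dots> = real (Suc j) ^ r" using \<open>i \<in> {..<Suc r}\<close> by (simp flip: power_add)
        finally show "real j ^ (Suc r - Suc i) * real (Suc j) ^ i \<le> real (Suc j) ^ r" .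
      qed
      also have "\<dots> = real (Suc r) * real (Suc j) ^ r" by simp
      finally have "c / real (Suc r) * (real (Suc j) ^ Suc r - real j ^ Suc r) \<le>
          c / real (Suc r) * (real (Suc r) * real (Suc j) ^ r)"
        using c by (intro mult_left_mono) auto
      then have "c / real (Suc r) * real (Suc j) ^ Suc r \<le>
          c * real (Suc j) ^ r + c / real (Suc r) * real j ^ Suc r"
        by (simp add: right_diff_distrib del: of_nat_Suc)
      also have "c * real (Suc j) ^ r \<le> colength (?P' <+> ideal_pow R ?Q (K * Suc j))"
        using g[of "Suc j"] by simp
      also have "\<dots> \<le> colength (?P' <+> ideal_pow R ?Q (L * j + L))"
        using P(4) by (intro mono) (auto simp: L_def algebra_simps)
      also note Suc
      finally show ?case using step[of "L * j"] by (simp add: algebra_simps)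
    qed
    then show ?case using c K
      by (intro exI[of _ "c / real (Suc r)"] conjI exI[of _ L]) (auto simp: L_def)
  }
qed

lemma colength_pow_growth:
  assumes dim: "krull_dim R = enat d"
    and xs: "set xs \<subseteq> m" and k: "ideal_pow R m k \<subseteq> Idl (set xs)"
  shows "\<exists>c>0. \<exists>K\<ge>1. \<forall>j\<ge>1. c * real j ^ d \<le> colength (ideal_pow R (Idl (set xs)) (K * j))"
proof -
  have xsc: "set xs \<subseteq> carrier R" using xs m_subset_carrier by auto
  have Q: "ideal (Idl (set xs)) R" using xsc by (rule genideal_ideal)
  obtain f where f: "\<forall>j\<le>d. primeideal (f j) R" "\<forall>j<d. f j \<subset> f (Suc j)"
    using ex_prime_chain[OF dim] by blast
  obtain c K where "c > 0" "K \<ge> 1" and g: "\<And>j. j \<ge> 1 \<Longrightarrow>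
      c * real j ^ d \<le> colength (f 0 <+> ideal_pow R (Idl (set xs)) (K * j))"
    using colength_growth[OF xs k f] by blast
  have f0: "ideal (f 0) R" using f(1) primeideal.axioms(1)[of "f 0" R] by simp
  have "colength (f 0 <+> ideal_pow R (Idl (set xs)) n) \<le> colength (ideal_pow R (Idl (set xs)) n)" for n
    using cofinite_m_primary[OF ideal_pow_ideal[OF Q] m_primary_pow[OF Q k]]
      add_ideals[OF f0 ideal_pow_ideal[OF Q]] subset_set_add_right[OF f0 ideal_pow_ideal[OF Q]]
    by (intro colength_antimono) auto
  then show ?thesis using g \<open>c > 0\<close> \<open>K \<ge> 1\<close> by (meson order_trans)
qed

end

section \<open>Analytic independence of a system of parameters\<close>

locale parameter_system = noetherian_local_ring R m for R (structure) and m +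
  fixes xs :: "'a list" and d :: nat and k :: nat
  assumes dim: "krull_dim R = enat d" and d_pos: "d \<ge> 1"
    and len: "length xs = d" and xs_m: "set xs \<subseteq> m" and primary: "ideal_pow R m k \<subseteq> Idl (set xs)"
begin

abbreviation Q :: "'a set" where "Q \<equiv> Idl (set xs)"

text \<open>\<open>Q^n\<close> modulo \<open>fibre n\<close> is the degree \<open>n\<close> part of
  the special fibre ring of \<open>Q\<close>.\<close>

abbreviation fibre :: "nat \<Rightarrow> 'a set" where "fibre \<equiv> \<lambda>n. m \<cdot> ideal_pow R Q n"

lemma xs_carrier: "set xs \<subseteq> carrier R"
  using xs_m m_subset_carrier by auto

lemma Q_ideal: "ideal Q R"
  using xs_carrier by (rule genideal_ideal)

lemma Q_subset_m: "Q \<subseteq> m"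
  using genideal_minimal[OF m_ideal xs_m] .

lemma Q_pow_ideal: "ideal (ideal_pow R Q n) R"
  using ideal_pow_ideal[OF Q_ideal] .

lemma cofinite_Q: "cofinite Q"
  using cofinite_m_primary[OF Q_ideal primary] .

lemma fibre_ideal: "ideal (fibre n) R"
  using m_ideal Q_pow_ideal by (rule ideal_prod_is_ideal)

lemma monomial_mem_Q_pow: "\<alpha> \<in> exponents d n \<Longrightarrow> monomial xs \<alpha> \<in> ideal_pow R Q n"
  using monomial_mem_ideal_pow[OF Q_ideal genideal_self[OF xs_carrier], of \<alpha>] len by (simp add: exponents_def)

lemma Q_pow_eq: "ideal_pow R Q n = Idl (monomial xs ` exponents d n)"
  using ideal_pow_Idl[OF xs_carrier] len by simp

lemma fibre_mult: "a \<in> fibre n \<Longrightarrow> b \<in> ideal_pow R Q l \<Longrightarrow> a \<otimes> b \<in> fibre (n + l)"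
  unfolding ideal_pow_add[OF Q_ideal] ideal_prod_assoc[OF m_ideal Q_pow_ideal Q_pow_ideal, symmetric]
  by (rule ideal_prod.prod)

lemma fibre_filtration: "monomial_filtration fibre xs"
  unfolding monomial_filtration_def
  using xs_carrier fibre_ideal fibre_mult monomial_mem_Q_pow len by simp

lemma card_exponents_coordinate:
  assumes "i < s"
  shows "card {\<gamma>. set \<gamma> \<subseteq> {..<n} \<and> length \<gamma> = s \<and> \<gamma> ! i = j} \<le> n ^ (s - 1)"
proof -
  let ?A = "{\<gamma>. set \<gamma> \<subseteq> {..<n} \<and> length \<gamma> = s \<and> \<gamma> ! i = j}"
  let ?B = "{\<gamma>. set \<gamma> \<subseteq> {..<n} \<and> length \<gamma> = s - 1}"
  let ?f = "\<lambda>\<gamma>. take i \<gamma> @ drop (Suc i) \<gamma>"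
  have "inj_on ?f ?A"
  proof (rule inj_onI)
    fix \<gamma> \<delta> assume g: "\<gamma> \<in> ?A" "\<delta> \<in> ?A" "?f \<gamma> = ?f \<delta>"
    then have "take i \<gamma> = take i \<delta>" "drop (Suc i) \<gamma> = drop (Suc i) \<delta>" by auto
    then show "\<gamma> = \<delta>"
      using g assms id_take_nth_drop[of i \<gamma>] id_take_nth_drop[of i \<delta>] by simp
  qed
  moreover have "?f ` ?A \<subseteq> ?B"
    using assms by (auto dest!: in_set_takeD in_set_dropD)
  ultimately have "card ?A \<le> card ?B" by (intro card_inj_on_le finite_lists_length_eq) auto
  also have "card ?B = n ^ (s - 1)" by (simp add: card_lists_length_eq)
  finally show ?thesis .
qed

text \<open>Otherwise every multiple of \<open>monomial xs \<alpha>\<close> could be rewritten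
  modulo \<open>m Q^n\<close> by larger monomials. The monomials not divisible by it would then
  generate \<open>Q^n\<close>; in degrees below \<open>n\<close> there are only O(n^(d-1)) of them,
  against the growth of \<open>colength (ideal_pow R Q n)\<close> like n^d.\<close>

lemma monomial_independent:
  assumes \<alpha>: "length \<alpha> = d"
  shows "\<one> \<notin> leading_colon fibre xs \<alpha>"
proof
  assume one: "\<one> \<in> leading_colon fibre xs \<alpha>"
  define \<Gamma> where "\<Gamma> n = {\<gamma>\<in>exponents d n. \<not> list_all2 (\<le>) \<alpha> \<gamma>}" for n
  have fin: "finite (\<Gamma> n)" for n by (simp add: \<Gamma>_def)
  have mc: "monomial xs ` A \<subseteq> carrier R" for A using xs_carrier by auto
  have G: "ideal (Idl (monomial xs ` \<Gamma> n)) R" for n using mc by (rule genideal_ideal)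
  have fibre_sub: "fibre n \<subseteq> carrier R" for n using ideal_subset_carrier[OF fibre_ideal] .
  have mem: "monomial xs \<gamma> \<in> tail_ideal fibre xs \<gamma>" if le: "list_all2 (\<le>) \<alpha> \<gamma>" for \<gamma>
  proof -
    obtain \<delta> where "length \<delta> = d" "\<gamma> = exp_add \<alpha> \<delta>" using exp_le_imp_exp_add[OF le] \<alpha> by auto
    then have "\<one> \<in> leading_colon fibre xs \<gamma>"
      using leading_colon_exp_add[OF fibre_filtration, of \<alpha> \<delta>] one \<alpha> len by auto
    then show ?thesis using xs_carrier by (simp add: leading_colon_def mem_colon_iff)
  qed
  have gen: "ideal_pow R Q n \<subseteq> fibre n <+> Idl (monomial xs ` \<Gamma> n)" for n
  proof -
    let ?D = "fibre n <+> Idl (monomial xs ` \<Gamma> n)"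
    have D: "ideal ?D R" using fibre_ideal G by (rule add_ideals)
    have "\<forall>\<gamma>\<in>exponents d n. monomial xs \<gamma> \<in> ?D"
    proof (rule ccontr)
      let ?B = "{\<gamma>\<in>exponents d n. monomial xs \<gamma> \<notin> ?D}"
      assume "\<not> ?thesis"
      then have ne: "?B \<noteq> {}" "finite ?B" by auto
      \<comment> \<open>For the largest offending exponent all later monomials lie in
        \<open>?D\<close>, and therefore so does its tail ideal.\<close>
      define \<gamma> where "\<gamma> = Max ?B"
      have \<gamma>: "\<gamma> \<in> ?B" using Max_in[OF ne(2,1)] by (simp add: \<gamma>_def)
      have max: "monomial xs \<beta> \<in> ?D" if "\<beta> \<in> exponents d n" "\<gamma> < \<beta>" for \<beta>
      proof (rule ccontr)
        assume "monomial xs \<beta> \<notin> ?D"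
        then have "\<beta> \<le> \<gamma>" unfolding \<gamma>_def using that(1) ne(2) by (intro Max_ge) auto
        with that(2) show False by simp
      qed
      have "\<gamma> \<notin> \<Gamma> n"
        using \<gamma> subset_set_add_right[OF fibre_ideal G, of n n] genideal_self[OF mc, of "\<Gamma> n"] by blast
      then have "monomial xs \<gamma> \<in> tail_ideal fibre xs \<gamma>"
        using \<gamma> by (intro mem) (auto simp: \<Gamma>_def exponents_def)
      also have "\<dots> \<subseteq> ?D"
        unfolding tail_ideal_def
      proof (rule genideal_minimal[OF D Un_least])
        show "fibre (sum_list \<gamma>) \<subseteq> ?D"
          using subset_set_add_left[OF fibre_ideal G, of n n] \<gamma> by (simp add: exponents_def)
        show "monomial xs ` {\<beta> \<in> exponents (length xs) (sum_list \<gamma>). \<gamma> < \<beta>} \<subseteq> ?D"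
          using max \<gamma> len by (auto simp: exponents_def)
      qed
      finally show False using \<gamma> by simp
    qed
    then have "Idl (monomial xs ` exponents d n) \<subseteq> ?D"
      by (intro genideal_minimal[OF D] image_subsetI) blast
    then show ?thesis by (rule ord_eq_le_trans[OF Q_pow_eq])
  qed
  \<comment> \<open>Nakayama's lemma made explicit: \<open>gen\<close> is substituted into itself
    \<open>l\<close> times. For \<open>l = k\<close> the inclusion of \<open>m^k\<close> in
    \<open>Q\<close> puts the remainder into \<open>Q^(n+1)\<close>.\<close>
  have gen': "ideal_pow R Q n \<subseteq> ideal_pow R m l \<cdot> ideal_pow R Q n <+> Idl (monomial xs ` \<Gamma> n)" for n l
  proof (induction l)
    case 0
    have "ideal_pow R Q n \<subseteq> carrier R \<cdot> ideal_pow R Q n"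
    proof
      fix b assume b: "b \<in> ideal_pow R Q n"
      have "\<one> \<otimes> b \<in> carrier R \<cdot> ideal_pow R Q n" using b by (intro ideal_prod.prod) simp_all
      then show "b \<in> carrier R \<cdot> ideal_pow R Q n" using ideal.Icarr[OF Q_pow_ideal b] by simp
    qed
    moreover have "ideal (carrier R \<cdot> ideal_pow R Q n) R"
      using oneideal Q_pow_ideal by (rule ideal_prod_is_ideal)
    ultimately show ?case using subset_set_add_left[OF _ G, of "carrier R \<cdot> ideal_pow R Q n" n] by simp
  next
    case (Suc l)
    let ?M = "ideal_pow R m (Suc l) \<cdot> ideal_pow R Q n"
    let ?T = "?M <+> Idl (monomial xs ` \<Gamma> n)"
    have M: "ideal ?M R" using ideal_pow_ideal[OF m_ideal] Q_pow_ideal by (rule ideal_prod_is_ideal)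
    have T: "ideal ?T R" using M G by (rule add_ideals)
    have "fibre n \<subseteq> ?T"
    proof (rule ideal_prod_least[OF T])
      fix a b assume a: "a \<in> m" and b: "b \<in> ideal_pow R Q n"
      obtain u v where uv: "u \<in> ideal_pow R m l \<cdot> ideal_pow R Q n" "v \<in> Idl (monomial xs ` \<Gamma> n)" "b = u \<oplus> v"
        using Suc b unfolding subset_iff mem_set_add by blast
      have mQ: "ideal (ideal_pow R m l \<cdot> ideal_pow R Q n) R"
        using ideal_pow_ideal[OF m_ideal] Q_pow_ideal by (rule ideal_prod_is_ideal)
      have c: "a \<in> carrier R" "u \<in> carrier R" "v \<in> carrier R"
        using a m_subset_carrier ideal.Icarr[OF mQ uv(1)] ideal.Icarr[OF G uv(2)] by auto
      have "a \<otimes> u \<in> m \<cdot> (ideal_pow R m l \<cdot> ideal_pow R Q n)" using a uv(1) by (rule ideal_prod.prod)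
      also have "m \<cdot> (ideal_pow R m l \<cdot> ideal_pow R Q n) = (m \<cdot> ideal_pow R m l) \<cdot> ideal_pow R Q n"
        using ideal_prod_assoc[OF m_ideal ideal_pow_ideal[OF m_ideal] Q_pow_ideal] by simp
      also have "m \<cdot> ideal_pow R m l = ideal_pow R m (Suc l)"
        unfolding ideal_pow_Suc using ideal_prod_commute[OF m_ideal ideal_pow_ideal[OF m_ideal]] .
      finally have "a \<otimes> u \<in> ?M" .
      moreover have "a \<otimes> v \<in> Idl (monomial xs ` \<Gamma> n)" using ideal.I_l_closed[OF G uv(2) c(1)] .
      moreover have "a \<otimes> b = a \<otimes> u \<oplus> a \<otimes> v" unfolding uv(3) using c by (simp add: r_distr)
      ultimately show "a \<otimes> b \<in> ?T" unfolding mem_set_add by blast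
    qed
    moreover have "Idl (monomial xs ` \<Gamma> n) \<subseteq> ?T" by (rule subset_set_add_right[OF M G])
    ultimately show ?case using gen[of n] set_add_least[OF T] by (meson subset_trans)
  qed
  have QG: "ideal_pow R Q n = Idl (ideal_pow R Q (Suc n) \<union> monomial xs ` \<Gamma> n)" for n
  proof (rule antisym)
    have "ideal_pow R m k \<cdot> ideal_pow R Q n \<subseteq> Q \<cdot> ideal_pow R Q n"
      using primary by (rule ideal_prod_mono) simp
    also have "\<dots> = ideal_pow R Q (Suc n)"
      unfolding ideal_pow_Suc using ideal_prod_commute[OF Q_ideal Q_pow_ideal] .
    finally have "ideal_pow R Q n \<subseteq> ideal_pow R Q (Suc n) <+> Idl (monomial xs ` \<Gamma> n)"
      using gen'[of n k] set_add_mono by blast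
    also have "\<dots> = Idl (ideal_pow R Q (Suc n) \<union> monomial xs ` \<Gamma> n)"
      using Idl_Un_Idl[OF ideal_subset_carrier[OF Q_pow_ideal] mc] Idl_ideal[OF Q_pow_ideal] by simp
    finally show "ideal_pow R Q n \<subseteq> Idl (ideal_pow R Q (Suc n) \<union> monomial xs ` \<Gamma> n)" .
    show "Idl (ideal_pow R Q (Suc n) \<union> monomial xs ` \<Gamma> n) \<subseteq> ideal_pow R Q n"
      using ideal_pow_antimono[OF Q_ideal, of n "Suc n"] monomial_mem_Q_pow
      by (intro genideal_minimal[OF Q_pow_ideal]) (auto simp: \<Gamma>_def)
  qed
  have step: "colength (ideal_pow R Q (Suc n)) \<le> colength (ideal_pow R Q n) + colength Q * real (card (\<Gamma> n))" for n
  proof -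
    let ?B = "ideal_pow R Q (Suc n)"
    let ?c = "\<lambda>\<gamma>. colon (Idl (?B \<union> monomial xs ` {j\<in>\<Gamma> n. \<gamma> < j})) (monomial xs \<gamma>)"
    have c: "ideal (?c \<gamma>) R \<and> Q \<subseteq> ?c \<gamma>" if \<gamma>: "\<gamma> \<in> \<Gamma> n" for \<gamma>
    proof
      have sub: "?B \<union> monomial xs ` {j\<in>\<Gamma> n. \<gamma> < j} \<subseteq> carrier R"
        using mc ideal_subset_carrier[OF Q_pow_ideal] by auto
      show "ideal (?c \<gamma>) R" using xs_carrier by (intro colon_ideal genideal_ideal sub) auto
      show "Q \<subseteq> ?c \<gamma>"
      proof
        fix q assume q: "q \<in> Q"
        have "q \<otimes> monomial xs \<gamma> \<in> ideal_pow R Q (1 + n)"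
          using q monomial_mem_Q_pow[of \<gamma> n] \<gamma> ideal_pow_1[OF Q_ideal]
          by (intro mult_mem_ideal_pow[OF Q_ideal]) (auto simp: \<Gamma>_def)
        then have "q \<otimes> monomial xs \<gamma> \<in> Idl (?B \<union> monomial xs ` {j\<in>\<Gamma> n. \<gamma> < j})"
          using genideal_self[OF sub] by auto
        then show "q \<in> ?c \<gamma>" using ideal.Icarr[OF Q_ideal q] by (simp add: mem_colon_iff)
      qed
    qed
    have "ideal_length ?B (ideal_pow R Q n) = (\<Sum>\<gamma>\<in>\<Gamma> n. ideal_length (?c \<gamma>) (carrier R))"
      unfolding QG[of n] using ideal_length_Idl_span[OF Q_pow_ideal fin, of n "monomial xs" "Suc n"] xs_carrier
      by simp
    moreover have "(\<Sum>\<gamma>\<in>\<Gamma> n. ideal_length (?c \<gamma>) (carrier R)) < \<infinity> \<and>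
        real (the_enat (\<Sum>\<gamma>\<in>\<Gamma> n. ideal_length (?c \<gamma>) (carrier R))) =
        (\<Sum>\<gamma>\<in>\<Gamma> n. real (the_enat (ideal_length (?c \<gamma>) (carrier R))))"
    proof (rule real_the_enat_sum[OF fin])
      fix \<gamma> assume "\<gamma> \<in> \<Gamma> n"
      then have "cofinite (?c \<gamma>)" using c cofinite_superset[OF cofinite_Q] by blast
      then show "ideal_length (?c \<gamma>) (carrier R) < \<infinity>" by (simp add: cofinite_def)
    qed
    ultimately have "real (the_enat (ideal_length ?B (ideal_pow R Q n))) = (\<Sum>\<gamma>\<in>\<Gamma> n. colength (?c \<gamma>))"
      by (simp add: colength_def)
    also have "\<dots> \<le> (\<Sum>\<gamma>\<in>\<Gamma> n. colength Q)"
      using c by (intro sum_mono colength_antimono[OF cofinite_Q]) auto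
    finally have "real (the_enat (ideal_length ?B (ideal_pow R Q n))) \<le> colength Q * real (card (\<Gamma> n))"
      by (simp add: mult.commute)
    moreover have "cofinite ?B" using hilbert_samuel_cofinite[OF xs_carrier cofinite_Q] .
    ultimately show ?thesis
      using colength_diff(2)[OF \<open>cofinite ?B\<close> Q_pow_ideal, of n] ideal_pow_antimono[OF Q_ideal, of n "Suc n"] by simp
  qed
  have upper: "colength (ideal_pow R Q n) \<le> colength Q * real (card (\<Union>l<n. \<Gamma> l))" for n
  proof (induction n)
    case (Suc n)
    have "(\<Union>l<Suc n. \<Gamma> l) = (\<Union>l<n. \<Gamma> l) \<union> \<Gamma> n" by (auto simp: less_Suc_eq)
    moreover have "(\<Union>l<n. \<Gamma> l) \<inter> \<Gamma> n = {}" by (auto simp: \<Gamma>_def exponents_def)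
    ultimately have "card (\<Union>l<Suc n. \<Gamma> l) = card (\<Union>l<n. \<Gamma> l) + card (\<Gamma> n)"
      using fin by (simp add: card_Un_disjoint)
    with Suc step[of n] show ?case by (simp add: algebra_simps)
  qed simp
  \<comment> \<open>An exponent \<gamma> that does not dominate \<alpha> has some entry
    \<open>\<gamma> ! i = j\<close> with \<open>j < \<alpha> ! i\<close>. These are
    \<open>sum_list \<alpha>\<close> slices of a cube of side \<open>n\<close>, each with at most
    \<open>n ^ (d - 1)\<close> points.\<close>
  have count: "card (\<Union>l<n. \<Gamma> l) \<le> sum_list \<alpha> * n ^ (d - 1)" for n
  proof -
    let ?A = "\<lambda>i j. {\<gamma>. set \<gamma> \<subseteq> {..<n} \<and> length \<gamma> = d \<and> \<gamma> ! i = j}"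
    have finA: "finite (?A i j)" for i j
      by (rule finite_subset[OF _ finite_lists_length_eq[of "{..<n}" d]]) auto
    have "(\<Union>l<n. \<Gamma> l) \<subseteq> (\<Union>i<d. \<Union>j<\<alpha> ! i. ?A i j)"
    proof
      fix \<gamma> assume "\<gamma> \<in> (\<Union>l<n. \<Gamma> l)"
      then obtain l where l: "l < n" "\<gamma> \<in> exponents d l" "\<not> list_all2 (\<le>) \<alpha> \<gamma>" by (auto simp: \<Gamma>_def)
      then have lg: "length \<gamma> = d" by (simp add: exponents_def)
      obtain i where "i < d" "\<gamma> ! i < \<alpha> ! i" using l(3) lg \<alpha> by (auto simp: list_all2_conv_all_nth not_le)
      moreover have "set \<gamma> \<subseteq> {..<n}" using exponents_subset_box[OF l(2)] l(1) by auto
      ultimately show "\<gamma> \<in> (\<Union>i<d. \<Union>j<\<alpha> ! i. ?A i j)" using lg by auto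
    qed
    then have "card (\<Union>l<n. \<Gamma> l) \<le> card (\<Union>i<d. \<Union>j<\<alpha> ! i. ?A i j)"
      using finA by (intro card_mono) auto
    also have "\<dots> \<le> (\<Sum>i<d. card (\<Union>j<\<alpha> ! i. ?A i j))" by (intro card_UN_le) simp
    also have "\<dots> \<le> (\<Sum>i<d. \<Sum>j<\<alpha> ! i. card (?A i j))" by (intro sum_mono card_UN_le) simp
    also have "\<dots> \<le> (\<Sum>i<d. \<Sum>j<\<alpha> ! i. n ^ (d - 1))"
      by (intro sum_mono card_exponents_coordinate) simp
    also have "\<dots> = sum_list \<alpha> * n ^ (d - 1)"
      using \<alpha> by (simp add: sum_list_sum_nth sum_distrib_right lessThan_atLeast0)
    finally show ?thesis .
  qed
  obtain c K where cK: "c > 0" "K \<ge> 1" "\<And>j. j \<ge> 1 \<Longrightarrow> c * real j ^ d \<le> colength (ideal_pow R Q (K * j))"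
    using colength_pow_growth[OF dim xs_m primary] by blast
  define C where "C = colength Q * real (sum_list \<alpha>) * real K ^ (d - 1)"
  have "real j \<le> C / c" if j: "j \<ge> 1" for j
  proof -
    have "c * real j ^ d \<le> colength Q * real (card (\<Union>l<K * j. \<Gamma> l))" using cK(3)[OF j] upper by (rule order_trans)
    also have "\<dots> \<le> colength Q * real (sum_list \<alpha> * (K * j) ^ (d - 1))"
      using count[of "K * j"] by (intro mult_left_mono) (auto simp flip: of_nat_mult of_nat_power)
    also have "\<dots> = C * real j ^ (d - 1)" by (simp add: C_def power_mult_distrib)
    also have "real j ^ d = real j * real j ^ (d - 1)" using d_pos by (cases d) auto
    finally have "c * real j \<le> C" using j by simp
    then show ?thesis using cK(1) by (simp add: field_simps)
  qed
  moreover obtain j :: nat where "j \<ge> 1" "C / c < real j"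
    using reals_Archimedean2[of "max 1 (C / c)"] by (metis less_eq_real_def max_less_iff_conj of_nat_1 of_nat_le_iff)
  ultimately show False by fastforce
qed

section \<open>Initial forms\<close>

text \<open>Representatives in \<open>R\<close> of the nonzero forms of degree \<open>r\<close> in
  the special fibre ring.\<close>

definition initial_forms :: "nat \<Rightarrow> 'a set" where
  "initial_forms r = ideal_pow R Q r - fibre r"

lemma monomial_not_mem_tail:
  assumes "length \<alpha> = d" "c \<in> carrier R" "c \<notin> m"
  shows "c \<otimes> monomial xs \<alpha> \<notin> tail_ideal fibre xs \<alpha>"
proof
  assume mem: "c \<otimes> monomial xs \<alpha> \<in> tail_ideal fibre xs \<alpha>"
  obtain y where y: "y \<in> carrier R" "y \<otimes> c = \<one>" using unit_of_not_mem_m[OF assms(2,3)] by blast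
  have "y \<otimes> (c \<otimes> monomial xs \<alpha>) \<in> tail_ideal fibre xs \<alpha>"
    using ideal.I_l_closed[OF tail_ideal_ideal[OF fibre_filtration] mem y(1)] .
  moreover have "y \<otimes> (c \<otimes> monomial xs \<alpha>) = monomial xs \<alpha>"
    using y assms(2) xs_carrier by (simp add: m_assoc[symmetric])
  ultimately have "\<one> \<in> leading_colon fibre xs \<alpha>"
    using xs_carrier by (simp add: leading_colon_def mem_colon_iff)
  with monomial_independent[OF assms(1)] show False by simp
qed

text \<open>Terms with coefficient in \<open>m\<close> lie in \<open>fibre r\<close> and are
  absorbed, the smallest exponents first. As \<tau> is not in \<open>fibre r\<close>, a term with
  unit coefficient must be met.\<close>

lemma initial_form_leading:
  assumes \<tau>: "\<tau> \<in> initial_forms r"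
  shows "\<exists>\<alpha>\<in>exponents d r. \<exists>c\<in>carrier R - m. \<exists>h\<in>tail_ideal fibre xs \<alpha>. \<tau> = h \<oplus> c \<otimes> monomial xs \<alpha>"
proof -
  have ind: "\<tau> \<in> Idl (fibre r \<union> monomial xs ` U) \<Longrightarrow>
      \<exists>\<alpha>\<in>exponents d r. \<exists>c\<in>carrier R - m. \<exists>h\<in>tail_ideal fibre xs \<alpha>. \<tau> = h \<oplus> c \<otimes> monomial xs \<alpha>"
    if "finite U" "U \<subseteq> exponents d r"
      "\<And>\<alpha> \<beta>. \<alpha> \<in> U \<Longrightarrow> \<beta> \<in> exponents d r \<Longrightarrow> \<alpha> < \<beta> \<Longrightarrow> \<beta> \<in> U" for U
    using that
  proof (induction U rule: finite_linorder_min_induct)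
    case empty
    then show ?case using \<tau> Idl_ideal[OF fibre_ideal] by (simp add: initial_forms_def)
  next
    case (insert \<alpha> U)
    have \<alpha>: "\<alpha> \<in> exponents d r" "sum_list \<alpha> = r" using insert.prems(2) by (auto simp: exponents_def)
    have U: "U = {\<beta>\<in>exponents d r. \<alpha> < \<beta>}"
      using insert.hyps(2) insert.prems(2) insert.prems(3)[of \<alpha>] by auto
    have sub: "fibre r \<union> monomial xs ` U \<subseteq> carrier R"
      using xs_carrier ideal_subset_carrier[OF fibre_ideal] by auto
    obtain h c where hc: "h \<in> Idl (fibre r \<union> monomial xs ` U)" "c \<in> carrier R" "\<tau> = h \<oplus> c \<otimes> monomial xs \<alpha>"
      using insert.prems(1) mem_Idl_insert[OF sub, of "monomial xs \<alpha>" \<tau>] xs_carrier by auto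
    have tail: "tail_ideal fibre xs \<alpha> = Idl (fibre r \<union> monomial xs ` U)"
      unfolding tail_ideal_def U \<alpha>(2) len ..
    show ?case
    proof (cases "c \<in> m")
      case False
      with hc \<alpha>(1) tail show ?thesis by blast
    next
      case True
      have "c \<otimes> monomial xs \<alpha> \<in> fibre r"
        using True monomial_mem_Q_pow[OF \<alpha>(1)] by (rule ideal_prod.prod)
      then have "\<tau> \<in> Idl (fibre r \<union> monomial xs ` U)"
        unfolding hc(3) using genideal_self[OF sub] hc(1) by (intro ideal_a_closed genideal_ideal sub) auto
      moreover have "\<beta> \<in> U" if "\<gamma> \<in> U" "\<beta> \<in> exponents d r" "\<gamma> < \<beta>" for \<gamma> \<beta>
        using that less_trans[of \<alpha> \<gamma> \<beta>] by (simp add: U)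
      ultimately show ?thesis using insert.IH insert.prems(2) by blast
    qed
  qed
  have "\<tau> \<in> Idl (fibre r \<union> monomial xs ` exponents d r)"
  proof -
    have "fibre r \<union> monomial xs ` exponents d r \<subseteq> carrier R"
      using xs_carrier ideal_subset_carrier[OF fibre_ideal] by auto
    then have "Idl (monomial xs ` exponents d r) \<subseteq> Idl (fibre r \<union> monomial xs ` exponents d r)"
      by (intro Idl_mono) auto
    moreover have "\<tau> \<in> Idl (monomial xs ` exponents d r)"
      using \<tau> Q_pow_eq[of r] by (simp add: initial_forms_def)
    ultimately show ?thesis by blast
  qed
  then show ?thesis using ind[of "exponents d r"] by simp
qed

text \<open>The special fibre ring is a domain: the product of the leading terms has a unit
  coefficient at \<open>exp_add \<alpha> \<beta>\<close>, and all other products fall into the tail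
  there.\<close>

lemma initial_forms_mult:
  assumes "\<tau> \<in> initial_forms r" "\<upsilon> \<in> initial_forms s"
  shows "\<tau> \<otimes> \<upsilon> \<in> initial_forms (r + s)"
proof -
  obtain \<alpha> c h where \<tau>: "\<alpha> \<in> exponents d r" "c \<in> carrier R - m" "h \<in> tail_ideal fibre xs \<alpha>"
      "\<tau> = h \<oplus> c \<otimes> monomial xs \<alpha>" using initial_form_leading[OF assms(1)] by blast
  obtain \<beta> e g where \<upsilon>: "\<beta> \<in> exponents d s" "e \<in> carrier R - m" "g \<in> tail_ideal fibre xs \<beta>"
      "\<upsilon> = g \<oplus> e \<otimes> monomial xs \<beta>" using initial_form_leading[OF assms(2)] by blast
  have la: "length \<alpha> = d" "sum_list \<alpha> = r" "length \<beta> = d" "sum_list \<beta> = s"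
    using \<tau> \<upsilon> by (auto simp: exponents_def)
  let ?D = "tail_ideal fibre xs (exp_add \<alpha> \<beta>)"
  note T = tail_ideal_ideal[OF fibre_filtration]
  have cr: "h \<in> carrier R" "g \<in> carrier R" "monomial xs \<alpha> \<in> carrier R" "monomial xs \<beta> \<in> carrier R"
      "c \<in> carrier R" "e \<in> carrier R"
    using ideal.Icarr[OF T \<tau>(3)] ideal.Icarr[OF T \<upsilon>(3)] xs_carrier \<tau>(2) \<upsilon>(2) by auto
  have sQ: "\<upsilon> \<in> ideal_pow R Q s" using assms(2) by (simp add: initial_forms_def)
  have sc: "\<upsilon> \<in> carrier R" using ideal.Icarr[OF Q_pow_ideal sQ] .
  have g': "monomial xs \<alpha> \<otimes> g \<in> ?D"
    using tail_ideal_exp_add[OF fibre_filtration, of \<beta> \<alpha>] \<upsilon>(3) la len cr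
    by (auto simp: mem_colon_iff exp_add_commute m_comm)
  have D_carr: "fibre (r + s) \<union> monomial xs ` {\<gamma>\<in>exponents d (r + s). exp_add \<alpha> \<beta> < \<gamma>} \<subseteq> carrier R"
    using xs_carrier ideal_subset_carrier[OF fibre_ideal] by auto
  have D: "?D = Idl (fibre (r + s) \<union> monomial xs ` {\<gamma>\<in>exponents d (r + s). exp_add \<alpha> \<beta> < \<gamma>})"
    using la by (simp add: tail_ideal_def sum_list_exp_add len)
  \<comment> \<open>Products involving the tail of \<tau> are treated here; \<open>g'\<close> has
    settled those of its leading monomial with the tail of \<upsilon>.\<close>
  have "tail_ideal fibre xs \<alpha> \<subseteq> colon ?D \<upsilon>"
    unfolding tail_ideal_def[of fibre xs \<alpha>]
  proof (rule genideal_minimal[OF colon_ideal[OF T sc] Un_least])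
    show "fibre (sum_list \<alpha>) \<subseteq> colon ?D \<upsilon>"
      using fibre_mult[OF _ sQ, of _ r] genideal_self[OF D_carr] ideal.Icarr[OF fibre_ideal] la
      unfolding D mem_colon_iff subset_iff by blast
    show "monomial xs ` {\<gamma> \<in> exponents (length xs) (sum_list \<alpha>). \<alpha> < \<gamma>} \<subseteq> colon ?D \<upsilon>"
    proof (rule image_subsetI)
      fix \<gamma> assume "\<gamma> \<in> {\<gamma> \<in> exponents (length xs) (sum_list \<alpha>). \<alpha> < \<gamma>}"
      then have \<gamma>: "\<gamma> \<in> exponents d r" "length \<gamma> = d" "\<alpha> < \<gamma>" using len la by (auto simp: exponents_def)
      have less: "exp_add \<alpha> \<beta> < exp_add \<gamma> \<beta>" using \<gamma> la by (intro exp_add_less_mono) auto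
      have mem: "exp_add \<gamma> \<beta> \<in> exponents d (r + s)" using \<gamma>(1) \<upsilon>(1) by (rule exp_add_exponents)
      have mg: "monomial xs \<gamma> \<in> carrier R" using xs_carrier by simp
      have "tail_ideal fibre xs (exp_add \<gamma> \<beta>) \<subseteq> ?D"
        unfolding D unfolding tail_ideal_def using la \<gamma> less xs_carrier ideal_subset_carrier[OF fibre_ideal]
        by (intro Idl_mono) (auto simp: sum_list_exp_add len exponents_def intro: less_trans)
      moreover have "g \<otimes> monomial xs \<gamma> \<in> tail_ideal fibre xs (exp_add \<gamma> \<beta>)"
        using tail_ideal_exp_add[OF fibre_filtration, of \<beta> \<gamma>] \<upsilon>(3) la \<gamma> len
        by (auto simp: mem_colon_iff exp_add_commute)
      ultimately have 1: "g \<otimes> monomial xs \<gamma> \<in> ?D" by blast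
      have "monomial xs (exp_add \<gamma> \<beta>) \<in> ?D"
        unfolding D using genideal_self[OF D_carr] mem less by blast
      then have 2: "e \<otimes> monomial xs (exp_add \<gamma> \<beta>) \<in> ?D" using ideal.I_l_closed[OF T] cr by simp
      have "monomial xs (exp_add \<gamma> \<beta>) = monomial xs \<gamma> \<otimes> monomial xs \<beta>"
        using monomial_exp_add[OF _ _ xs_carrier, of \<gamma> \<beta>] \<gamma> la len by simp
      then have "monomial xs \<gamma> \<otimes> \<upsilon> = g \<otimes> monomial xs \<gamma> \<oplus> e \<otimes> monomial xs (exp_add \<gamma> \<beta>)"
        unfolding \<upsilon>(4) using cr mg by algebra
      then show "monomial xs \<gamma> \<in> colon ?D \<upsilon>" using ideal_a_closed[OF T 1 2] mg by (simp add: mem_colon_iff)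
    qed
  qed
  then have h': "h \<otimes> \<upsilon> \<in> ?D" using \<tau>(3) by (auto simp: mem_colon_iff)
  have "\<tau> \<otimes> \<upsilon> \<notin> fibre (r + s)"
  proof
    assume "\<tau> \<otimes> \<upsilon> \<in> fibre (r + s)"
    then have tD: "\<tau> \<otimes> \<upsilon> \<in> ?D" unfolding D using genideal_self[OF D_carr] by blast
    have "c \<otimes> e \<otimes> monomial xs (exp_add \<alpha> \<beta>) = \<tau> \<otimes> \<upsilon> \<ominus> (h \<otimes> \<upsilon> \<oplus> c \<otimes> (monomial xs \<alpha> \<otimes> g))"
    proof -
      have "monomial xs (exp_add \<alpha> \<beta>) = monomial xs \<alpha> \<otimes> monomial xs \<beta>"
        using monomial_exp_add[OF _ _ xs_carrier, of \<alpha> \<beta>] la len by simp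
      then show ?thesis unfolding \<tau>(4) \<upsilon>(4) using cr by algebra
    qed
    also have "\<dots> \<in> ?D"
      using ideal.I_l_closed[OF T g' cr(5)] h' tD by (intro ideal_minus_closed[OF T] ideal_a_closed[OF T])
    finally have "c \<otimes> e \<otimes> monomial xs (exp_add \<alpha> \<beta>) \<in> ?D" .
    moreover have "c \<otimes> e \<notin> m" using primeideal.I_prime[OF m_prime, of c e] \<tau>(2) \<upsilon>(2) by blast
    ultimately show False using monomial_not_mem_tail[of "exp_add \<alpha> \<beta>" "c \<otimes> e"] la cr by simp
  qed
  moreover have "\<tau> \<otimes> \<upsilon> \<in> ideal_pow R Q (r + s)"
    using mult_mem_ideal_pow[OF Q_ideal _ sQ] assms(1) by (simp add: initial_forms_def)
  ultimately show ?thesis by (simp add: initial_forms_def)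
qed

lemma fibre_0: "fibre 0 = m"
  using ideal_prod_one[OF m_ideal] by simp

lemma initial_forms_0: "initial_forms 0 = carrier R - m"
  unfolding initial_forms_def fibre_0 by simp

lemma initial_forms_carrier: "\<tau> \<in> initial_forms r \<Longrightarrow> \<tau> \<in> carrier R"
  using ideal.Icarr[OF Q_pow_ideal] by (auto simp: initial_forms_def)

lemma Q_pow_Suc_subset_fibre: "ideal_pow R Q (Suc n) \<subseteq> fibre n"
  unfolding ideal_pow_Suc ideal_prod_commute[OF Q_pow_ideal Q_ideal]
  using Q_subset_m by (rule ideal_prod_mono) simp

lemma initial_forms_not_mem_pow: "\<tau> \<in> initial_forms r \<Longrightarrow> \<tau> \<in> ideal_pow R Q s \<Longrightarrow> s \<le> r"
  using Q_pow_Suc_subset_fibre[of r] ideal_pow_antimono[OF Q_ideal, of "Suc r" s]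
  by (force simp: initial_forms_def not_le[symmetric] Suc_le_eq)

end

section \<open>Multiplicative norms\<close>

lemma le_mult_Inf:
  fixes a b :: real
  assumes "S \<noteq> {}" "0 \<le> b" "\<And>s. s \<in> S \<Longrightarrow> a \<le> b * s"
  shows "a \<le> b * Inf S"
proof (cases "b = 0")
  case True
  then show ?thesis using assms(1,3) by auto
next
  case False
  then have "a / b \<le> Inf S"
    using assms by (intro cInf_greatest) (auto simp: field_simps)
  then show ?thesis using False assms(2) by (simp add: field_simps)
qed

lemma le_mult_of_less:
  fixes x y z :: real
  assumes "0 \<le> x" "0 \<le> y" "\<And>t u. x < t \<Longrightarrow> y < u \<Longrightarrow> z \<le> t * u"
  shows "z \<le> x * y"
proof (rule field_le_epsilon)
  fix e :: real assume "0 < e"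
  \<comment> \<open>The bound by 1 keeps the quadratic term \<open>\<delta> * \<delta>\<close> below
    \<delta>, so that \<delta> times \<open>x + y + 1\<close> dominates the whole error.\<close>
  define \<delta> where "\<delta> = min 1 (e / (x + y + 1))"
  have \<delta>: "0 < \<delta>" "\<delta> \<le> 1" "\<delta> \<le> e / (x + y + 1)"
    using \<open>0 < e\<close> assms(1,2) by (auto simp: \<delta>_def)
  have pos: "0 < x + y + 1" using assms(1,2) by simp
  have "\<delta> * (x + y + 1) \<le> e / (x + y + 1) * (x + y + 1)"
    using \<delta>(3) pos by (intro mult_right_mono) auto
  then have \<delta>_le: "\<delta> * (x + y + 1) \<le> e" using pos by simp
  have "z \<le> (x + \<delta>) * (y + \<delta>)" using \<delta> by (intro assms(3)) auto
  also have "\<dots> = x * y + \<delta> * (x + y + \<delta>)" by (simp add: algebra_simps)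
  also have "\<delta> * (x + y + \<delta>) \<le> \<delta> * (x + y + 1)" using \<delta> by (intro mult_left_mono) auto
  finally show "z \<le> x * y + e" using \<delta>_le by simp
qed

context parameter_system
begin

text \<open>Submultiplicative non-archimedean norms that restrict to the \<open>Q\<close>-adic one on initial forms.
  Setting them to zero outside the carrier makes the pointwise order antisymmetric.\<close>

definition form_norm :: "('a \<Rightarrow> real) \<Rightarrow> bool" where
  "form_norm N \<longleftrightarrow> (\<forall>x. x \<notin> carrier R \<longrightarrow> N x = 0) \<and> (\<forall>x. 0 \<le> N x \<and> N x \<le> 1) \<and> N \<zero> = 0 \<and>
     (\<forall>x\<in>carrier R. \<forall>y\<in>carrier R. N (x \<oplus> y) \<le> max (N x) (N y) \<and> N (x \<otimes> y) \<le> N x * N y) \<and>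
     (\<forall>r. \<forall>\<tau>\<in>initial_forms r. N \<tau> = (1/2) ^ r)"

lemma form_normD:
  assumes "form_norm N"
  shows "x \<notin> carrier R \<Longrightarrow> N x = 0" "0 \<le> N x" "N x \<le> 1" "N \<zero> = 0"
    and "x \<in> carrier R \<Longrightarrow> y \<in> carrier R \<Longrightarrow> N (x \<oplus> y) \<le> max (N x) (N y)"
    and "x \<in> carrier R \<Longrightarrow> y \<in> carrier R \<Longrightarrow> N (x \<otimes> y) \<le> N x * N y"
    and "\<tau> \<in> initial_forms r \<Longrightarrow> N \<tau> = (1/2) ^ r"
  using assms unfolding form_norm_def by blast+

lemma form_norm_one: "form_norm N \<Longrightarrow> N \<one> = 1"
  using form_normD(7)[of N \<one> 0] m_proper by (simp add: initial_forms_0)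

lemma form_norm_pow_le: "form_norm N \<Longrightarrow> x \<in> carrier R \<Longrightarrow> N (x [^] (j::nat)) \<le> N x ^ j"
proof (induction j)
  case (Suc j)
  have "N (x [^] j \<otimes> x) \<le> N (x [^] j) * N x" using Suc form_normD(6) by simp
  also have "\<dots> \<le> N x ^ j * N x" using Suc form_normD(2) by (intro mult_right_mono) auto
  finally show ?case by (simp add: mult.commute)
qed (simp add: form_norm_one)

text \<open>The members need not be norms themselves: it suffices that sums and products estimated
  by \<open>f\<close> and \<open>g\<close> are controlled by some third member \<open>h\<close>. In
  a chain of norms \<open>h\<close> is the smaller of the two; in a localization it comes from a
  product of denominators.\<close>

lemma form_norm_INF:
  assumes ne: "F \<noteq> {}"
    and out: "\<And>f x. f \<in> F \<Longrightarrow> x \<notin> carrier R \<Longrightarrow> f x = 0"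
    and bd: "\<And>f x. f \<in> F \<Longrightarrow> 0 \<le> f x \<and> f x \<le> 1" and zero: "\<And>f. f \<in> F \<Longrightarrow> f \<zero> = 0"
    and add: "\<And>f g. f \<in> F \<Longrightarrow> g \<in> F \<Longrightarrow>
      \<exists>h\<in>F. \<forall>x\<in>carrier R. \<forall>y\<in>carrier R. h (x \<oplus> y) \<le> max (f x) (g y)"
    and mult: "\<And>f g. f \<in> F \<Longrightarrow> g \<in> F \<Longrightarrow>
      \<exists>h\<in>F. \<forall>x\<in>carrier R. \<forall>y\<in>carrier R. h (x \<otimes> y) \<le> f x * g y"
    and ge: "\<And>f r \<tau>. f \<in> F \<Longrightarrow> \<tau> \<in> initial_forms r \<Longrightarrow> (1/2) ^ r \<le> f \<tau>"
    and le: "\<And>r \<tau>. \<tau> \<in> initial_forms r \<Longrightarrow> \<exists>f\<in>F. f \<tau> \<le> (1/2) ^ r"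
  shows "form_norm (\<lambda>x. INF f\<in>F. f x) \<and> (\<forall>f\<in>F. \<forall>x. (INF f\<in>F. f x) \<le> f x)"
proof
  have bdd: "bdd_below ((\<lambda>f. f x) ` F)" for x using bd by (intro bdd_belowI2[of _ 0]) auto
  have lower: "(INF f\<in>F. f x) \<le> f x" if "f \<in> F" for f x using bdd that by (intro cINF_lower) auto
  then show "\<forall>f\<in>F. \<forall>x. (INF f\<in>F. f x) \<le> f x" by blast
  have nonneg: "0 \<le> (INF f\<in>F. f x)" for x using ne bd by (intro cINF_greatest) auto
  obtain f0 where f0: "f0 \<in> F" using ne by blast
  show "form_norm (\<lambda>x. INF f\<in>F. f x)"
    unfolding form_norm_def
  proof (intro conjI allI impI ballI)
    fix x assume "x \<notin> carrier R"
    then have "(INF f\<in>F. f x) = (INF f\<in>F. 0)" using out by (intro INF_cong) auto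
    then show "(INF f\<in>F. f x) = 0" using ne by simp
  next
    show "0 \<le> (INF f\<in>F. f x)" for x by (rule nonneg)
    show "(INF f\<in>F. f x) \<le> 1" for x using lower[OF f0, of x] bd[OF f0, of x] by simp
    have "(INF f\<in>F. f \<zero>) = (INF f\<in>F. 0)" using zero by (intro INF_cong) auto
    then show "(INF f\<in>F. f \<zero>) = 0" using ne by simp
  next
    fix x y assume xy: "x \<in> carrier R" "y \<in> carrier R"
    show "(INF f\<in>F. f (x \<oplus> y)) \<le> max (INF f\<in>F. f x) (INF f\<in>F. f y)"
    proof (rule ccontr)
      assume "\<not> ?thesis"
      then have "(INF f\<in>F. f x) < (INF f\<in>F. f (x \<oplus> y))" "(INF f\<in>F. f y) < (INF f\<in>F. f (x \<oplus> y))" by auto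
      then obtain f g where fg: "f \<in> F" "f x < (INF f\<in>F. f (x \<oplus> y))" "g \<in> F" "g y < (INF f\<in>F. f (x \<oplus> y))"
        using cINF_less_iff[OF ne bdd] by auto
      then obtain h where "h \<in> F" "h (x \<oplus> y) \<le> max (f x) (g y)" using add xy by blast
      then show False using lower[of h "x \<oplus> y"] fg by auto
    qed
    have "(INF f\<in>F. f (x \<otimes> y)) \<le> (INF f\<in>F. f x) * g y" if g: "g \<in> F" for g
    proof -
      have "(INF f\<in>F. f (x \<otimes> y)) \<le> g y * (INF f\<in>F. f x)"
      proof (rule le_mult_Inf)
        fix t assume "t \<in> (\<lambda>f. f x) ` F"
        then obtain f where f: "f \<in> F" "t = f x" by blast
        then obtain h where "h \<in> F" "h (x \<otimes> y) \<le> f x * g y" using mult g xy by blast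
        then show "(INF f\<in>F. f (x \<otimes> y)) \<le> g y * t"
          using lower[of h "x \<otimes> y"] f by (simp add: mult.commute)
      qed (use ne bd[OF g] in auto)
      then show ?thesis by (simp add: mult.commute)
    qed
    then show "(INF f\<in>F. f (x \<otimes> y)) \<le> (INF f\<in>F. f x) * (INF f\<in>F. f y)"
      using ne nonneg by (intro le_mult_Inf) auto
  next
    fix r \<tau> assume \<tau>: "\<tau> \<in> initial_forms r"
    obtain f where "f \<in> F" "f \<tau> \<le> (1/2) ^ r" using le[OF \<tau>] by blast
    then have "(INF f\<in>F. f \<tau>) \<le> (1/2) ^ r" using lower[of f \<tau>] by simp
    moreover have "(1/2) ^ r \<le> (INF f\<in>F. f \<tau>)" using ne ge[OF _ \<tau>] by (intro cINF_greatest) auto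
    ultimately show "(INF f\<in>F. f \<tau>) = (1/2) ^ r" by simp
  qed
qed

text \<open>The norm is the infimum of \<open>N (s \<otimes> x) / w\<close> over \<open>S\<close>,
  as if each \<open>s\<close> were inverted with norm \<open>w\<close>. The last hypothesis prevents
  the values on initial forms from dropping. For minimal \<open>N\<close> the conclusion becomes
  \<open>w * N x \<le> N (s \<otimes> x)\<close>.\<close>

lemma form_norm_localize:
  assumes N: "form_norm N"
    and one: "(\<one>, 1) \<in> S"
    and S: "\<And>s w. (s, w) \<in> S \<Longrightarrow> s \<in> carrier R \<and> 0 < w \<and> N s \<le> w"
    and mult: "\<And>s w s' w'. (s, w) \<in> S \<Longrightarrow> (s', w') \<in> S \<Longrightarrow> (s \<otimes> s', w * w') \<in> S"
    and form: "\<And>s w r \<tau>. (s, w) \<in> S \<Longrightarrow> \<tau> \<in> initial_forms r \<Longrightarrow> w * (1/2) ^ r \<le> N (s \<otimes> \<tau>)"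
  shows "\<exists>N'. form_norm N' \<and> N' \<le> N \<and> (\<forall>x\<in>carrier R. \<forall>(s, w)\<in>S. w * N' x \<le> N (s \<otimes> x))"
proof -
  define f where "f = (\<lambda>(s, w) x. if x \<in> carrier R then N (s \<otimes> x) / w else 0)"
  \<comment> \<open>A larger denominator only lowers the quotient, because
    \<open>N s' \<le> w'\<close>. So the family is directed downwards, and the pair
    \<open>(s \<otimes> s', w * w')\<close> serves as third member.\<close>
  have f_le: "f (s \<otimes> s', w * w') x \<le> f (s, w) x" if sw: "(s, w) \<in> S" "(s', w') \<in> S" "x \<in> carrier R" for s w s' w' x
  proof -
    have "s \<otimes> s' \<otimes> x = s' \<otimes> (s \<otimes> x)" using S[OF sw(1)] S[OF sw(2)] sw(3) by (simp add: m_ac)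
    then have "N (s \<otimes> s' \<otimes> x) \<le> N s' * N (s \<otimes> x)"
      using form_normD(6)[OF N, of s' "s \<otimes> x"] S[OF sw(1)] S[OF sw(2)] sw(3) by simp
    also have "\<dots> \<le> w' * N (s \<otimes> x)"
      using S[OF sw(2)] form_normD(2)[OF N] by (intro mult_right_mono) auto
    finally show ?thesis
      using S[OF sw(1)] S[OF sw(2)] sw(3) by (simp add: f_def field_simps)
  qed
  have f_le': "f (s \<otimes> s', w * w') x \<le> f (s', w') x" if sw: "(s, w) \<in> S" "(s', w') \<in> S" "x \<in> carrier R" for s w s' w' x
    using f_le[OF sw(2,1,3)] S[OF sw(1)] S[OF sw(2)] by (simp add: m_comm mult.commute)
  have f1: "f (\<one>, 1) x = N x" for x using form_normD(1)[OF N] by (simp add: f_def)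
  have INF: "form_norm (\<lambda>x. INF h\<in>f ` S. h x) \<and> (\<forall>h\<in>f ` S. \<forall>x. (INF h\<in>f ` S. h x) \<le> h x)"
  proof (rule form_norm_INF[of "f ` S"], goal_cases)
    case 1 show ?case using one by blast
  next
    case (2 h x) then show ?case by (auto simp: f_def)
  next
    case (3 h x)
    then obtain s w where sw: "(s, w) \<in> S" "h = f (s, w)" by auto
    have "N (s \<otimes> x) \<le> w" if "x \<in> carrier R"
    proof -
      have "N (s \<otimes> x) \<le> N s * N x" using form_normD(6)[OF N] S[OF sw(1)] that by simp
      also have "\<dots> \<le> w * 1" using S[OF sw(1)] form_normD(2,3)[OF N] by (intro mult_mono) auto
      finally show ?thesis by simp
    qed
    then show ?case using S[OF sw(1)] form_normD(2)[OF N] sw(2) by (auto simp: f_def field_simps)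
  next
    case (4 h)
    then obtain s w where sw: "(s, w) \<in> S" "h = f (s, w)" by auto
    then show ?case using S[OF sw(1)] form_normD(4)[OF N] by (simp add: f_def)
  next
    case (5 h g)
    then obtain s w s' w' where sw: "(s, w) \<in> S" "h = f (s, w)" "(s', w') \<in> S" "g = f (s', w')" by auto
    show ?case
    proof (intro bexI[of _ "f (s \<otimes> s', w * w')"] ballI)
      fix x y assume xy: "x \<in> carrier R" "y \<in> carrier R"
      have c: "s \<in> carrier R" "s' \<in> carrier R" "0 < w * w'" using S[OF sw(1)] S[OF sw(3)] by auto
      have "N (s \<otimes> s' \<otimes> (x \<oplus> y)) \<le> max (N (s \<otimes> s' \<otimes> x)) (N (s \<otimes> s' \<otimes> y))"
        using form_normD(5)[OF N, of "s \<otimes> s' \<otimes> x" "s \<otimes> s' \<otimes> y"] c xy by (simp add: r_distr)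
      then have "f (s \<otimes> s', w * w') (x \<oplus> y) \<le> max (f (s \<otimes> s', w * w') x) (f (s \<otimes> s', w * w') y)"
        using c xy by (auto simp: f_def le_max_iff_disj divide_right_mono)
      then show "f (s \<otimes> s', w * w') (x \<oplus> y) \<le> max (h x) (g y)"
        using f_le[OF sw(1,3) xy(1)] f_le'[OF sw(1,3) xy(2)] sw(2,4) by auto
    qed (use mult sw in auto)
  next
    case (6 h g)
    then obtain s w s' w' where sw: "(s, w) \<in> S" "h = f (s, w)" "(s', w') \<in> S" "g = f (s', w')" by auto
    show ?case
    proof (intro bexI[of _ "f (s \<otimes> s', w * w')"] ballI)
      fix x y assume xy: "x \<in> carrier R" "y \<in> carrier R"
      have c: "s \<in> carrier R" "s' \<in> carrier R" "0 < w" "0 < w'" using S[OF sw(1)] S[OF sw(3)] by auto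
      have "s \<otimes> s' \<otimes> (x \<otimes> y) = (s \<otimes> x) \<otimes> (s' \<otimes> y)" using c xy by (simp add: m_ac)
      then have "N (s \<otimes> s' \<otimes> (x \<otimes> y)) \<le> N (s \<otimes> x) * N (s' \<otimes> y)"
        using form_normD(6)[OF N, of "s \<otimes> x" "s' \<otimes> y"] c xy by simp
      then show "f (s \<otimes> s', w * w') (x \<otimes> y) \<le> h x * g y"
        using c xy sw by (simp add: f_def divide_right_mono)
    qed (use mult sw in auto)
  next
    case (7 h r \<tau>)
    then obtain s w where sw: "(s, w) \<in> S" "h = f (s, w)" by auto
    then show ?case using form[OF sw(1) 7(2)] S[OF sw(1)] initial_forms_carrier[OF 7(2)]
      by (simp add: f_def field_simps)
  next
    case (8 r \<tau>)
    then show ?case using f1 form_normD(7)[OF N 8] one by (intro bexI[of _ "f (\<one>, 1)"]) auto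
  qed
  define N' where "N' x = (INF h\<in>f ` S. h x)" for x
  have N': "form_norm N'" and lower: "\<And>s w x. (s, w) \<in> S \<Longrightarrow> N' x \<le> f (s, w) x"
    using INF unfolding N'_def by auto
  have "N' x \<le> N x" for x using lower[OF one, of x] f1 by simp
  moreover have "w * N' x \<le> N (s \<otimes> x)" if "(s, w) \<in> S" "x \<in> carrier R" for s w x
    using lower[OF that(1), of x] S[OF that(1)] that(2) by (simp add: f_def field_simps)
  ultimately show ?thesis using N' by (intro exI[of _ N']) (auto simp: le_fun_def)
qed

text \<open>The \<open>Q\<close>-adic norm. It is exact on initial forms because
  \<open>Q^(r+1)\<close> lies in \<open>fibre r\<close>; the infimum assigns 0 to elements of all
  powers of \<open>Q\<close>.\<close>

lemma ex_form_norm: "\<exists>N. form_norm N"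
proof -
  define V where "V x = {(1/2) ^ r :: real | r. x \<in> ideal_pow R Q r}" for x
  define N where "N x = (if x \<in> carrier R then Inf (V x) else 0)" for x
  have ne: "V x \<noteq> {}" if "x \<in> carrier R" for x using that by (auto simp: V_def intro!: exI[of _ 0])
  have bdd: "bdd_below (V x)" for x by (rule bdd_belowI[of _ 0]) (auto simp: V_def)
  have le: "Inf (V x) \<le> (1/2) ^ r" if "x \<in> ideal_pow R Q r" for x r
    using bdd that by (intro cInf_lower) (auto simp: V_def)
  have nonneg: "0 \<le> Inf (V x)" if "x \<in> carrier R" for x
    using ne[OF that] by (intro cInf_greatest) (auto simp: V_def)
  have half_le: "(1/2 :: real) ^ r \<le> (1/2) ^ s" if "s \<le> r" for r s using that by (intro power_decreasing) auto
  have "form_norm N"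
    unfolding form_norm_def
  proof (intro conjI allI impI ballI)
    show "N x = 0" if "x \<notin> carrier R" for x using that by (simp add: N_def)
    show "0 \<le> N x" for x using nonneg by (simp add: N_def)
    show "N x \<le> 1" for x using le[of x 0] by (simp add: N_def)
    have "N \<zero> \<le> e" if e: "e > 0" for e
    proof -
      obtain r where "(1/2 :: real) ^ r < e" using real_arch_pow_inv[OF e, of "1/2"] by auto
      then show ?thesis using le[of \<zero> r] ideal_zero_closed[OF Q_pow_ideal] by (simp add: N_def)
    qed
    then have "N \<zero> \<le> 0" by (intro field_le_epsilon[of _ 0]) simp
    moreover have "0 \<le> N \<zero>" using nonneg[of \<zero>] by (simp add: N_def)
    ultimately show "N \<zero> = 0" by simp
  next
    fix x y assume xy: "x \<in> carrier R" "y \<in> carrier R"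
    show "N (x \<oplus> y) \<le> max (N x) (N y)"
    proof (rule ccontr)
      assume "\<not> ?thesis"
      then have "Inf (V x) < N (x \<oplus> y)" "Inf (V y) < N (x \<oplus> y)" using xy by (auto simp: N_def)
      then obtain u v where "u \<in> V x" "u < N (x \<oplus> y)" "v \<in> V y" "v < N (x \<oplus> y)"
        using cInf_lessD[OF ne[OF xy(1)], of "N (x \<oplus> y)"] cInf_lessD[OF ne[OF xy(2)], of "N (x \<oplus> y)"] by meson
      then obtain r s where rs: "x \<in> ideal_pow R Q r" "(1/2) ^ r < N (x \<oplus> y)"
          "y \<in> ideal_pow R Q s" "(1/2) ^ s < N (x \<oplus> y)"
        unfolding V_def by auto
      have "x \<oplus> y \<in> ideal_pow R Q (min r s)"
        using rs(1,3) ideal_pow_antimono[OF Q_ideal, of "min r s" r] ideal_pow_antimono[OF Q_ideal, of "min r s" s]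
        by (intro ideal_a_closed[OF Q_pow_ideal]) auto
      then have "N (x \<oplus> y) \<le> (1/2) ^ min r s" using le xy by (simp add: N_def)
      with rs(2,4) show False by (auto simp: min_def split: if_splits)
    qed
    have "N (x \<otimes> y) \<le> N x * t" if t: "t \<in> V y" for t
    proof -
      obtain s where s: "y \<in> ideal_pow R Q s" "t = (1/2) ^ s" using t by (auto simp: V_def)
      have "N (x \<otimes> y) \<le> t * Inf (V x)"
      proof (rule le_mult_Inf[OF ne[OF xy(1)]])
        fix u assume "u \<in> V x"
        then obtain r where r: "x \<in> ideal_pow R Q r" "u = (1/2) ^ r" by (auto simp: V_def)
        show "N (x \<otimes> y) \<le> t * u"
          using le[OF mult_mem_ideal_pow[OF Q_ideal r(1) s(1)]] xy r s
          by (simp add: N_def power_add mult.commute)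
      qed (simp add: s)
      then show ?thesis using xy by (simp add: N_def mult.commute)
    qed
    then have "N (x \<otimes> y) \<le> N x * Inf (V y)"
      using ne[OF xy(2)] nonneg[OF xy(1)] xy by (intro le_mult_Inf) (auto simp: N_def)
    then show "N (x \<otimes> y) \<le> N x * N y" using xy by (simp add: N_def)
  next
    fix r \<tau> assume \<tau>: "\<tau> \<in> initial_forms r"
    have c: "\<tau> \<in> carrier R" using initial_forms_carrier[OF \<tau>] .
    have "(1/2) ^ r \<le> Inf (V \<tau>)"
    proof (rule cInf_greatest[OF ne[OF c]])
      fix u assume "u \<in> V \<tau>"
      then obtain s where "\<tau> \<in> ideal_pow R Q s" "u = (1/2) ^ s" by (auto simp: V_def)
      then show "(1/2) ^ r \<le> u" using initial_forms_not_mem_pow[OF \<tau>] half_le by simp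
    qed
    moreover have "Inf (V \<tau>) \<le> (1/2) ^ r" using le \<tau> by (simp add: initial_forms_def)
    ultimately show "N \<tau> = (1/2) ^ r" using c by (simp add: N_def)
  qed
  then show ?thesis by blast
qed

section \<open>Minimal norms and their multiplicativity\<close>

definition minimal_norm :: "('a \<Rightarrow> real) \<Rightarrow> bool" where
  "minimal_norm N \<longleftrightarrow> form_norm N \<and> (\<forall>N'. form_norm N' \<and> N' \<le> N \<longrightarrow> N' = N)"

text \<open>Zorn's lemma for the reversed pointwise order, with pointwise infima as bounds of
  chains.\<close>

lemma ex_minimal_norm: "\<exists>N. minimal_norm N"
proof -
  let ?A = "{N. form_norm N}" and ?P = "\<lambda>N M :: 'a \<Rightarrow> real. M \<le> N"
  have "\<exists>N\<in>?A. \<forall>M\<in>?A. ?P N M \<longrightarrow> M = N"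
  proof (rule predicate_Zorn)
    show "partial_order_on ?A (relation_of ?P ?A)"
      by (rule partial_order_on_relation_ofI) auto
    fix C assume C: "C \<in> Chains (relation_of ?P ?A)"
    then have CA: "form_norm N" if "N \<in> C" for N using that by (auto simp: Chains_def relation_of_def)
    have chain: "N \<le> M \<or> M \<le> N" if "N \<in> C" "M \<in> C" for N M
      using C that by (auto simp: Chains_def relation_of_def)
    show "\<exists>u\<in>?A. \<forall>N\<in>C. u \<le> N"
    proof (cases "C = {}")
      case True
      then show ?thesis using ex_form_norm by auto
    next
      case False
      have min: "\<exists>h\<in>C. h \<le> f \<and> h \<le> g" if "f \<in> C" "g \<in> C" for f g
        using chain[OF that] that by blast
      have "form_norm (\<lambda>x. INF f\<in>C. f x) \<and> (\<forall>f\<in>C. \<forall>x. (INF f\<in>C. f x) \<le> f x)"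
      proof (rule form_norm_INF[OF False])
        fix f g assume fg: "f \<in> C" "g \<in> C"
        then obtain h where h: "h \<in> C" "\<And>x. h x \<le> f x" "\<And>x. h x \<le> g x"
          using min by (meson le_funD)
        have "h (x \<oplus> y) \<le> max (f x) (g y)" if "x \<in> carrier R" "y \<in> carrier R" for x y
          using form_normD(5)[OF CA[OF h(1)] that] h(2)[of x] h(3)[of y] by auto
        then show "\<exists>h\<in>C. \<forall>x\<in>carrier R. \<forall>y\<in>carrier R. h (x \<oplus> y) \<le> max (f x) (g y)"
          using h(1) by blast
        have "h (x \<otimes> y) \<le> f x * g y" if "x \<in> carrier R" "y \<in> carrier R" for x y
        proof -
          have "h (x \<otimes> y) \<le> h x * h y" using form_normD(6)[OF CA[OF h(1)] that] .
          also have "\<dots> \<le> f x * g y"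
            using h form_normD(2)[OF CA[OF h(1)]] form_normD(2)[OF CA[OF fg(1)]] by (intro mult_mono) auto
          finally show ?thesis .
        qed
        then show "\<exists>h\<in>C. \<forall>x\<in>carrier R. \<forall>y\<in>carrier R. h (x \<otimes> y) \<le> f x * g y"
          using h(1) by blast
      next
        fix r \<tau> assume "\<tau> \<in> initial_forms r"
        then show "\<exists>f\<in>C. f \<tau> \<le> (1/2) ^ r" using False CA form_normD(7) by fastforce
      next
        fix f r \<tau> assume "f \<in> C" "\<tau> \<in> initial_forms r"
        then show "(1/2) ^ r \<le> f \<tau>" using form_normD(7)[OF CA] by simp
      next
        fix f x assume f: "f \<in> C"
        show "f x = 0" if "x \<notin> carrier R" using form_normD(1)[OF CA[OF f] that] .
        show "0 \<le> f x \<and> f x \<le> 1" "f \<zero> = 0" using form_normD(2-4)[OF CA[OF f]] by simp_all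
      qed
      then show ?thesis by (intro bexI[of _ "\<lambda>x. INF f\<in>C. f x"]) (auto simp: le_fun_def)
    qed
  qed
  then show ?thesis unfolding minimal_norm_def by blast
qed

lemma initial_forms_pow: "\<tau> \<in> initial_forms r \<Longrightarrow> \<tau> [^] (j::nat) \<in> initial_forms (r * j)"
proof (induction j)
  case 0
  then show ?case using m_proper by (simp add: initial_forms_0)
next
  case (Suc j)
  then show ?case using initial_forms_mult[of "\<tau> [^] j" "r * j" \<tau> r] by (simp add: add.commute)
qed

text \<open>The spectral radius of \<open>N\<close>, as the infimum of all exponential growth rates
  of \<open>N (x [^] j)\<close>; rates avoid limits of roots. Initial forms keep their value because
  their powers are initial forms again.\<close>

lemma spectral_norm:
  assumes N: "form_norm N"
  defines "S \<equiv> \<lambda>x. {t::real. 0 < t \<and> (\<exists>C. \<forall>j::nat. N (x [^] j) \<le> C * t ^ j)}"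
  shows "\<exists>N'. form_norm N' \<and> N' \<le> N \<and> (\<forall>x\<in>carrier R. \<forall>t\<in>S x. N' x \<le> t)"
proof -
  note NN = form_normD[OF N]
  have memI: "t \<in> S x" if "0 < t" "\<And>j::nat. N (x [^] j) \<le> C * t ^ j" for t x C
    using that unfolding S_def by blast
  have memE: "\<exists>C\<ge>0. \<forall>j::nat. N (x [^] j) \<le> C * t ^ j" if t: "t \<in> S x" for t x
  proof -
    obtain C where C: "\<And>j::nat. N (x [^] j) \<le> C * t ^ j" using t by (auto simp: S_def)
    have "1 \<le> C" using C[of 0] form_norm_one[OF N] by simp
    then show ?thesis using C by (intro exI[of _ C]) auto
  qed
  have up: "u \<in> S x" if t: "t \<in> S x" and "t \<le> u" for t u x
  proof -
    obtain C where C: "C \<ge> 0" "\<And>j::nat. N (x [^] j) \<le> C * t ^ j" using memE[OF t] by blast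
    have "N (x [^] j) \<le> C * u ^ j" for j
      using C(2)[of j] mult_left_mono[OF power_mono[OF that(2), of j] C(1)] t by (force simp: S_def)
    then show ?thesis using t that(2) by (intro memI[of u x C]) (auto simp: S_def)
  qed
  have above: "t \<in> S x" if "x \<in> carrier R" "N x < t" for x t
  proof (rule memI[of t x 1])
    show "0 < t" using NN(2)[of x] that(2) by linarith
    show "N (x [^] j) \<le> 1 * t ^ j" for j :: nat
      using form_norm_pow_le[OF N that(1), of j] power_mono[of "N x" t j] NN(2)[of x] that(2) by simp
  qed
  have ne: "S x \<noteq> {}" if "x \<in> carrier R" for x using above[OF that, of "N x + 1"] by auto
  have bdd: "bdd_below (S x)" for x by (rule bdd_belowI[of _ 0]) (auto simp: S_def)
  define N' where "N' x = (if x \<in> carrier R then Inf (S x) else 0)" for x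
  have low: "N' x \<le> t" if "t \<in> S x" "x \<in> carrier R" for x t
    using bdd that by (simp add: N'_def cInf_lower)
  have mem: "t \<in> S x" if "x \<in> carrier R" "N' x < t" for x t
    using cInf_lessD[OF ne[OF that(1)], of t] that up by (auto simp: N'_def)
  have le: "N' x \<le> N x" for x
  proof (cases "x \<in> carrier R")
    case True
    show ?thesis
    proof (rule field_le_epsilon)
      fix e :: real assume "0 < e"
      then show "N' x \<le> N x + e" using low[OF above[OF True, of "N x + e"] True] by simp
    qed
  qed (simp add: N'_def NN)
  have nonneg: "0 \<le> N' x" for x
    using ne by (auto simp: N'_def S_def intro!: cInf_greatest)
  have "form_norm N'"
    unfolding form_norm_def
  proof (intro conjI allI impI ballI)
    show "N' x = 0" if "x \<notin> carrier R" for x using that by (simp add: N'_def)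
    show "0 \<le> N' x" for x by (rule nonneg)
    show "N' x \<le> 1" for x using le[of x] NN(3)[of x] by simp
    show "N' \<zero> = 0" using le[of \<zero>] nonneg[of \<zero>] NN(4) by simp
  next
    fix x y assume xy: "x \<in> carrier R" "y \<in> carrier R"
    show "N' (x \<oplus> y) \<le> max (N' x) (N' y)"
    proof (rule field_le_epsilon)
      fix e :: real assume e: "0 < e"
      define t where "t = max (N' x) (N' y) + e"
      have lt: "N' x < t" "N' y < t" using e by (auto simp: t_def)
      obtain C where C: "C \<ge> 0" "\<And>j::nat. N (x [^] j) \<le> C * t ^ j"
        using memE[OF mem[OF xy(1) lt(1)]] by blast
      obtain D where D: "D \<ge> 0" "\<And>j::nat. N (y [^] j) \<le> D * t ^ j"
        using memE[OF mem[OF xy(2) lt(2)]] by blast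
      have t0: "0 < t" using e nonneg[of x] by (auto simp: t_def)
      \<comment> \<open>Ultrametric binomial estimate: one factor of
        \<open>(x \<oplus> y) [^] j\<close> is expanded at a time, so no binomial coefficients
        appear.\<close>
      have "N (x [^] i \<otimes> y [^] l \<otimes> (x \<oplus> y) [^] j) \<le> C * D * t ^ (i + l + j)" for i l j :: nat
      proof (induction j arbitrary: i l)
        case 0
        have "N (x [^] i \<otimes> y [^] l) \<le> N (x [^] i) * N (y [^] l)" using NN(6) xy by simp
        also have "\<dots> \<le> (C * t ^ i) * (D * t ^ l)" using C D NN(2) t0 by (intro mult_mono) auto
        finally show ?case using xy by (simp add: power_add mult_ac)
      next
        case (Suc j)
        define z where "z = (x \<oplus> y) [^] j"
        define a where "a = x [^] i"
        define b where "b = y [^] l"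
        have c: "z \<in> carrier R" "a \<in> carrier R" "b \<in> carrier R" using xy by (auto simp: z_def a_def b_def)
        have "a \<otimes> b \<otimes> (z \<otimes> (x \<oplus> y)) = (a \<otimes> x) \<otimes> b \<otimes> z \<oplus> a \<otimes> (b \<otimes> y) \<otimes> z"
          using c xy by algebra
        then have "N (a \<otimes> b \<otimes> (z \<otimes> (x \<oplus> y))) \<le> max (N ((a \<otimes> x) \<otimes> b \<otimes> z)) (N (a \<otimes> (b \<otimes> y) \<otimes> z))"
          using NN(5)[of "(a \<otimes> x) \<otimes> b \<otimes> z" "a \<otimes> (b \<otimes> y) \<otimes> z"] c xy by simp
        moreover have "N ((a \<otimes> x) \<otimes> b \<otimes> z) \<le> C * D * t ^ (i + l + Suc j)"
          using Suc[of "Suc i" l] by (simp add: a_def b_def z_def)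
        moreover have "N (a \<otimes> (b \<otimes> y) \<otimes> z) \<le> C * D * t ^ (i + l + Suc j)"
          using Suc[of i "Suc l"] by (simp add: a_def b_def z_def)
        ultimately show ?case by (simp add: a_def b_def z_def)
      qed
      from this[of 0 0] have "t \<in> S (x \<oplus> y)" using xy t0 by (intro memI[of t _ "C * D"]) auto
      then show "N' (x \<oplus> y) \<le> max (N' x) (N' y) + e" using low xy by (simp add: t_def)
    qed
    show "N' (x \<otimes> y) \<le> N' x * N' y"
    proof (rule le_mult_of_less[OF nonneg nonneg])
      fix t u assume tu: "N' x < t" "N' y < u"
      obtain C where C: "C \<ge> 0" "\<And>j::nat. N (x [^] j) \<le> C * t ^ j" using memE[OF mem[OF xy(1) tu(1)]] by blast
      obtain D where D: "D \<ge> 0" "\<And>j::nat. N (y [^] j) \<le> D * u ^ j" using memE[OF mem[OF xy(2) tu(2)]] by blast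
      have tu0: "0 < t" "0 < u" using tu nonneg[of x] nonneg[of y] by linarith+
      have "N ((x \<otimes> y) [^] j) \<le> C * D * (t * u) ^ j" for j
      proof -
        have "N ((x \<otimes> y) [^] j) \<le> N (x [^] j) * N (y [^] j)" using NN(6) xy by (simp add: nat_pow_distrib)
        also have "\<dots> \<le> (C * t ^ j) * (D * u ^ j)" using C D NN(2) tu0 by (intro mult_mono) auto
        finally show ?thesis by (simp add: power_mult_distrib mult_ac)
      qed
      then have "t * u \<in> S (x \<otimes> y)" using tu0 by (intro memI[of _ _ "C * D"]) auto
      then show "N' (x \<otimes> y) \<le> t * u" using low xy by simp
    qed
  next
    fix r \<tau> assume \<tau>: "\<tau> \<in> initial_forms r"
    have c: "\<tau> \<in> carrier R" using initial_forms_carrier[OF \<tau>] .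
    have "(1/2) ^ r \<le> Inf (S \<tau>)"
    proof (rule cInf_greatest[OF ne[OF c]])
      fix t assume t: "t \<in> S \<tau>"
      then have t0: "0 < t" by (simp add: S_def)
      obtain C where C: "\<And>j::nat. N (\<tau> [^] j) \<le> C * t ^ j" using memE[OF t] by blast
      have C': "((1/2) ^ r) ^ j \<le> C * t ^ j" for j :: nat
        using C[of j] NN(7)[OF initial_forms_pow[OF \<tau>, of j]] by (simp add: power_mult)
      show "(1/2) ^ r \<le> t"
      proof (rule ccontr)
        assume "\<not> ?thesis"
        then have "1 < (1/2) ^ r / t" using t0 by simp
        then obtain j where "C < ((1/2) ^ r / t) ^ j" using real_arch_pow by blast
        then have "C * t ^ j < ((1/2) ^ r) ^ j" using t0 by (simp add: power_divide field_simps)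
        with C'[of j] show False by simp
      qed
    qed
    then show "N' \<tau> = (1/2) ^ r" using le[of \<tau>] NN(7)[OF \<tau>] c by (simp add: N'_def)
  qed
  then show ?thesis using le low by (intro exI[of _ N']) (auto simp: le_fun_def)
qed

text \<open>A minimal norm equals its spectral norm, and one power with
  \<open>N (x [^] j) < N x ^ j\<close> would push the growth rate of all powers below
  \<open>N x\<close>.\<close>

lemma minimal_norm_pow:
  assumes min: "minimal_norm N" and x: "x \<in> carrier R"
  shows "N (x [^] (j::nat)) = N x ^ j"
proof (rule antisym)
  have N: "form_norm N" using min by (simp add: minimal_norm_def)
  note NN = form_normD[OF N]
  show "N (x [^] j) \<le> N x ^ j" by (rule form_norm_pow_le[OF N x])
  show "N x ^ j \<le> N (x [^] j)"
  proof (rule ccontr)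
    assume "\<not> ?thesis"
    then have lt: "N (x [^] j) < N x ^ j" by simp
    then have j: "j > 0" using form_norm_one[OF N] by (cases j) auto
    \<comment> \<open>A value strictly above \<open>N (x [^] j)\<close> keeps \<open>v\<close>
      positive even if that norm vanishes; its \<open>j\<close>-th root \<open>t\<close> is still
      below \<open>N x\<close>.\<close>
    define v where "v = (N (x [^] j) + N x ^ j) / 2"
    have v: "N (x [^] j) < v" "v < N x ^ j" "0 < v" using lt NN(2)[of "x [^] j"] by (auto simp: v_def)
    define t where "t = root j v"
    have t: "0 < t" "t ^ j = v" using j v by (auto simp: t_def)
    have tN: "t < N x" using power_less_imp_less_base[of t j "N x"] t v NN(2)[of x] by simp
    then have t1: "t \<le> 1" using NN(3)[of x] by simp
    \<comment> \<open>Division of \<open>i\<close> by \<open>j\<close> with remainder: the remainder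
      costs at most the constant \<open>1 / v\<close>, since
      \<open>v = t ^ j \<le> t ^ (i mod j)\<close>.\<close>
    have "N (x [^] i) \<le> 1 / v * t ^ i" for i :: nat
    proof -
      have "x [^] i = (x [^] j) [^] (i div j) \<otimes> x [^] (i mod j)"
        using x by (simp add: nat_pow_pow nat_pow_mult)
      then have "N (x [^] i) \<le> N ((x [^] j) [^] (i div j)) * N (x [^] (i mod j))"
        using NN(6) x by simp
      also have "\<dots> \<le> N (x [^] j) ^ (i div j) * 1"
        using form_norm_pow_le[OF N, of "x [^] j" "i div j"] x NN(2,3) by (intro mult_mono) auto
      also have "\<dots> \<le> v ^ (i div j)" using v NN(2) by (simp add: power_mono)
      also have "\<dots> = t ^ (j * (i div j))" using t(2) by (simp add: power_mult)
      finally have "N (x [^] i) * t ^ (i mod j) \<le> t ^ (j * (i div j)) * t ^ (i mod j)"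
        using t by (intro mult_right_mono) auto
      also have "\<dots> = t ^ i" by (simp flip: power_add)
      finally have "N (x [^] i) * t ^ (i mod j) \<le> t ^ i" .
      moreover have "v \<le> t ^ (i mod j)"
        unfolding t(2)[symmetric] using t t1 j by (intro power_decreasing) auto
      then have "N (x [^] i) * v \<le> N (x [^] i) * t ^ (i mod j)" using NN(2) by (intro mult_left_mono) auto
      ultimately show ?thesis using v by (simp add: field_simps)
    qed
    moreover obtain N' where N': "form_norm N'" "N' \<le> N"
        "\<And>t. 0 < t \<and> (\<exists>C. \<forall>i::nat. N (x [^] i) \<le> C * t ^ i) \<Longrightarrow> N' x \<le> t"
      using spectral_norm[OF N] x by blast
    ultimately have "N' x \<le> t" using t(1) by blast
    moreover have "N' = N" using min N' by (simp add: minimal_norm_def)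
    ultimately show False using tN by simp
  qed
qed

text \<open>Localization at the multiplicative set of all initial forms, weighted by their
  norms.\<close>

lemma minimal_norm_form:
  assumes min: "minimal_norm N" and x: "x \<in> carrier R" and \<tau>: "\<tau> \<in> initial_forms r"
  shows "N (\<tau> \<otimes> x) = (1/2) ^ r * N x"
proof (rule antisym)
  have N: "form_norm N" using min by (simp add: minimal_norm_def)
  note NN = form_normD[OF N]
  show "N (\<tau> \<otimes> x) \<le> (1/2) ^ r * N x"
    using NN(6)[OF initial_forms_carrier[OF \<tau>] x] NN(7)[OF \<tau>] by simp
  let ?S = "{(\<tau>, (1/2) ^ r :: real) | \<tau> r. \<tau> \<in> initial_forms r}"
  have "\<exists>N'. form_norm N' \<and> N' \<le> N \<and> (\<forall>x\<in>carrier R. \<forall>(s, w)\<in>?S. w * N' x \<le> N (s \<otimes> x))"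
  proof (rule form_norm_localize[OF N])
    have "\<one> \<in> initial_forms 0" using m_proper by (simp add: initial_forms_0)
    moreover have "1 = (1/2 :: real) ^ 0" by simp
    ultimately show "(\<one>, 1) \<in> ?S" by blast
    show "s \<in> carrier R \<and> 0 < w \<and> N s \<le> w" if "(s, w) \<in> ?S" for s w
      using that initial_forms_carrier NN(7) by auto
    show "(s \<otimes> s', w * w') \<in> ?S" if "(s, w) \<in> ?S" "(s', w') \<in> ?S" for s w s' w'
    proof -
      from that obtain p q where "s \<in> initial_forms p" "w = (1/2) ^ p" "s' \<in> initial_forms q" "w' = (1/2) ^ q"
        by auto
      then have "s \<otimes> s' \<in> initial_forms (p + q)" "w * w' = (1/2) ^ (p + q)"
        by (auto simp: initial_forms_mult power_add)
      then show ?thesis by blast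
    qed
    show "w * (1/2) ^ q \<le> N (s \<otimes> \<upsilon>)" if "(s, w) \<in> ?S" "\<upsilon> \<in> initial_forms q" for s w q \<upsilon>
    proof -
      from that(1) obtain p where "s \<in> initial_forms p" "w = (1/2) ^ p" by auto
      then show ?thesis using NN(7)[OF initial_forms_mult[OF _ that(2)], of s p] by (simp add: power_add)
    qed
  qed
  then obtain N' where N': "form_norm N'" "N' \<le> N" "\<forall>x\<in>carrier R. \<forall>(s, w)\<in>?S. w * N' x \<le> N (s \<otimes> x)" by blast
  then have "N' = N" using min by (simp add: minimal_norm_def)
  moreover have "(\<tau>, (1/2) ^ r) \<in> ?S" using \<tau> by blast
  ultimately show "(1/2) ^ r * N x \<le> N (\<tau> \<otimes> x)" using N'(3) x by fast
qed

text \<open>Localization at the powers of \<open>x\<close> with weights \<open>N x ^ j\<close>. That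
  the values on initial forms survive is exactly what the two preceding facts, on powers and on
  products with forms, provide.\<close>

lemma minimal_norm_mult:
  assumes min: "minimal_norm N" and x: "x \<in> carrier R" and y: "y \<in> carrier R"
  shows "N (x \<otimes> y) = N x * N y"
proof (rule antisym)
  have N: "form_norm N" using min by (simp add: minimal_norm_def)
  note NN = form_normD[OF N]
  show "N (x \<otimes> y) \<le> N x * N y" using NN(6) x y by blast
  show "N x * N y \<le> N (x \<otimes> y)"
  proof (cases "N x = 0")
    case True
    then show ?thesis using NN(2) by simp
  next
    case False
    then have x0: "0 < N x" using NN(2)[of x] by simp
    let ?S = "{(x [^] j, N x ^ j) | j :: nat. True}"
    have "\<exists>N'. form_norm N' \<and> N' \<le> N \<and> (\<forall>y\<in>carrier R. \<forall>(s, w)\<in>?S. w * N' y \<le> N (s \<otimes> y))"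
    proof (rule form_norm_localize[OF N])
      show "(\<one>, 1) \<in> ?S" by (auto intro!: exI[of _ 0])
      show "s \<in> carrier R \<and> 0 < w \<and> N s \<le> w" if "(s, w) \<in> ?S" for s w
        using that x x0 form_norm_pow_le[OF N x] by auto
      show "(s \<otimes> s', w * w') \<in> ?S" if "(s, w) \<in> ?S" "(s', w') \<in> ?S" for s w s' w'
      proof -
        from that obtain i j :: nat where "s = x [^] i" "w = N x ^ i" "s' = x [^] j" "w' = N x ^ j" by auto
        then have "s \<otimes> s' = x [^] (i + j)" "w * w' = N x ^ (i + j)"
          using x by (auto simp: nat_pow_mult power_add)
        then show ?thesis by blast
      qed
      show "w * (1/2) ^ r \<le> N (s \<otimes> \<tau>)" if "(s, w) \<in> ?S" "\<tau> \<in> initial_forms r" for s w r \<tau>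
      proof -
        from that(1) obtain j :: nat where j: "s = x [^] j" "w = N x ^ j" by auto
        have "N (s \<otimes> \<tau>) = (1/2) ^ r * N (x [^] j)"
          using minimal_norm_form[OF min _ that(2), of s] j x initial_forms_carrier[OF that(2)] by (simp add: m_comm)
        then show ?thesis using minimal_norm_pow[OF min x] j by simp
      qed
    qed
    then obtain N' where N': "form_norm N'" "N' \<le> N" "\<forall>y\<in>carrier R. \<forall>(s, w)\<in>?S. w * N' y \<le> N (s \<otimes> y)" by blast
    then have "N' = N" using min by (simp add: minimal_norm_def)
    moreover have "(x [^] (1::nat), N x ^ 1) \<in> ?S" by blast
    ultimately have "N x ^ 1 * N y \<le> N (x [^] (1::nat) \<otimes> y)" using N'(3) y by fast
    then show ?thesis using x by simp
  qed
qed

end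

section \<open>Quotient modules\<close>

context cring
begin

lemma quotient_coset_eq_iff:
  assumes I: "ideal I R" and x: "x \<in> carrier R" "y \<in> carrier R"
  shows "I +> x = I +> y \<longleftrightarrow> x \<ominus> y \<in> I"
  using quotient_eq_iff_same_a_r_cos[OF assms] by simp

lemma carrier_quotient_module: "carrier (quotient_module R I) = {I +> x | x. x \<in> carrier R}"
  by (auto simp: quotient_module_def FactRing_def A_RCOSETS_def')

lemma submodule_image_cosets:
  assumes I: "ideal I R" and K: "ideal K R"
  shows "submodule {I +> x | x. x \<in> K} R (quotient_module R I)"
proof -
  let ?M = "quotient_module R I"
  interpret I: ideal I R by fact
  interpret M: module R ?M using quotient_module_is_module[OF I] .
  have smult: "r \<odot>\<^bsub>?M\<^esub> (I +> x) = I +> (r \<otimes> x)" if "r \<in> carrier R" "x \<in> carrier R" for r x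
    using that by (simp add: quotient_module_def FactRing_def I.rcoset_mult_add)
  have add: "(I +> x) \<oplus>\<^bsub>?M\<^esub> (I +> y) = I +> (x \<oplus> y)" if "x \<in> carrier R" "y \<in> carrier R" for x y
    using that by (simp add: quotient_module_def FactRing_def I.a_rcos_sum)
  have zero: "\<zero>\<^bsub>?M\<^esub> = I +> \<zero>"
    by (simp add: quotient_module_def FactRing_def a_coset_add_zero I.a_subset)
  have Kc: "x \<in> carrier R" if "x \<in> K" for x using ideal.Icarr[OF K that] .
  show ?thesis
  proof (rule M.submoduleI)
    show "{I +> x | x. x \<in> K} \<subseteq> carrier ?M" using Kc by (auto simp: carrier_quotient_module)
    show "\<zero>\<^bsub>?M\<^esub> \<in> {I +> x | x. x \<in> K}" using zero ideal_zero_closed[OF K] by blast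
    show smult': "r \<odot>\<^bsub>?M\<^esub> a \<in> {I +> x | x. x \<in> K}"
      if "r \<in> carrier R" "a \<in> {I +> x | x. x \<in> K}" for r a
    proof -
      from that(2) obtain x where x: "x \<in> K" "a = I +> x" by blast
      then show ?thesis using smult[OF that(1) Kc[OF x(1)]] ideal.I_l_closed[OF K x(1) that(1)] by auto
    qed
    fix a assume a: "a \<in> {I +> x | x. x \<in> K}"
    then have "a \<in> carrier ?M" using Kc by (auto simp: carrier_quotient_module)
    then have "\<ominus>\<^bsub>?M\<^esub> a = (\<ominus> \<one>) \<odot>\<^bsub>?M\<^esub> a" using M.smult_l_minus[of \<one> a] by simp
    then show "\<ominus>\<^bsub>?M\<^esub> a \<in> {I +> x | x. x \<in> K}" using smult'[of "\<ominus> \<one>" a] a by simp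
    fix b assume b: "b \<in> {I +> x | x. x \<in> K}"
    obtain x y where "x \<in> K" "a = I +> x" "y \<in> K" "b = I +> y" using a b by blast
    then show "a \<oplus>\<^bsub>?M\<^esub> b \<in> {I +> x | x. x \<in> K}"
      using add[of x y] Kc ideal_a_closed[OF K, of x y] by auto
  qed
qed

lemma ideal_coset_preimage:
  assumes I: "ideal I R" and N: "submodule N R (quotient_module R I)"
  shows "ideal {x \<in> carrier R. I +> x \<in> N} R" and "I \<subseteq> {x \<in> carrier R. I +> x \<in> N}"
proof -
  let ?M = "quotient_module R I"
  interpret I: ideal I R by fact
  interpret M: module R ?M using quotient_module_is_module[OF I] .
  have smult: "r \<odot>\<^bsub>?M\<^esub> (I +> x) = I +> (r \<otimes> x)" if "r \<in> carrier R" "x \<in> carrier R" for r x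
    using that by (simp add: quotient_module_def FactRing_def I.rcoset_mult_add)
  have add: "(I +> x) \<oplus>\<^bsub>?M\<^esub> (I +> y) = I +> (x \<oplus> y)" if "x \<in> carrier R" "y \<in> carrier R" for x y
    using that by (simp add: quotient_module_def FactRing_def I.a_rcos_sum)
  have zero: "\<zero>\<^bsub>?M\<^esub> = I +> \<zero>"
    by (simp add: quotient_module_def FactRing_def a_coset_add_zero I.a_subset)
  note E = M.submoduleE[OF N]
  have z: "\<zero>\<^bsub>?M\<^esub> \<in> N" using subgroup.one_closed[OF submodule.axioms(1)[OF N]] by simp
  show "ideal {x \<in> carrier R. I +> x \<in> N} R"
  proof (rule idealI_cring)
    show "\<zero> \<in> {x \<in> carrier R. I +> x \<in> N}" using z zero by simp
    show "x \<oplus> y \<in> {x \<in> carrier R. I +> x \<in> N}"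
      if "x \<in> {x \<in> carrier R. I +> x \<in> N}" "y \<in> {x \<in> carrier R. I +> x \<in> N}" for x y
      using that E(5)[of "I +> x" "I +> y"] add[of x y] by simp
    show "r \<otimes> x \<in> {x \<in> carrier R. I +> x \<in> N}"
      if "r \<in> carrier R" "x \<in> {x \<in> carrier R. I +> x \<in> N}" for r x
      using that submodule.smult_closed[OF N that(1), of "I +> x"] smult[of r x] by simp
  qed auto
  show "I \<subseteq> {x \<in> carrier R. I +> x \<in> N}"
  proof
    fix x assume x: "x \<in> I"
    then have "I +> x = I +> \<zero>" using quotient_coset_eq_iff[OF I, of x \<zero>] I.Icarr[OF x] by (simp add: minus_eq)
    then show "x \<in> {x \<in> carrier R. I +> x \<in> N}" using z zero I.Icarr[OF x] by simp
  qed
qed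

text \<open>Chains correspond under preimage and image along the coset map; strictness of the image
  chain uses that every member contains \<open>I\<close>.\<close>

lemma module_length_quotient:
  assumes I: "ideal I R"
  shows "module_length R (quotient_module R I) = ideal_length I (carrier R)"
proof (rule antisym)
  let ?M = "quotient_module R I"
  show "module_length R ?M \<le> ideal_length I (carrier R)"
    unfolding module_length_def
  proof (rule SUP_least)
    fix n assume "n \<in> {n. \<exists>N. (\<forall>i\<le>n. submodule (N i) R ?M) \<and> (\<forall>i<n. N i \<subset> N (Suc i))}"
    then obtain N where N: "\<And>i. i \<le> n \<Longrightarrow> submodule (N i) R ?M" "\<And>i. i < n \<Longrightarrow> N i \<subset> N (Suc i)" by blast
    let ?K = "\<lambda>i. {x \<in> carrier R. I +> x \<in> N i}"
    have "?K i \<subset> ?K (Suc i)" if i: "i < n" for i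
    proof -
      obtain c where c: "c \<in> N (Suc i)" "c \<notin> N i" using N(2)[OF i] by blast
      have "N (Suc i) \<subseteq> carrier ?M"
        using subgroup.subset[OF submodule.axioms(1)[OF N(1)[of "Suc i"]]] i by simp
      then obtain x where "x \<in> carrier R" "c = I +> x" using c(1) unfolding carrier_quotient_module by blast
      with c N(2)[OF i] show ?thesis by auto
    qed
    then have "ideal_chain I (carrier R) n ?K"
      using ideal_coset_preimage[OF I N(1)] unfolding ideal_chain_def by auto
    then show "enat n \<le> ideal_length I (carrier R)" by (rule ideal_length_chain)
  qed
  show "ideal_length I (carrier R) \<le> module_length R ?M"
  proof (rule ideal_length_least)
    fix n K assume K: "ideal_chain I (carrier R) n K"
    let ?N = "\<lambda>i. {I +> x | x. x \<in> K i}"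
    have Ki: "ideal (K i) R" "I \<subseteq> K i" if "i \<le> n" for i using K that by (auto simp: ideal_chain_def)
    have "?N i \<subset> ?N (Suc i)" if i: "i < n" for i
    proof -
      have sub: "K i \<subset> K (Suc i)" using K i by (auto simp: ideal_chain_def)
      then obtain x where x: "x \<in> K (Suc i)" "x \<notin> K i" by blast
      have xc: "x \<in> carrier R" using ideal.Icarr[OF Ki(1)[of "Suc i"] x(1)] i by simp
      have "I +> x \<notin> ?N i"
      proof
        assume "I +> x \<in> ?N i"
        then obtain y where y: "y \<in> K i" "I +> x = I +> y" by blast
        have yc: "y \<in> carrier R" using ideal.Icarr[OF Ki(1) y(1)] i by simp
        have "x \<ominus> y \<in> K i" using quotient_coset_eq_iff[OF I xc yc] y(2) Ki(2)[of i] i by auto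
        then have "(x \<ominus> y) \<oplus> y \<in> K i" using ideal_a_closed[OF Ki(1)] y(1) i by simp
        moreover have "(x \<ominus> y) \<oplus> y = x" using xc yc by algebra
        ultimately show False using x(2) by simp
      qed
      moreover have "I +> x \<in> ?N (Suc i)" using x(1) by blast
      ultimately show ?thesis using sub by blast
    qed
    moreover have "submodule (?N i) R ?M" if "i \<le> n" for i
      by (rule submodule_image_cosets[OF I Ki(1)[OF that]])
    ultimately have "(\<forall>i\<le>n. submodule (?N i) R ?M) \<and> (\<forall>i<n. ?N i \<subset> ?N (Suc i))" by blast
    then have "\<exists>N. (\<forall>i\<le>n. submodule (N i) R ?M) \<and> (\<forall>i<n. N i \<subset> N (Suc i))" by (intro exI[of _ ?N])
    then show "enat n \<le> module_length R ?M"
      unfolding module_length_def by (intro SUP_upper CollectI)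
  qed
qed

lemma quotient_length_eq_colength: "ideal I R \<Longrightarrow> quotient_length R I = colength I"
  by (simp add: quotient_length_def colength_def module_length_quotient)

end

section \<open>Level sets of a multiplicative norm\<close>

locale normed_parameter_system = parameter_system +
  fixes N :: "'a \<Rightarrow> real"
  assumes norm: "form_norm N"
    and norm_mult: "x \<in> carrier R \<Longrightarrow> y \<in> carrier R \<Longrightarrow> N (x \<otimes> y) = N x * N y"
begin

lemmas norm_nonneg = form_normD(2)[OF norm] and norm_le_1 = form_normD(3)[OF norm]
  and norm_zero = form_normD(4)[OF norm] and norm_add = form_normD(5)[OF norm]
  and norm_form = form_normD(7)[OF norm] and norm_one = form_norm_one[OF norm]

lemma norm_pow: "x \<in> carrier R \<Longrightarrow> N (x [^] (j::nat)) = N x ^ j"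
  by (induction j) (simp_all add: norm_one norm_mult)

lemma norm_mult_le: "r \<in> carrier R \<Longrightarrow> x \<in> carrier R \<Longrightarrow> N (r \<otimes> x) \<le> N x"
  using norm_mult[of r x] mult_right_mono[OF norm_le_1[of r] norm_nonneg[of x]] by simp

definition open_level :: "real \<Rightarrow> 'a set" where
  "open_level t = {x \<in> carrier R. N x < t}"

definition closed_level :: "real \<Rightarrow> 'a set" where
  "closed_level t = {x \<in> carrier R. N x \<le> t}"

lemma open_level_ideal: "0 < t \<Longrightarrow> ideal (open_level t) R"
proof (rule idealI_cring)
  fix x y assume "x \<in> open_level t" "y \<in> open_level t"
  then show "x \<oplus> y \<in> open_level t" using norm_add[of x y] by (auto simp: open_level_def)
next
  fix r x assume "r \<in> carrier R" "x \<in> open_level t"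
  then show "r \<otimes> x \<in> open_level t" using norm_mult_le[of r x] by (auto simp: open_level_def)
qed (auto simp: open_level_def norm_zero)

lemma closed_level_ideal: "0 \<le> t \<Longrightarrow> ideal (closed_level t) R"
proof (rule idealI_cring)
  fix x y assume "x \<in> closed_level t" "y \<in> closed_level t"
  then show "x \<oplus> y \<in> closed_level t" using norm_add[of x y] by (auto simp: closed_level_def)
next
  fix r x assume "r \<in> carrier R" "x \<in> closed_level t"
  then show "r \<otimes> x \<in> closed_level t" using norm_mult_le[of r x] by (auto simp: closed_level_def)
qed (auto simp: closed_level_def norm_zero)

lemma monomial_form: "\<alpha> \<in> exponents d r \<Longrightarrow> monomial xs \<alpha> \<in> initial_forms r"
proof -
  assume \<alpha>: "\<alpha> \<in> exponents d r"
  then have la: "length \<alpha> = d" "sum_list \<alpha> = r" by (auto simp: exponents_def)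
  have "monomial xs \<alpha> \<notin> fibre r"
  proof
    assume "monomial xs \<alpha> \<in> fibre r"
    moreover have "fibre r \<subseteq> tail_ideal fibre xs \<alpha>"
    proof -
      have "fibre r \<union> monomial xs ` {\<beta>\<in>exponents d r. \<alpha> < \<beta>} \<subseteq> carrier R"
        using ideal_subset_carrier[OF fibre_ideal] xs_carrier by auto
      from genideal_self[OF this] show ?thesis by (simp add: tail_ideal_def la(2) len)
    qed
    ultimately show False
      using monomial_not_mem_tail[OF la(1) one_closed m_proper(1)] xs_carrier by auto
  qed
  then show ?thesis using monomial_mem_Q_pow[OF \<alpha>] by (simp add: initial_forms_def)
qed

lemma Q_pow_subset_closed_level: "ideal_pow R Q r \<subseteq> closed_level ((1/2) ^ r)"
  unfolding Q_pow_eq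
  using norm_form[OF monomial_form] xs_carrier
  by (intro genideal_minimal closed_level_ideal) (auto simp: closed_level_def)

text \<open>A relation between the elements \<open>h \<otimes> monomial xs \<alpha>\<close> of norm
  \<open>t\<close> modulo smaller norm would, after cancelling \<open>h\<close> by multiplicativity,
  give an initial form of degree \<open>r\<close> with norm below \<open>(1/2) ^ r\<close>. So each
  of them contributes at least 1 to the length.\<close>

lemma ideal_length_level:
  assumes A: "ideal A R" and h: "h \<in> carrier R" "0 < N h"
    and hA: "\<And>\<alpha>. \<alpha> \<in> exponents d r \<Longrightarrow> h \<otimes> monomial xs \<alpha> \<in> A" and t: "t = N h * (1/2) ^ r"
  shows "enat (card (exponents d r)) \<le> ideal_length (A \<inter> open_level t) (A \<inter> closed_level t)"
proof -
  let ?E = "exponents d r" let ?B = "A \<inter> open_level t" let ?g = "\<lambda>\<alpha>. h \<otimes> monomial xs \<alpha>"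
  have t0: "0 < t" using h(2) t by simp
  have B: "ideal ?B R" using A open_level_ideal[OF t0] by (rule ideal_inter)
  have AC: "ideal (A \<inter> closed_level t) R" using A closed_level_ideal t0 by (intro ideal_inter) auto
  have gc: "?g \<alpha> \<in> carrier R" for \<alpha> using h xs_carrier by simp
  have sub: "?B \<union> ?g ` U \<subseteq> carrier R" for U using gc ideal_subset_carrier[OF B] by auto
  have Ng: "N (?g \<alpha>) = t" if "\<alpha> \<in> ?E" for \<alpha>
    using norm_mult[of h "monomial xs \<alpha>"] h norm_form[OF monomial_form[OF that]] xs_carrier t by simp
  have proper: "?g \<alpha> \<notin> Idl (?B \<union> ?g ` {\<beta>\<in>?E. \<alpha> < \<beta>})" if \<alpha>: "\<alpha> \<in> ?E" for \<alpha>
  proof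
    let ?U = "{\<beta>\<in>?E. \<alpha> < \<beta>}"
    assume mem: "?g \<alpha> \<in> Idl (?B \<union> ?g ` ?U)"
    have mc: "monomial xs ` ?U \<subseteq> carrier R" using xs_carrier by auto
    let ?K = "Idl (monomial xs ` ?U)"
    have K: "ideal ?K R" using mc by (rule genideal_ideal)
    have "Idl (?B \<union> ?g ` ?U) \<subseteq> {b \<oplus> u \<otimes> h | b u. b \<in> ?B \<and> u \<in> ?K}"
    proof (rule genideal_minimal[OF ideal_scaled_sum[OF B K h(1)]], rule Un_least)
      show "?B \<subseteq> {b \<oplus> u \<otimes> h | b u. b \<in> ?B \<and> u \<in> ?K}"
      proof
        fix b assume b: "b \<in> ?B"
        have "b = b \<oplus> \<zero> \<otimes> h" using ideal.Icarr[OF B b] h by simp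
        then show "b \<in> {b \<oplus> u \<otimes> h | b u. b \<in> ?B \<and> u \<in> ?K}" using b ideal_zero_closed[OF K] by blast
      qed
      show "?g ` ?U \<subseteq> {b \<oplus> u \<otimes> h | b u. b \<in> ?B \<and> u \<in> ?K}"
      proof (rule image_subsetI)
        fix \<beta> assume "\<beta> \<in> ?U"
        then have "monomial xs \<beta> \<in> ?K" using genideal_self[OF mc] by blast
        moreover have "?g \<beta> = \<zero> \<oplus> monomial xs \<beta> \<otimes> h" using h xs_carrier by (simp add: m_comm)
        ultimately show "?g \<beta> \<in> {b \<oplus> u \<otimes> h | b u. b \<in> ?B \<and> u \<in> ?K}"
          using ideal_zero_closed[OF B] by blast
      qed
    qed
    then obtain b u where bu: "b \<in> ?B" "u \<in> ?K" "?g \<alpha> = b \<oplus> u \<otimes> h" using mem by blast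
    \<comment> \<open>Its leading monomial is that of \<alpha> with coefficient 1, the element
      \<open>u\<close> being a combination of later monomials; hence \<tau> is an initial
      form.\<close>
    define \<tau> where "\<tau> = monomial xs \<alpha> \<ominus> u"
    have c: "b \<in> carrier R" "u \<in> carrier R" "monomial xs \<alpha> \<in> carrier R"
      using ideal.Icarr[OF B bu(1)] ideal.Icarr[OF K bu(2)] xs_carrier by auto
    have tc: "\<tau> \<in> carrier R" using c by (simp add: \<tau>_def)
    have la: "length \<alpha> = d" "sum_list \<alpha> = r" using \<alpha> by (auto simp: exponents_def)
    have "\<tau> \<otimes> h = ?g \<alpha> \<ominus> u \<otimes> h" unfolding \<tau>_def using c h(1) by algebra
    also have "\<dots> = b" unfolding bu(3) using c h(1) by algebra
    finally have "N \<tau> * N h < N h * (1/2) ^ r"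
      using bu(1) norm_mult[OF tc h(1)] t by (simp add: open_level_def)
    then have small: "N \<tau> < (1/2) ^ r" using h(2) by (simp add: mult.commute)
    have sub': "fibre r \<union> monomial xs ` ?U \<subseteq> carrier R"
      using mc ideal_subset_carrier[OF fibre_ideal] by auto
    have tail: "tail_ideal fibre xs \<alpha> = Idl (fibre r \<union> monomial xs ` ?U)"
      using la len by (simp add: tail_ideal_def)
    have "\<tau> \<in> ideal_pow R Q r"
    proof -
      have "?K \<subseteq> ideal_pow R Q r" using monomial_mem_Q_pow by (intro genideal_minimal Q_pow_ideal) auto
      then show ?thesis unfolding \<tau>_def
        using monomial_mem_Q_pow[OF \<alpha>] bu(2) by (intro ideal_minus_closed[OF Q_pow_ideal]) auto
    qed
    moreover have "\<tau> \<notin> fibre r"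
    proof
      assume "\<tau> \<in> fibre r"
      then have "\<tau> \<in> tail_ideal fibre xs \<alpha>" unfolding tail using genideal_self[OF sub'] by blast
      moreover have "u \<in> tail_ideal fibre xs \<alpha>"
        unfolding tail using Idl_mono[OF _ sub', of "monomial xs ` ?U"] bu(2) by auto
      ultimately have "\<tau> \<oplus> u \<in> tail_ideal fibre xs \<alpha>"
        by (rule ideal_a_closed[OF tail_ideal_ideal[OF fibre_filtration]])
      moreover have "\<tau> \<oplus> u = \<one> \<otimes> monomial xs \<alpha>" unfolding \<tau>_def using c by algebra
      ultimately show False using monomial_not_mem_tail[OF la(1) one_closed m_proper(1)] by simp
    qed
    ultimately have "\<tau> \<in> initial_forms r" by (simp add: initial_forms_def)
    with small show False using norm_form by simp
  qed
  let ?c = "\<lambda>\<alpha>. colon (Idl (?B \<union> ?g ` {\<beta>\<in>?E. \<alpha> < \<beta>})) (?g \<alpha>)"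
  have "1 \<le> ideal_length (?c \<alpha>) (carrier R)" if \<alpha>: "\<alpha> \<in> ?E" for \<alpha>
  proof (rule ideal_length_ge_1[OF _ oneideal])
    show "ideal (?c \<alpha>) R" using gc by (intro colon_ideal genideal_ideal sub)
    have "\<one> \<notin> ?c \<alpha>" using proper[OF \<alpha>] gc by (simp add: mem_colon_iff)
    then show "?c \<alpha> \<subset> carrier R" by (auto simp: colon_def)
  qed
  then have "(\<Sum>\<alpha>\<in>?E. 1) \<le> (\<Sum>\<alpha>\<in>?E. ideal_length (?c \<alpha>) (carrier R))" by (intro sum_mono) auto
  also have "\<dots> = ideal_length ?B (Idl (?B \<union> ?g ` ?E))"
    using ideal_length_Idl_span[OF B finite_exponents, of d r ?g] gc by simp
  also have "\<dots> \<le> ideal_length ?B (A \<inter> closed_level t)"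
  proof (rule ideal_length_mono[OF order_refl], rule genideal_minimal[OF AC])
    show "?B \<union> ?g ` ?E \<subseteq> A \<inter> closed_level t"
      using hA Ng gc by (auto simp: open_level_def closed_level_def)
  qed
  finally show ?thesis by (simp add: of_nat_eq_enat)
qed

text \<open>Different levels stack up, since the closed level at \<open>b\<close> lies in the open
  level at every larger value. The induction removes the smallest level and continues above its
  closed level.\<close>

lemma ideal_length_levels:
  assumes "finite T" and A: "ideal A R" and B: "ideal B R" "B \<subseteq> A"
    and T: "\<And>t. t \<in> T \<Longrightarrow> 0 < t \<and> B \<subseteq> open_level t \<and>
      enat (M t) \<le> ideal_length (A \<inter> open_level t) (A \<inter> closed_level t)"
  shows "enat (\<Sum>t\<in>T. M t) \<le> ideal_length B A"
  using assms(1) B T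
proof (induction T arbitrary: B rule: finite_linorder_min_induct)
  case empty
  then show ?case by (simp flip: zero_enat_def)
next
  case (insert b T)
  have b: "0 < b" "B \<subseteq> open_level b" "enat (M b) \<le> ideal_length (A \<inter> open_level b) (A \<inter> closed_level b)"
    using insert.prems(3)[of b] by auto
  have O: "ideal (A \<inter> open_level b) R" using A open_level_ideal[OF b(1)] by (rule ideal_inter)
  have C: "ideal (A \<inter> closed_level b) R" using A closed_level_ideal b(1) by (intro ideal_inter) auto
  have OC: "A \<inter> open_level b \<subseteq> A \<inter> closed_level b" by (auto simp: open_level_def closed_level_def)
  have "enat (\<Sum>t\<in>T. M t) \<le> ideal_length (A \<inter> closed_level b) A"
  proof (rule insert.IH[OF C])
    fix t assume t: "t \<in> T"
    then have "b < t" using insert.hyps(2) by blast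
    then have "A \<inter> closed_level b \<subseteq> open_level t" by (auto simp: open_level_def closed_level_def)
    then show "0 < t \<and> A \<inter> closed_level b \<subseteq> open_level t \<and>
        enat (M t) \<le> ideal_length (A \<inter> open_level t) (A \<inter> closed_level t)"
      using insert.prems(3)[of t] t by simp
  qed auto
  then have "enat (M b) + enat (\<Sum>t\<in>T. M t) \<le>
      ideal_length (A \<inter> open_level b) (A \<inter> closed_level b) + ideal_length (A \<inter> closed_level b) A"
    using b(3) by (intro add_mono)
  also have "\<dots> = ideal_length (A \<inter> open_level b) A"
    using ideal_length_add[OF O C A OC] by simp
  also have "\<dots> \<le> ideal_length B A" using b(2) insert.prems(2) by (intro ideal_length_mono) auto
  finally show ?case using insert.hyps by auto
qed

lemma ideal_length_indexed_levels:
  assumes fin: "finite J" and A: "ideal A R" and B: "ideal B R" "B \<subseteq> A" and inj: "inj_on t J"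
    and J: "\<And>i. i \<in> J \<Longrightarrow> 0 < t i \<and> B \<subseteq> open_level (t i) \<and>
      enat (M i) \<le> ideal_length (A \<inter> open_level (t i)) (A \<inter> closed_level (t i))"
  shows "enat (\<Sum>i\<in>J. M i) \<le> ideal_length B A"
proof -
  have "enat (\<Sum>u\<in>t ` J. M (inv_into J t u)) \<le> ideal_length B A"
    using fin J inj by (intro ideal_length_levels A B) auto
  also have "(\<Sum>u\<in>t ` J. M (inv_into J t u)) = (\<Sum>i\<in>J. M i)"
    using inj by (simp add: sum.reindex)
  finally show ?thesis .
qed

text \<open>The number of exponents of degree below \<open>L > 0\<close> is the binomial coefficient
  of \<open>d + L - 1\<close> over \<open>d\<close>, by the hockey-stick identity.\<close>

lemma sum_card_exponents_ge:
  "(real L / real d) ^ d \<le> real (\<Sum>r<L. card (exponents d r))"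
proof (cases L)
  case 0
  then show ?thesis using d_pos by (simp add: power_0_left)
next
  case (Suc l)
  have "(\<Sum>r<L. card (exponents d r)) = (\<Sum>r\<le>l. (d - 1 + r) choose r)"
    unfolding Suc lessThan_Suc_atMost card_exponents using d_pos by (intro sum.cong) (auto simp: add.commute)
  also have "\<dots> = (d + l) choose l" using sum_choose_lower[of "d - 1" l] d_pos by simp
  also have "\<dots> = (d + l) choose d" using binomial_symmetric[of l "d + l"] by simp
  finally have e: "real (\<Sum>r<L. card (exponents d r)) = real ((d + l) choose d)" by (rule arg_cong)
  have "(real L / real d) ^ d \<le> (real (d + l) / real d) ^ d"
    using Suc d_pos by (intro power_mono divide_right_mono) auto
  also have "\<dots> \<le> real ((d + l) choose d)" using binomial_ge_n_over_k_pow_k[of d "d + l", where 'a = real] by simp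
  finally show ?thesis using e by simp
qed

lemma card_exponents_ge: "(real r / real d) ^ (d - 1) \<le> real (card (exponents d r))"
\<comment> \<open>The general estimate divides by \<open>d - 1\<close>.\<close>
proof (cases "d = 1")
  case True
  then show ?thesis by (simp add: card_exponents)
next
  case False
  then have d: "d \<ge> 2" using d_pos by simp
  have "(real r / real d) ^ (d - 1) \<le> (real (r + d - 1) / real (d - 1)) ^ (d - 1)"
    using d by (intro power_mono frac_le) auto
  also have "\<dots> \<le> real ((r + d - 1) choose (d - 1))"
    using binomial_ge_n_over_k_pow_k[of "d - 1" "r + d - 1", where 'a = real] by simp
  also have "(r + d - 1) choose (d - 1) = (r + d - 1) choose r"
    using binomial_symmetric[of r "r + d - 1"] d by (simp add: algebra_simps)
  finally show ?thesis by (simp add: card_exponents)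
qed

definition x1 :: 'a where "x1 = xs ! 0"

lemma x1_carrier: "x1 \<in> carrier R"
proof -
  have "x1 \<in> set xs" unfolding x1_def using d_pos len by (intro nth_mem) simp
  then show ?thesis using xs_carrier by blast
qed

lemma norm_x1: "N x1 = 1/2"
proof -
  have "monomial xs (unit_exp d 0) = x1"
    using monomial_unit_exp[OF xs_carrier, of 0] d_pos len by (simp add: x1_def)
  moreover have "unit_exp d 0 \<in> exponents d 1" using unit_exp_exponents[of 0 d] d_pos by simp
  ultimately show ?thesis using norm_form[OF monomial_form, of "unit_exp d 0" 1] by simp
qed

lemma norm_x1_pow: "N (x1 [^] (n::nat)) = (1/2) ^ n"
  using norm_pow[OF x1_carrier] norm_x1 by simp

text \<open>The values of \<open>N\<close> do not accumulate at powers of \<open>1/2\<close>: powers of \<open>g\<close> would otherwise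
  produce too many levels, contradicting the Hilbert-Samuel bound for \<open>Q\<close>.\<close>

lemma norm_gap:
  "\<exists>E\<ge>1. \<forall>n. \<forall>g\<in>carrier R. N g < (1/2) ^ n \<longrightarrow> N g ^ E \<le> (1/2) ^ (n * E + 1)"
proof -
  \<comment> \<open>Chosen to contradict the inequality
    \<open>E (L/d)^d \<le> colength Q * (2 L)^d\<close> reached at the end, in which
    \<open>L\<close> cancels.\<close>
  obtain E :: nat where E: "colength Q * (2 * real d) ^ d < real E" using reals_Archimedean2 by blast
  have E1: "E \<ge> 1"
  proof -
    have "0 \<le> colength Q * (2 * real d) ^ d" by (intro mult_nonneg_nonneg) auto
    with E have "0 < real E" by linarith
    then show ?thesis by simp
  qed
  have False if g: "g \<in> carrier R" "N g < (1/2) ^ n" "\<not> N g ^ E \<le> (1/2) ^ (n * E + 1)" for n g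
  proof -
    \<comment> \<open>Large enough that \<open>n * E + L \<le> 2 * L\<close>; this removes the
      dependence on \<open>n\<close>.\<close>
    define L where "L = n * E + 1"
    define q where "q = N g * 2 ^ n"
    have big: "(1/2) ^ (n * E + 1) < N g ^ E" using g(3) by simp
    have g0: "0 < N g"
    proof (rule ccontr)
      assume "\<not> 0 < N g"
      then have "N g = 0" using norm_nonneg[of g] by simp
      then have "(1/2 :: real) ^ (n * E + 1) < 0" using big E1 by (simp add: power_0_left)
      then show False using zero_less_power[of "1/2 :: real" "n * E + 1"] by linarith
    qed
    have q: "0 < q" "q < 1" using g0 g(2) by (auto simp: q_def power_one_over field_simps)
    have Ngq: "N g = q * (1/2) ^ n" by (simp add: q_def power_one_over)
    have "N g ^ E = q ^ E * (1/2) ^ (n * E)" unfolding Ngq by (simp add: power_mult_distrib power_mult)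
    then have "(1/2) ^ (n * E) * (1/2) < (1/2) ^ (n * E) * q ^ E" using big by (simp add: mult.commute)
    then have qE: "1/2 < q ^ E" by (simp add: mult_less_cancel_left)
    have qj: "1/2 < q ^ j" "q ^ j \<le> 1" if "j \<le> E" for j
    proof -
      have "q ^ E \<le> q ^ j" using q that by (intro power_decreasing) auto
      then show "1/2 < q ^ j" using qE by simp
      show "q ^ j \<le> 1" using q by (simp add: power_le_one)
    qed
    \<comment> \<open>These interpolate between \<open>x1 [^] (n * E)\<close> and
      \<open>g [^] E\<close>. Their norms are \<open>q ^ j\<close> times a fixed power of 1/2,
      pairwise different and all within a factor of 2.\<close>
    define h where "h j = x1 [^] (n * (E - j)) \<otimes> g [^] j" for j
    have hc: "h j \<in> carrier R" for j using x1_carrier g(1) by (simp add: h_def)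
    have Nh: "N (h j) = (1/2) ^ (n * E) * q ^ j" if "j \<le> E" for j
    proof -
      have "N (h j) = (1/2) ^ (n * (E - j)) * (q * (1/2) ^ n) ^ j"
        using norm_mult x1_carrier g(1) norm_pow norm_x1_pow Ngq by (simp add: h_def)
      also have "\<dots> = (1/2) ^ (n * (E - j) + n * j) * q ^ j"
        by (simp add: power_mult_distrib power_add power_mult)
      also have "n * (E - j) + n * j = n * E" using that by (simp flip: add_mult_distrib2)
      finally show ?thesis .
    qed
    define t where "t = (\<lambda>(j, r). N (h j) * (1/2) ^ r)"
    define I where "I = {..<E} \<times> {..<L}"
    have t_eq: "t (j, r) = (1/2) ^ (n * E + r) * q ^ j" if "j \<le> E" for j r
      using Nh[OF that] by (simp add: t_def power_add)
    have t_lower: "(1/2) ^ (n * E + r + 1) < t (j, r)" and t_upper: "t (j, r) \<le> (1/2) ^ (n * E + r)"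
      if "j \<le> E" for j r
      unfolding t_eq[OF that] using qj[OF that] by simp_all
    \<comment> \<open>The exponent \<open>r\<close> determines the interval between consecutive
      powers of 1/2, and \<open>j\<close> the position inside it.\<close>
    have "inj_on t I"
    proof (rule inj_onI)
      have less: "t (j', r') < t (j, r)" if "j \<le> E" "j' \<le> E" "r < r'" for j r j' r'
      proof -
        have "t (j', r') \<le> (1/2) ^ (n * E + r')" by (rule t_upper[OF that(2)])
        also have "\<dots> \<le> (1/2) ^ (n * E + r + 1)" using that(3) by (intro power_decreasing) auto
        also have "\<dots> < t (j, r)" by (rule t_lower[OF that(1)])
        finally show ?thesis .
      qed
      fix a b assume ab: "a \<in> I" "b \<in> I" "t a = t b"
      obtain j r j' r' where e: "a = (j, r)" "b = (j', r')" by (cases a; cases b)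
      have jj: "j \<le> E" "j' \<le> E" using ab e by (auto simp: I_def)
      have "r = r'"
      proof (rule ccontr)
        assume "r \<noteq> r'"
        then consider "r < r'" | "r' < r" by linarith
        then show False
          using less[OF jj] less[OF jj(2,1)] ab(3) e by cases (metis less_irrefl)+
      qed
      moreover have "q ^ j = q ^ j'" using ab(3) e t_eq[OF jj(1), of r] t_eq[OF jj(2), of r'] \<open>r = r'\<close> by simp
      then have "j = j'" using q power_strict_decreasing[of j j' q] power_strict_decreasing[of j' j q]
        by (metis less_irrefl linorder_neqE_nat)
      ultimately show "a = b" using e by simp
    qed
    have "enat (\<Sum>i\<in>I. card (exponents d (snd i))) \<le> ideal_length (ideal_pow R Q (n * E + L)) (carrier R)"
    proof (rule ideal_length_indexed_levels[OF _ oneideal Q_pow_ideal _ \<open>inj_on t I\<close>])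
      show "finite I" by (simp add: I_def)
      show "ideal_pow R Q (n * E + L) \<subseteq> carrier R" using ideal_subset_carrier[OF Q_pow_ideal] .
      fix i assume i: "i \<in> I"
      then obtain j r where e: "i = (j, r)" "j < E" "r < L" by (auto simp: I_def)
      then have j: "j \<le> E" by simp
      have t0: "0 < t i" using t_eq[OF j, of r] q e(1) by simp
      have "(1/2) ^ (n * E + L) \<le> (1/2 :: real) ^ (n * E + r + 1)" using e(3) by (intro power_decreasing) auto
      also have "\<dots> < t i" using t_lower[OF j] e(1) by simp
      finally have "ideal_pow R Q (n * E + L) \<subseteq> open_level (t i)"
        using Q_pow_subset_closed_level[of "n * E + L"] by (auto simp: open_level_def closed_level_def)
      moreover have "enat (card (exponents d r)) \<le>
          ideal_length (carrier R \<inter> open_level (t i)) (carrier R \<inter> closed_level (t i))"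
        using hc Nh[OF j] q e(1) xs_carrier
        by (intro ideal_length_level[OF oneideal hc, of j]) (auto simp: t_def)
      ultimately show "0 < t i \<and> ideal_pow R Q (n * E + L) \<subseteq> open_level (t i) \<and>
          enat (card (exponents d (snd i))) \<le>
          ideal_length (carrier R \<inter> open_level (t i)) (carrier R \<inter> closed_level (t i))"
        using t0 e(1) by simp
    qed
    also have "ideal_length (ideal_pow R Q (n * E + L)) (carrier R) =
        enat (the_enat (ideal_length (ideal_pow R Q (n * E + L)) (carrier R)))"
      by (rule colength_diff(1)[OF hilbert_samuel_cofinite[OF xs_carrier cofinite_Q] oneideal
          ideal_subset_carrier[OF Q_pow_ideal]])
    finally have "(\<Sum>i\<in>I. card (exponents d (snd i))) \<le>
        the_enat (ideal_length (ideal_pow R Q (n * E + L)) (carrier R))" by simp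
    then have "real (\<Sum>i\<in>I. card (exponents d (snd i))) \<le> colength (ideal_pow R Q (n * E + L))"
      by (simp only: colength_def of_nat_le_iff)
    also have "\<dots> \<le> colength Q * real (n * E + L) ^ d"
      using hilbert_samuel_le[OF xs_carrier cofinite_Q, of "n * E + L"] len by (simp only:)
    also have "\<dots> \<le> colength Q * (2 * real L) ^ d"
      by (intro mult_left_mono power_mono) (auto simp: L_def)
    finally have upper: "real (\<Sum>i\<in>I. card (exponents d (snd i))) \<le> colength Q * (2 * real L) ^ d" .
    have "(\<Sum>i\<in>I. card (exponents d (snd i))) = (\<Sum>j<E. \<Sum>r<L. card (exponents d r))"
      unfolding I_def sum.cartesian_product case_prod_beta ..
    then have "real (\<Sum>i\<in>I. card (exponents d (snd i))) = real E * real (\<Sum>r<L. card (exponents d r))"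
      by simp
    then have "real E * (real L / real d) ^ d \<le> colength Q * (2 * real L) ^ d"
      using upper mult_left_mono[OF sum_card_exponents_ge[of L], of "real E"] by simp
    then have "real E * real L ^ d \<le> colength Q * (2 * real d) ^ d * real L ^ d"
      using d_pos by (simp add: power_divide power_mult_distrib field_simps)
    moreover have "0 < L" by (simp add: L_def)
    then have "0 < real L ^ d" by simp
    ultimately have "real E \<le> colength Q * (2 * real d) ^ d" by (rule mult_right_le_imp_le)
    with E show False by simp
  qed
  then show ?thesis using E1 by (intro exI[of _ E]) blast
qed

end

section \<open>Hilbert-Samuel multiplicities\<close>

context noetherian_local_ring
begin

lemma hilbert_samuel_eventually_poly_primary:
  assumes "cofinite I"
  shows "\<exists>r. eventually_poly r (\<lambda>n. colength (ideal_pow R I n))"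
    and "cofinite (ideal_pow R I n)"
proof -
  obtain ys where ys: "set ys \<subseteq> carrier R" "I = Idl (set ys)"
    using ideal_eq_Idl_set assms by (auto simp: cofinite_def)
  show "\<exists>r. eventually_poly r (\<lambda>n. colength (ideal_pow R I n))" "cofinite (ideal_pow R I n)"
    using hilbert_samuel_eventually_poly[OF ys(1)] hilbert_samuel_cofinite[OF ys(1)] assms ys(2) by auto
qed

end

context parameter_system
begin

text \<open>Since \<open>Q^(l n)\<close> lies in \<open>I^n\<close>, the colengths are bounded by a
  multiple of \<open>n ^ d\<close>; together with polynomiality this shows that the
  \<open>lim\<close> in the definition is a genuine limit.\<close>

lemma multiplicity_LIMSEQ:
  assumes I: "ideal I R" and sub: "ideal_pow R Q l \<subseteq> I"
  shows "(\<lambda>n. fact d * colength (ideal_pow R I n) / real n ^ d) \<longlonglongrightarrow> multiplicity_of_ideal R I"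
proof -
  have cof: "cofinite I"
    using cofinite_superset[OF hilbert_samuel_cofinite[OF xs_carrier cofinite_Q] I sub] .
  obtain r where r: "eventually_poly r (\<lambda>n. colength (ideal_pow R I n))"
    using hilbert_samuel_eventually_poly_primary(1)[OF cof] by blast
  have bound: "\<bar>colength (ideal_pow R I n)\<bar> \<le> colength Q * real l ^ d * real n ^ d" for n
  proof -
    have "ideal_pow R Q (l * n) \<subseteq> ideal_pow R I n"
      using ideal_pow_mono[OF sub, of n] ideal_pow_pow[OF Q_ideal] by simp
    then have "colength (ideal_pow R I n) \<le> colength (ideal_pow R Q (l * n))"
      using ideal_pow_ideal[OF I] hilbert_samuel_cofinite[OF xs_carrier cofinite_Q]
      by (intro colength_antimono)
    also have "\<dots> \<le> colength Q * real (l * n) ^ d"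
      using hilbert_samuel_le[OF xs_carrier cofinite_Q, of "l * n"] len by (simp only:)
    finally show ?thesis by (simp add: power_mult_distrib)
  qed
  have "convergent (\<lambda>n. colength (ideal_pow R I n) / real n ^ d)"
    by (rule eventually_poly_convergent[OF r bound])
  then have "convergent (\<lambda>n. fact d * (colength (ideal_pow R I n) / real n ^ d))"
    by (intro convergent_mult convergent_const)
  then have "convergent (\<lambda>n. fact d * colength (ideal_pow R I n) / real n ^ d)" by simp
  moreover have "multiplicity_of_ideal R I = lim (\<lambda>n. fact d * colength (ideal_pow R I n) / real n ^ d)"
    using quotient_length_eq_colength[OF ideal_pow_ideal[OF I]] dim
    by (simp add: multiplicity_of_ideal_def)
  ultimately show ?thesis by (simp add: convergent_LIMSEQ_iff)
qed

end

section \<open>Integral dependence and the norm\<close>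

context cring
begin

text \<open>Horner's step for the left side of an equation of integral dependence, so that such
  equations can be treated by induction on partial sums.\<close>

lemma monic_sum_Suc:
  assumes x: "x \<in> carrier R" and a: "\<And>k. k \<in> {1..Suc M} \<Longrightarrow> a k \<in> carrier R"
  shows "x [^] Suc M \<oplus> (\<Oplus>k\<in>{1..Suc M}. a k \<otimes> x [^] (Suc M - k)) =
    x \<otimes> (x [^] M \<oplus> (\<Oplus>k\<in>{1..M}. a k \<otimes> x [^] (M - k))) \<oplus> a (Suc M)"
proof -
  have cl: "(\<lambda>k. a k \<otimes> x [^] (n - k)) \<in> {1..M} \<rightarrow> carrier R" for n :: nat
    using a x by auto
  have aM: "a (Suc M) \<in> carrier R" using a by simp
  have "(\<Oplus>k\<in>{1..Suc M}. a k \<otimes> x [^] (Suc M - k)) =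
      a (Suc M) \<otimes> x [^] (Suc M - Suc M) \<oplus> (\<Oplus>k\<in>{1..M}. a k \<otimes> x [^] (Suc M - k))"
    using finsum_insert[of "{1..M}" "Suc M" "\<lambda>k. a k \<otimes> x [^] (Suc M - k)"] cl[of "Suc M"] aM x
    by (simp add: atLeastAtMostSuc_conv)
  also have "(\<Oplus>k\<in>{1..M}. a k \<otimes> x [^] (Suc M - k)) = (\<Oplus>k\<in>{1..M}. x \<otimes> (a k \<otimes> x [^] (M - k)))"
  proof (rule finsum_cong')
    fix k assume k: "k \<in> {1..M}"
    have ak: "a k \<in> carrier R" using a k by simp
    have "Suc M - k = Suc (M - k)" using k by (simp add: Suc_diff_le)
    then show "a k \<otimes> x [^] (Suc M - k) = x \<otimes> (a k \<otimes> x [^] (M - k))"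
      using ak x by (simp add: m_ac)
  qed (use a x in auto)
  also have "\<dots> = x \<otimes> (\<Oplus>k\<in>{1..M}. a k \<otimes> x [^] (M - k))"
    using finsum_rdistr[of "{1..M}" x "\<lambda>k. a k \<otimes> x [^] (M - k)"] cl[of M] x by simp
  finally have e: "(\<Oplus>k\<in>{1..Suc M}. a k \<otimes> x [^] (Suc M - k)) =
      a (Suc M) \<oplus> x \<otimes> (\<Oplus>k\<in>{1..M}. a k \<otimes> x [^] (M - k))" using aM by simp
  define p where "p = x [^] M"
  define s where "s = (\<Oplus>k\<in>{1..M}. a k \<otimes> x [^] (M - k))"
  define b where "b = a (Suc M)"
  have c: "p \<in> carrier R" "s \<in> carrier R" "b \<in> carrier R"
    using x aM cl[of M] by (auto simp: p_def s_def b_def intro: finsum_closed)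
  show ?thesis unfolding e nat_pow_Suc p_def[symmetric] s_def[symmetric] b_def[symmetric]
    using c x by algebra
qed

lemma subset_integral_closure:
  assumes I: "ideal I R" shows "I \<subseteq> integral_closure R I"
proof
  fix x assume x: "x \<in> I"
  have xc: "x \<in> carrier R" using ideal.Icarr[OF I x] .
  have "x [^] (1::nat) \<oplus> (\<Oplus>k\<in>{1..1::nat}. (\<ominus> x) \<otimes> x [^] (1 - k)) = \<zero>"
    using xc by (simp add: r_neg)
  moreover have "\<forall>k\<in>{1..1::nat}. \<ominus> x \<in> ideal_pow R I k"
    using ideal_pow_1[OF I] ideal_a_inv_closed[OF I x] by simp
  ultimately show "x \<in> integral_closure R I"
    unfolding integral_closure_def using xc
    by (intro CollectI conjI exI[of _ "1::nat"] exI[of _ "\<lambda>_. \<ominus> x"]) auto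
qed

text \<open>Horner's scheme for the homogeneous polynomial \<open>\<Sum> c i x^(M-i) f^i\<close>,
  summed over \<open>i \<le> M\<close>. With \<one> for \<open>f\<close> it is the value at
  \<open>x\<close> of a polynomial with leading coefficient \<open>c 0\<close>.\<close>

primrec hom_horner :: "(nat \<Rightarrow> 'a) \<Rightarrow> 'a \<Rightarrow> 'a \<Rightarrow> nat \<Rightarrow> 'a" where
  "hom_horner c x f 0 = c 0"
| "hom_horner c x f (Suc i) = x \<otimes> hom_horner c x f i \<oplus> c (Suc i) \<otimes> f [^] Suc i"

lemma hom_horner_closed:
  "(\<And>i. c i \<in> carrier R) \<Longrightarrow> x \<in> carrier R \<Longrightarrow> f \<in> carrier R \<Longrightarrow> hom_horner c x f i \<in> carrier R"
  by (induction i) auto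

text \<open>The values of \<open>hom_horner c l \<one>\<close> are the coefficients of the quotient by \<open>x - l f\<close>,
  followed by the remainder.\<close>

lemma hom_horner_division:
  assumes c: "\<And>i. c i \<in> carrier R" and x: "x \<in> carrier R" "f \<in> carrier R" "l \<in> carrier R"
  shows "hom_horner c x f (Suc M) =
    (x \<ominus> l \<otimes> f) \<otimes> hom_horner (hom_horner c l \<one>) x f M \<oplus> hom_horner c l \<one> (Suc M) \<otimes> f [^] Suc M"
proof (induction M)
  case 0
  have "c 0 \<in> carrier R" "c 1 \<in> carrier R" using c by auto
  then show ?case using x by simp algebra
next
  case (Suc M)
  let ?b = "hom_horner c l \<one>"
  have bc: "?b i \<in> carrier R" for i using hom_horner_closed[of c l \<one> i] c x by simp
  define B where "B = hom_horner ?b x f M"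
  define p where "p = f [^] Suc M"
  define b where "b = ?b (Suc M)"
  define e where "e = c (Suc (Suc M))"
  have cl: "B \<in> carrier R" "p \<in> carrier R" "b \<in> carrier R" "e \<in> carrier R"
    using hom_horner_closed[of ?b x f M] bc x c by (auto simp: B_def p_def b_def e_def)
  have pS: "f [^] Suc (Suc M) = p \<otimes> f" by (simp add: p_def)
  have "hom_horner c x f (Suc (Suc M)) = x \<otimes> ((x \<ominus> l \<otimes> f) \<otimes> B \<oplus> b \<otimes> p) \<oplus> e \<otimes> (p \<otimes> f)"
    using Suc by (simp only: hom_horner.simps(2)[of c x f "Suc M"] B_def b_def p_def e_def pS nat_pow_Suc)
  also have "\<dots> = (x \<ominus> l \<otimes> f) \<otimes> (x \<otimes> B \<oplus> b \<otimes> p) \<oplus> (l \<otimes> b \<oplus> e) \<otimes> (p \<otimes> f)"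
    using cl x by algebra
  also have "x \<otimes> B \<oplus> b \<otimes> p = hom_horner ?b x f (Suc M)"
    by (simp only: hom_horner.simps(2) B_def b_def p_def)
  also have "l \<otimes> b \<oplus> e = ?b (Suc (Suc M))"
    using cl by (simp add: b_def e_def)
  finally show ?case unfolding pS .
qed

end

lemma zero_FactRing: "\<zero>\<^bsub>R Quot I\<^esub> = I"
  by (simp add: FactRing_def)

context noetherian_local_ring
begin

text \<open>Reduction modulo \<open>m\<close> gives a polynomial of positive degree
  \<open>Suc M\<close>, monic because \<open>c 0 = \<one>\<close>; \<open>l\<close> is any lift of
  one of its roots.\<close>

lemma residue_field_root:
  assumes closed: "algebraically_closed (R Quot m)"
    and c: "\<And>i. c i \<in> carrier R" and c0: "c 0 = \<one>"
  shows "\<exists>l\<in>carrier R. hom_horner c l \<one> (Suc M) \<in> m"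
proof -
  let ?K = "R Quot m"
  interpret K: algebraically_closed ?K by fact
  interpret m: ideal m R by (rule m_ideal)
  interpret h: ring_hom_ring R ?K "(+>) m" by (rule m.rcos_ring_hom_ring)
  define p where "p n = map (\<lambda>i. m +> c i) [0..<Suc n]" for n
  have pc: "set (p n) \<subseteq> carrier ?K" for n using c by (auto simp: p_def)
  have lead: "hd (p n) = \<one>\<^bsub>?K\<^esub>" for n
    using c0 h.hom_one by (simp add: p_def hd_map upt_rec del: upt_Suc)
  have poly: "p (Suc M) \<in> carrier (poly_ring ?K)"
    unfolding sym[OF univ_poly_carrier] polynomial_def using pc lead K.one_not_zero by auto
  have "size (K.roots (p (Suc M))) = degree (p (Suc M))"
    using K.roots_over_carrier[OF poly] by (simp add: K.splitted_def)
  also have "\<dots> = Suc M" by (simp add: p_def)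
  finally have "K.roots (p (Suc M)) \<noteq> {#}" by auto
  then obtain y where "y \<in># K.roots (p (Suc M))" by blast
  then have "K.is_root (p (Suc M)) y" using K.roots_mem_iff_is_root[OF poly] by simp
  then have y: "y \<in> carrier ?K" "K.eval (p (Suc M)) y = \<zero>\<^bsub>?K\<^esub>" by (auto simp: K.is_root_def)
  obtain l where l: "l \<in> carrier R" "y = m +> l"
    using y(1) unfolding FactRing_def A_RCOSETS_def' by auto
  have ev: "K.eval (p n) y = m +> hom_horner c l \<one> n" for n
  proof (induction n)
    case 0
    then show ?case using c[of 0] y(1) by (simp add: p_def)
  next
    case (Suc n)
    have hc: "hom_horner c l \<one> n \<in> carrier R" using hom_horner_closed c l by simp
    have "p (Suc n) = p n @ [m +> c (Suc n)]" by (simp add: p_def)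
    then have "K.eval (p (Suc n)) y = (K.eval (p n) y \<otimes>\<^bsub>?K\<^esub> y) \<oplus>\<^bsub>?K\<^esub> (m +> c (Suc n))"
      using K.eval_append_aux[OF pc _ y(1), of "m +> c (Suc n)" n] c by simp
    also have "\<dots> = m +> (hom_horner c l \<one> n \<otimes> l \<oplus> c (Suc n))"
      unfolding Suc.IH unfolding l(2) using hc l(1) c by simp
    also have "hom_horner c l \<one> n \<otimes> l \<oplus> c (Suc n) = hom_horner c l \<one> (Suc n)"
      using hc l(1) c by (simp add: m_comm)
    finally show ?case .
  qed
  have hc: "hom_horner c l \<one> (Suc M) \<in> carrier R" by (intro hom_horner_closed c l one_closed)
  have "m +> hom_horner c l \<one> (Suc M) = \<zero>\<^bsub>?K\<^esub>"
    using ev[of "Suc M"] y(2) by (rule trans[OF sym])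
  also note zero_FactRing
  finally have "m +> hom_horner c l \<one> (Suc M) = m" .
  then have "hom_horner c l \<one> (Suc M) \<in> m" by (rule m.rcos_const_imp_mem[OF hc])
  with l show ?thesis by blast
qed

end

context normed_parameter_system
begin

lemma norm_a_inv: "x \<in> carrier R \<Longrightarrow> N (\<ominus> x) = N x"
proof -
  assume x: "x \<in> carrier R"
  have le: "N (\<ominus> y) \<le> N y" if "y \<in> carrier R" for y
    using norm_mult_le[of "\<ominus> \<one>" y] that by (simp add: l_minus)
  show ?thesis using le[OF x] le[of "\<ominus> x"] x by simp
qed

text \<open>Elements outside \<open>m\<close> are initial forms of degree 0 and have norm 1, while
  the \<open>k\<close>-th power of an element of \<open>m\<close> lies in \<open>Q\<close> and has
  norm at most 1/2.\<close>

lemma norm_mem_m: "x \<in> carrier R \<Longrightarrow> N x < 1 \<longleftrightarrow> x \<in> m"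
proof
  assume x: "x \<in> carrier R" and "N x < 1"
  then show "x \<in> m" using norm_form[of x 0] by (auto simp: initial_forms_0)
next
  assume x: "x \<in> carrier R" and "x \<in> m"
  then have "x [^] k \<in> Q" using nat_pow_mem_ideal_pow[OF m_ideal] primary by blast
  then have "N (x [^] k) \<le> (1/2) ^ 1"
    using Q_pow_subset_closed_level[of 1] ideal_pow_1[OF Q_ideal] by (auto simp: closed_level_def)
  then have "N x ^ k < 1" using norm_pow[OF x] by simp
  then show "N x < 1" using norm_le_1[of x] by (cases "N x = 1") auto
qed

text \<open>In an ultrametric sum the strictly largest term \<open>x [^] M\<close> cannot be
  cancelled; the induction carries the rest along as one element \<open>s\<close> of smaller
  norm.\<close>

lemma monic_dominant:
  assumes x: "x \<in> carrier R" and a: "\<And>k. k \<in> {1..M} \<Longrightarrow> a k \<in> carrier R \<and> N (a k) < N x ^ k" and x0: "0 < N x"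
  shows "x [^] M \<oplus> (\<Oplus>k\<in>{1..M}. a k \<otimes> x [^] (M - k)) \<noteq> \<zero>"
proof -
  let ?P = "\<lambda>n. x [^] n \<oplus> (\<Oplus>k\<in>{1..n}. a k \<otimes> x [^] (n - k))"
  have "n \<le> M \<Longrightarrow> \<exists>s\<in>carrier R. ?P n = x [^] n \<oplus> s \<and> N s < N x ^ n" for n
  proof (induction n)
    case 0
    then show ?case by (intro bexI[of _ \<zero>]) (simp_all add: norm_zero)
  next
    case (Suc n)
    then obtain s where s: "s \<in> carrier R" "?P n = x [^] n \<oplus> s" "N s < N x ^ n" by auto
    have aS: "a (Suc n) \<in> carrier R" "N (a (Suc n)) < N x ^ Suc n" using a[of "Suc n"] Suc.prems by auto
    have "?P (Suc n) = x \<otimes> ?P n \<oplus> a (Suc n)" using a Suc.prems by (intro monic_sum_Suc x) auto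
    also have "\<dots> = x [^] Suc n \<oplus> (x \<otimes> s \<oplus> a (Suc n))"
      unfolding s(2) using s(1) aS(1) x by (simp add: r_distr a_assoc m_comm)
    finally have "?P (Suc n) = x [^] Suc n \<oplus> (x \<otimes> s \<oplus> a (Suc n))" .
    moreover have "N (x \<otimes> s \<oplus> a (Suc n)) < N x ^ Suc n"
    proof (rule le_less_trans[OF norm_add])
      show "max (N (x \<otimes> s)) (N (a (Suc n))) < N x ^ Suc n"
        using aS(2) norm_mult[OF x s(1)] mult_strict_left_mono[OF s(3) x0] by simp
    qed (use x s(1) aS(1) in simp_all)
    ultimately show ?case using s(1) aS(1) x by (intro bexI[of _ "x \<otimes> s \<oplus> a (Suc n)"]) auto
  qed
  from this[of M] obtain s where s: "s \<in> carrier R" "?P M = x [^] M \<oplus> s" "N s < N x ^ M" by auto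
  show ?thesis
  proof
    assume "?P M = \<zero>"
    then have "x [^] M \<oplus> s = \<zero>" using s(2) by simp
    then have "x [^] M = \<ominus> s" using s(1) x by (simp add: minus_equality)
    then have "N x ^ M = N s" using norm_pow[OF x, of M] norm_a_inv[OF s(1)] by simp
    with s(3) show False by simp
  qed
qed

section \<open>The ideals \<open>I n\<close> and \<open>J n\<close>\<close>

definition I :: "nat \<Rightarrow> 'a set" where "I n = open_level ((1/2) ^ n)"

definition J :: "nat \<Rightarrow> 'a set" where "J n = Idl (insert (x1 [^] n) (I n))"

lemma I_ideal: "ideal (I n) R"
  unfolding I_def by (intro open_level_ideal) simp

lemma I_subset_carrier: "I n \<subseteq> carrier R"
  using ideal_subset_carrier[OF I_ideal] .

lemma mem_J: "y \<in> J n \<longleftrightarrow> (\<exists>b\<in>I n. \<exists>r\<in>carrier R. y = b \<oplus> r \<otimes> x1 [^] n)"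
  unfolding J_def using mem_Idl_insert[OF I_subset_carrier, of "x1 [^] n" y] Idl_ideal[OF I_ideal] x1_carrier by simp

lemma J_ideal: "ideal (J n) R" and I_subset_J: "I n \<subseteq> J n" and x1_pow_mem_J: "x1 [^] n \<in> J n"
proof -
  have c: "insert (x1 [^] n) (I n) \<subseteq> carrier R" using I_subset_carrier x1_carrier by auto
  show "ideal (J n) R" "I n \<subseteq> J n" "x1 [^] n \<in> J n"
    unfolding J_def using genideal_ideal[OF c] genideal_self[OF c] by auto
qed

lemma I_psubset_J: "I n \<subset> J n"
  using I_subset_J[of n] x1_pow_mem_J[of n] norm_x1_pow[of n] by (force simp: I_def open_level_def)

lemma J_norm_le: "y \<in> J n \<Longrightarrow> N y \<le> (1/2) ^ n"
proof -
  assume "y \<in> J n"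
  then obtain b r where "b \<in> I n" "r \<in> carrier R" "y = b \<oplus> r \<otimes> x1 [^] n"
    using mem_J by blast
  note y = this
  have b: "b \<in> carrier R" "N b < (1/2) ^ n" using y(1) by (auto simp: I_def open_level_def)
  show "N y \<le> (1/2) ^ n" unfolding y(3)
  proof (rule order_trans[OF norm_add])
    show "max (N b) (N (r \<otimes> x1 [^] n)) \<le> (1/2) ^ n"
      using b(2) norm_mult_le[OF y(2), of "x1 [^] n"] x1_carrier norm_x1_pow by simp
  qed (use b(1) y(2) x1_carrier in simp_all)
qed

lemma Q_pow_subset_I: "ideal_pow R Q (Suc n) \<subseteq> I n"
proof -
  have "closed_level ((1/2) ^ Suc n) \<subseteq> I n"
  proof
    fix x assume "x \<in> closed_level ((1/2) ^ Suc n)"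
    then have x: "x \<in> carrier R" "N x \<le> (1/2) ^ Suc n" unfolding closed_level_def by blast+
    have "(1/2 :: real) ^ Suc n < (1/2) ^ n" by simp
    with x(2) have "N x < (1/2) ^ n" by linarith
    then show "x \<in> I n" using x(1) by (simp add: I_def open_level_def)
  qed
  then show ?thesis using Q_pow_subset_closed_level[of "Suc n"] by blast
qed

lemma Q_pow_subset_J: "ideal_pow R Q (Suc n) \<subseteq> J n"
  using Q_pow_subset_I I_subset_J by blast

lemma cofinite_I: "cofinite (I n)"
  using cofinite_superset[OF hilbert_samuel_cofinite[OF xs_carrier cofinite_Q] I_ideal Q_pow_subset_I] .

lemma radical_I: "ideal_radical R (I n) = m"
proof (intro equalityI subsetI)
  fix x assume "x \<in> ideal_radical R (I n)"
  then obtain j :: nat where x: "x \<in> carrier R" "x [^] j \<in> I n" by (auto simp: ideal_radical_def)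
  show "x \<in> m"
  proof (rule ccontr)
    assume "x \<notin> m"
    then have "N x = 1" using norm_mem_m[OF x(1)] norm_le_1[of x] by simp
    then have "N (x [^] j) = 1" using norm_pow[OF x(1)] by simp
    then have "1 < (1/2 :: real) ^ n" using x(2) by (simp add: I_def open_level_def)
    moreover have "(1/2 :: real) ^ n \<le> 1" by (simp add: power_le_one)
    ultimately show False by simp
  qed
next
  fix x assume x: "x \<in> m"
  then have xc: "x \<in> carrier R" using m_subset_carrier by auto
  then have lt: "N x < 1" using norm_mem_m x by simp
  obtain j where "N x ^ j < (1/2) ^ n" using real_arch_pow_inv[OF _ lt, of "(1/2) ^ n"] by auto
  then have "N x ^ Suc j < (1/2) ^ n"
    \<comment> \<open>\<open>Suc j\<close> because \<open>ideal_radical\<close> asks for a positive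
      exponent.\<close>
    using power_decreasing[of j "Suc j" "N x"] norm_nonneg[of x] lt by simp
  then have "x [^] Suc j \<in> I n" using norm_pow[OF xc, of "Suc j"] xc by (simp add: I_def open_level_def)
  then show "x \<in> ideal_radical R (I n)" using xc by (auto simp: ideal_radical_def intro!: exI[of _ "Suc j"])
qed

text \<open>By multiplicativity \<open>r \<otimes> x1 [^] n\<close> has norm below
  \<open>(1/2) ^ n\<close> exactly when \<open>N r < 1\<close>, so the colon ideal is
  \<open>m\<close> and the quotient of \<open>J n\<close> by \<open>I n\<close> is the residue
  field.\<close>

lemma quotient_length_I_J: "quotient_length R (I n) - quotient_length R (J n) = 1"
proof -
  have fc: "x1 [^] n \<in> carrier R" using x1_carrier by simp
  have "colon (I n) (x1 [^] n) = m"
  proof (intro equalityI subsetI)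
    fix r assume "r \<in> colon (I n) (x1 [^] n)"
    then have r: "r \<in> carrier R" "N (r \<otimes> x1 [^] n) < (1/2) ^ n"
      by (auto simp: mem_colon_iff I_def open_level_def)
    then have "N r < 1" using norm_mult[OF r(1) fc] norm_x1_pow by simp
    then show "r \<in> m" using norm_mem_m r(1) by simp
  next
    fix r assume "r \<in> m"
    then have r: "r \<in> carrier R" "N r < 1" using m_subset_carrier norm_mem_m by auto
    then show "r \<in> colon (I n) (x1 [^] n)"
      using norm_mult[OF r(1) fc] norm_x1_pow[of n] fc by (simp add: mem_colon_iff I_def open_level_def)
  qed
  then have "ideal_length (I n) (J n) = 1"
    using ideal_length_colon[OF I_ideal fc, of n] ideal_length_maximal[OF maximal] by (simp add: J_def)
  then have "colength (I n) = 1 + colength (J n)"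
    using colength_diff(2)[OF cofinite_I J_ideal I_subset_J, of n] by (simp add: one_enat_def)
  then show ?thesis by (simp add: quotient_length_eq_colength I_ideal J_ideal)
qed

text \<open>The strict bound fails for \<open>l = 0\<close>, where the power is the whole ring and
  contains elements of norm 1.\<close>

lemma I_pow_norm:
  assumes "l \<ge> 1" "y \<in> ideal_pow R (I n) l"
  shows "N y < (1/2) ^ (n * l)"
proof -
  have "ideal_pow R (I n) (Suc j) \<subseteq> open_level ((1/2) ^ (n * Suc j))" for j
  proof (induction j)
    case 0
    then show ?case using ideal_pow_1[OF I_ideal, of n] by (simp add: I_def)
  next
    case (Suc j)
    show ?case unfolding ideal_pow_Suc[of _ "Suc j"]
    proof (rule ideal_prod_least[OF open_level_ideal])
      fix a b assume ab: "a \<in> ideal_pow R (I n) (Suc j)" "b \<in> I n"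
      then have a: "a \<in> carrier R" "N a < (1/2) ^ (n * Suc j)" using Suc by (auto simp: open_level_def)
      have b: "b \<in> carrier R" "N b < (1/2) ^ n" using ab(2) by (auto simp: I_def open_level_def)
      have "N a * N b < (1/2) ^ (n * Suc j) * (1/2) ^ n"
        using a b norm_nonneg by (intro mult_strict_mono) auto
      then show "a \<otimes> b \<in> open_level ((1/2) ^ (n * Suc (Suc j)))"
        using a b norm_mult[of a b] by (simp add: open_level_def power_add mult_ac)
    qed simp
  qed
  then show ?thesis using assms by (cases l) (auto simp: open_level_def)
qed

text \<open>Modulo smaller norm the powers of \<open>J n\<close> are generated by the powers of
  \<open>x1 [^] n\<close>. The coefficients \<open>c\<close> are what turns an integral equation
  over \<open>J n\<close> into a polynomial over the residue field.\<close>

lemma J_pow_decompose: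
  assumes "y \<in> ideal_pow R (J n) l"
  shows "\<exists>b c. b \<in> open_level ((1/2) ^ (n * l)) \<and> c \<in> carrier R \<and> y = b \<oplus> c \<otimes> (x1 [^] n) [^] l"
proof -
  let ?f = "x1 [^] n"
  let ?S = "\<lambda>l. {b \<oplus> c \<otimes> ?f [^] l | b c. b \<in> open_level ((1/2) ^ (n * l)) \<and> c \<in> carrier R}"
  have fc: "?f \<in> carrier R" using x1_carrier by simp
  have O: "ideal (open_level ((1/2) ^ (n * l))) R" for l by (intro open_level_ideal) simp
  have S: "ideal (?S l) R" for l
    using ideal_scaled_sum[OF O oneideal nat_pow_closed[OF fc, of l]] .
  have "ideal_pow R (J n) l \<subseteq> ?S l"
  proof (induction l)
    case 0
    have "\<one> = \<zero> \<oplus> \<one> \<otimes> ?f [^] (0::nat)" by simp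
    moreover have "\<zero> \<in> open_level ((1/2) ^ (n * 0))" using ideal_zero_closed[OF O[of 0]] by simp
    ultimately have "\<one> \<in> ?S 0" by blast
    then show ?case using ideal.one_imp_carrier[OF S[of 0]] by simp
  next
    case (Suc l)
    show ?case unfolding ideal_pow_Suc
    proof (rule ideal_prod_least[OF S])
      fix u v assume u: "u \<in> ideal_pow R (J n) l" and v: "v \<in> J n"
      obtain b c where bc: "b \<in> open_level ((1/2) ^ (n * l))" "c \<in> carrier R" "u = b \<oplus> c \<otimes> ?f [^] l"
        using Suc u by blast
      obtain b' c' where bc': "b' \<in> I n" "c' \<in> carrier R" "v = b' \<oplus> c' \<otimes> ?f" using v mem_J by blast
      define p where "p = ?f [^] l"
      have p: "p \<in> carrier R" "N p = (1/2) ^ (n * l)"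
        using fc norm_pow[OF fc, of l] norm_x1_pow[of n] by (auto simp: p_def power_mult)
      have b: "b \<in> carrier R" "N b < (1/2) ^ (n * l)" using bc(1) by (auto simp: open_level_def)
      have b': "b' \<in> carrier R" "N b' < (1/2) ^ n" using bc'(1) by (auto simp: I_def open_level_def)
      define w where "w = b \<otimes> v \<oplus> c \<otimes> (p \<otimes> b')"
      have vc: "v \<in> carrier R" using ideal.Icarr[OF J_ideal v] .
      have e: "u \<otimes> v = w \<oplus> (c \<otimes> c') \<otimes> ?f [^] Suc l"
      proof -
        have "u \<otimes> v = b \<otimes> v \<oplus> c \<otimes> p \<otimes> v"
          unfolding bc(3) p_def[symmetric] using b(1) bc(2) p(1) vc by (simp add: l_distr)
        also have "c \<otimes> p \<otimes> v = c \<otimes> (p \<otimes> b') \<oplus> (c \<otimes> c') \<otimes> (p \<otimes> ?f)"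
          unfolding bc'(3) using bc(2) bc'(2) b'(1) p(1) fc by algebra
        finally show ?thesis
          unfolding w_def using b(1) vc bc(2) bc'(2) b'(1) p(1) fc by (simp add: a_assoc p_def)
      qed
      have "b \<otimes> v \<in> open_level ((1/2) ^ (n * Suc l))"
      proof -
        have "N b * N v \<le> N b * (1/2) ^ n" using J_norm_le[OF v] norm_nonneg by (intro mult_left_mono)
        also have "\<dots> < (1/2) ^ (n * l) * (1/2) ^ n" using b(2) by simp
        finally show ?thesis using norm_mult[OF b(1) vc] b(1) vc by (simp add: open_level_def power_add mult_ac)
      qed
      moreover have "p \<otimes> b' \<in> open_level ((1/2) ^ (n * Suc l))"
        using norm_mult[OF p(1) b'(1)] p b' by (simp add: open_level_def power_add mult_ac)
      then have "c \<otimes> (p \<otimes> b') \<in> open_level ((1/2) ^ (n * Suc l))" by (rule ideal.I_l_closed[OF O _ bc(2)])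
      ultimately have "w \<in> open_level ((1/2) ^ (n * Suc l))" unfolding w_def by (rule ideal_a_closed[OF O])
      moreover have "c \<otimes> c' \<in> carrier R" using bc(2) bc'(2) by simp
      ultimately show "u \<otimes> v \<in> ?S (Suc l)" using e by blast
    qed
  qed
  with assms show ?thesis by blast
qed

text \<open>If \<open>N x\<close> were at least \<open>(1/2) ^ n\<close>, every coefficient
  \<open>a k\<close> would have norm below \<open>N x ^ k\<close>, and the leading power would
  dominate the equation.\<close>

lemma integral_closure_I: "integral_closure R (I n) = I n"
proof (rule antisym[OF _ subset_integral_closure[OF I_ideal]], rule subsetI)
  fix x assume "x \<in> integral_closure R (I n)"
  then obtain M a where x: "x \<in> carrier R" and a: "\<forall>k\<in>{1..M}. a k \<in> ideal_pow R (I n) k"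
    and eq: "x [^] M \<oplus> (\<Oplus>k\<in>{1..M}. a k \<otimes> x [^] (M - k)) = \<zero>"
    unfolding integral_closure_def by blast
  show "x \<in> I n"
  proof (rule ccontr)
    assume "x \<notin> I n"
    then have ge: "(1/2) ^ n \<le> N x" using x by (simp add: I_def open_level_def)
    have "a k \<in> carrier R \<and> N (a k) < N x ^ k" if k: "k \<in> {1..M}" for k
    proof
      have ak: "a k \<in> ideal_pow R (I n) k" using a k by blast
      show "a k \<in> carrier R" using ideal.Icarr[OF ideal_pow_ideal[OF I_ideal] ak] .
      have "N (a k) < (1/2) ^ (n * k)" using I_pow_norm[OF _ ak] k by simp
      also have "\<dots> = ((1/2) ^ n) ^ k" by (simp add: power_mult)
      also have "\<dots> \<le> N x ^ k" using ge by (intro power_mono) auto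
      finally show "N (a k) < N x ^ k" .
    qed
    moreover have "0 < N x" using ge zero_less_power[of "1/2 :: real" n] by linarith
    ultimately show False using monic_dominant[OF x, of M a] eq by blast
  qed
qed

text \<open>One root at a time: dividing by \<open>x \<ominus> l \<otimes> f\<close> leaves a
  remainder with coefficient in \<open>m\<close>, hence of small norm, so the product of divisor and
  quotient is small. By multiplicativity either the divisor is small, or the quotient is an
  approximate equation of lower degree. For \<open>M = 0\<close> the hypothesis would read 1 <
  1.\<close>

lemma approximate_root:
  assumes closed: "algebraically_closed (R Quot m)" and x: "x \<in> carrier R" and f: "f \<in> carrier R" "N f = (1/2) ^ n"
  shows "(\<And>i. c i \<in> carrier R) \<Longrightarrow> c 0 = \<one> \<Longrightarrow> N (hom_horner c x f M) < (1/2) ^ (n * M) \<Longrightarrow>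
    \<exists>l\<in>carrier R. N (x \<ominus> l \<otimes> f) < (1/2) ^ n"
proof (induction M arbitrary: c)
  case 0
  then show ?case by (simp add: norm_one)
next
  case (Suc M)
  obtain l where l: "l \<in> carrier R" "hom_horner c l \<one> (Suc M) \<in> m"
    using residue_field_root[where c = c and M = M, OF closed] Suc.prems(1,2) by blast
  let ?b = "hom_horner c l \<one>"
  have bc: "?b i \<in> carrier R" for i using hom_horner_closed[of c l \<one> i] Suc.prems(1) l(1) by simp
  define u where "u = x \<ominus> l \<otimes> f"
  define v where "v = hom_horner ?b x f M"
  define w where "w = ?b (Suc M) \<otimes> f [^] Suc M"
  have cl: "u \<in> carrier R" "v \<in> carrier R" "w \<in> carrier R"
    using x f(1) l(1) hom_horner_closed[of ?b x f M, OF bc x f(1)] bc[of "Suc M"] by (auto simp: u_def v_def w_def)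
  have e: "hom_horner c x f (Suc M) = u \<otimes> v \<oplus> w"
    unfolding u_def v_def w_def by (rule hom_horner_division[OF Suc.prems(1) x f(1) l(1)])
  have Nf: "N (f [^] Suc M) = (1/2) ^ (n * Suc M)"
    using norm_pow[OF f(1), of "Suc M"] f(2) by (simp add: power_mult[symmetric] del: mult_Suc_right nat_pow_Suc power_Suc)
  have "N w = N (?b (Suc M)) * (1/2) ^ (n * Suc M)"
    unfolding w_def using norm_mult[OF bc, of "f [^] Suc M" "Suc M"] f(1) Nf by simp
  also have "\<dots> < 1 * (1/2) ^ (n * Suc M)"
    using norm_mem_m[OF bc[of "Suc M"]] l(2) by (intro mult_strict_right_mono) auto
  finally have w: "w \<in> open_level ((1/2) ^ (n * Suc M))" using cl by (simp add: open_level_def)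
  have "u \<otimes> v \<oplus> w \<in> open_level ((1/2) ^ (n * Suc M))"
    using Suc.prems(3) cl unfolding e by (simp add: open_level_def)
  then have "u \<otimes> v \<in> open_level ((1/2) ^ (n * Suc M))"
    using ideal_a_cancel_right[OF open_level_ideal w, of "u \<otimes> v"] cl by simp
  then have uv: "N u * N v < (1/2) ^ (n * Suc M)" using norm_mult cl by (simp add: open_level_def)
  show ?case
  proof (cases "N u < (1/2) ^ n")
    case True
    then show ?thesis using l(1) by (auto simp: u_def)
  next
    case False
    have "(1/2) ^ n * N v \<le> N u * N v" using False norm_nonneg by (intro mult_right_mono) auto
    also have "\<dots> < (1/2) ^ n * (1/2) ^ (n * M)" using uv by (simp add: power_add)
    finally have "N v < (1/2) ^ (n * M)" by simp
    then show ?thesis using Suc.IH[of ?b] bc Suc.prems(2) by (simp add: v_def)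
  qed
qed

lemma integral_closure_J:
  assumes closed: "algebraically_closed (R Quot m)"
  shows "integral_closure R (J n) = J n"
proof (rule antisym[OF _ subset_integral_closure[OF J_ideal]], rule subsetI)
  fix x assume "x \<in> integral_closure R (J n)"
  then obtain M a where x: "x \<in> carrier R" and a: "\<forall>k\<in>{1..M}. a k \<in> ideal_pow R (J n) k"
    and eq: "x [^] M \<oplus> (\<Oplus>k\<in>{1..M}. a k \<otimes> x [^] (M - k)) = \<zero>"
    unfolding integral_closure_def by blast
  let ?f = "x1 [^] n"
  have fc: "?f \<in> carrier R" using x1_carrier by simp
  have ac: "a k \<in> carrier R" if "k \<in> {1..M}" for k
    using ideal.Icarr[OF ideal_pow_ideal[OF J_ideal]] a that by blast
  have "\<forall>k. \<exists>b c. k \<in> {1..M} \<longrightarrow>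
      b \<in> open_level ((1/2) ^ (n * k)) \<and> c \<in> carrier R \<and> a k = b \<oplus> c \<otimes> ?f [^] k"
    using J_pow_decompose a by meson
  then obtain b c' where bc: "\<And>k. k \<in> {1..M} \<Longrightarrow>
      b k \<in> open_level ((1/2) ^ (n * k)) \<and> c' k \<in> carrier R \<and> a k = b k \<oplus> c' k \<otimes> ?f [^] k" by metis
  \<comment> \<open>At index 0 the value \<one> is the leading coefficient; beyond \<open>M\<close>
    it is a filler that keeps \<open>c\<close> inside the carrier.\<close>
  define c where "c k = (if k \<in> {1..M} then c' k else \<one>)" for k
  have cc: "c k \<in> carrier R" for k using bc by (simp add: c_def)
  have c0: "c 0 = \<one>" by (simp add: c_def)
  have ak_le: "N (a k) \<le> (1/2) ^ (n * k)" if k: "k \<in> {1..M}" for k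
  proof -
    have "N (c' k \<otimes> ?f [^] k) \<le> (1/2) ^ (n * k)"
      using norm_mult_le[of "c' k" "?f [^] k"] bc[OF k] fc norm_pow[OF fc, of k] norm_x1_pow[of n]
      by (simp add: power_mult)
    then show ?thesis
      using norm_add[of "b k" "c' k \<otimes> ?f [^] k"] bc[OF k] fc by (auto simp: open_level_def)
  qed
  \<comment> \<open>A larger \<open>x\<close> would dominate the equation. The bound is needed again
    below, where error terms are multiplied by \<open>x\<close>.\<close>
  have x_le: "N x \<le> (1/2) ^ n"
  proof (rule ccontr)
    assume "\<not> ?thesis"
    then have gt: "(1/2) ^ n < N x" by simp
    have "a k \<in> carrier R \<and> N (a k) < N x ^ k" if k: "k \<in> {1..M}" for k
    proof
      show "a k \<in> carrier R" using ac k .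
      have "N (a k) \<le> ((1/2) ^ n) ^ k" using ak_le[OF k] by (simp add: power_mult)
      also have "\<dots> < N x ^ k" using gt k by (intro power_strict_mono) auto
      finally show "N (a k) < N x ^ k" .
    qed
    moreover have "0 < N x" using gt zero_less_power[of "1/2 :: real" n] by linarith
    ultimately show False using monic_dominant[OF x, of M a] eq by blast
  qed
  have O: "ideal (open_level ((1/2) ^ (n * k))) R" for k by (intro open_level_ideal) simp
  let ?P = "\<lambda>j. x [^] j \<oplus> (\<Oplus>k\<in>{1..j}. a k \<otimes> x [^] (j - k))"
  \<comment> \<open>Each \<open>a k\<close> is replaced by its principal part; the accumulated error
    stays of norm below \<open>(1/2) ^ (n * j)\<close> at every partial sum.\<close>
  have "j \<le> M \<Longrightarrow> \<exists>e\<in>open_level ((1/2) ^ (n * j)). ?P j = hom_horner c x ?f j \<oplus> e" for j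
  proof (induction j)
    case 0
    then show ?case using ideal_zero_closed[OF O[of 0]] by (intro bexI[of _ \<zero>]) (simp_all add: c0)
  next
    case (Suc j)
    then obtain e where e: "e \<in> open_level ((1/2) ^ (n * j))" "?P j = hom_horner c x ?f j \<oplus> e" by auto
    have Sj: "Suc j \<in> {1..M}" using Suc.prems by simp
    define h where "h = hom_horner c x ?f j"
    define p where "p = c (Suc j) \<otimes> ?f [^] Suc j"
    have cl: "e \<in> carrier R" "h \<in> carrier R" "p \<in> carrier R" "b (Suc j) \<in> carrier R"
      using e(1) hom_horner_closed[of c x ?f j, OF cc x fc] cc[of "Suc j"] fc bc[OF Sj]
      by (auto simp: open_level_def h_def p_def)
    have "?P (Suc j) = x \<otimes> ?P j \<oplus> a (Suc j)" using ac Suc.prems by (intro monic_sum_Suc x) auto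
    also have "\<dots> = x \<otimes> (h \<oplus> e) \<oplus> (b (Suc j) \<oplus> p)"
      using e(2) bc[OF Sj] Sj by (simp add: h_def p_def c_def)
    also have "\<dots> = (x \<otimes> h \<oplus> p) \<oplus> (x \<otimes> e \<oplus> b (Suc j))" using cl x by algebra
    finally have "?P (Suc j) = hom_horner c x ?f (Suc j) \<oplus> (x \<otimes> e \<oplus> b (Suc j))" by (simp add: h_def p_def)
    moreover have "x \<otimes> e \<in> open_level ((1/2) ^ (n * Suc j))"
    proof -
      have "N x * N e \<le> (1/2) ^ n * N e" using x_le norm_nonneg by (intro mult_right_mono)
      also have "\<dots> < (1/2) ^ n * (1/2) ^ (n * j)" using e(1) by (simp add: open_level_def)
      finally show ?thesis using norm_mult[OF x cl(1)] x cl(1) by (simp add: open_level_def power_add)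
    qed
    then have "x \<otimes> e \<oplus> b (Suc j) \<in> open_level ((1/2) ^ (n * Suc j))"
      using bc[OF Sj] by (intro ideal_a_closed[OF O]) auto
    ultimately show ?case by blast
  qed
  from this[of M] obtain e where e: "e \<in> open_level ((1/2) ^ (n * M))" "hom_horner c x ?f M \<oplus> e = \<zero>"
    using eq by auto
  have hc: "hom_horner c x ?f M \<in> carrier R" using hom_horner_closed[of c x ?f M, OF cc x fc] .
  have "hom_horner c x ?f M \<in> open_level ((1/2) ^ (n * M))"
    using ideal_a_cancel_right[OF O e(1) _ hc] e(2) ideal_zero_closed[OF O] by simp
  then have "N (hom_horner c x ?f M) < (1/2) ^ (n * M)" by (simp add: open_level_def)
  then obtain l where l: "l \<in> carrier R" "N (x \<ominus> l \<otimes> ?f) < (1/2) ^ n"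
    using approximate_root[OF closed x fc norm_x1_pow, of c M] cc c0 by blast
  have "x \<ominus> l \<otimes> ?f \<in> I n" using l x fc by (simp add: I_def open_level_def)
  moreover have "x = (x \<ominus> l \<otimes> ?f) \<oplus> l \<otimes> ?f" using l(1) x fc by algebra
  ultimately show "x \<in> J n" using l(1) mem_J by blast
qed

section \<open>The gap between the multiplicities\<close>

text \<open>The index \<open>b\<close> stands for the level of norm
  \<open>(1/2) ^ (n * j + b)\<close>. The elements filling it lie in the \<open>j\<close>-th power
  of \<open>J n\<close>: \<open>x1 [^] n\<close> contributes \<open>j - b\<close> factors, and
  monomials of degree \<open>Suc n * b\<close> contribute the other \<open>b\<close>, because
  \<open>Q^(n+1)\<close> is contained in \<open>J n\<close>.\<close>

lemma colength_pow_gap: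
  assumes E: "E \<ge> 1" "\<And>n g. g \<in> carrier R \<Longrightarrow> N g < (1/2) ^ n \<Longrightarrow> N g ^ E \<le> (1/2) ^ (n * E + 1)"
  shows "(\<Sum>b\<in>{b. b * E < j}. real (card (exponents d (Suc n * b)))) \<le>
    colength (ideal_pow R (I n) j) - colength (ideal_pow R (J n) j)"
proof -
  let ?B = "ideal_pow R (I n) j" let ?A = "ideal_pow R (J n) j" let ?S = "{b. b * E < j}"
  have fin: "finite ?S"
  proof (rule finite_subset)
    show "?S \<subseteq> {..<j}"
    proof
      fix b assume "b \<in> ?S"
      then show "b \<in> {..<j}" using E(1) le_less_trans[of b "b * E" j] by (cases E) auto
    qed
  qed simp
  have A: "ideal ?A R" and B: "ideal ?B R" using ideal_pow_ideal J_ideal I_ideal by auto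
  have BA: "?B \<subseteq> ?A" using ideal_pow_mono[OF I_subset_J] .
  \<comment> \<open>The bound \<open>N \<le> 2^(-(n + 1/E) j)\<close> on the \<open>j\<close>-th
    power of \<open>I n\<close>, raised to the power \<open>E\<close> to avoid fractional
    exponents.\<close>
  have I_small: "?B \<subseteq> {x \<in> carrier R. N x ^ E \<le> (1/2) ^ ((n * E + 1) * j)}"
  proof (induction j)
    case 0
    then show ?case using norm_le_1 norm_nonneg by (auto intro: power_le_one)
  next
    case (Suc j)
    have pw: "ideal {x \<in> carrier R. N x ^ E \<le> (1/2) ^ l} R" for l
    proof (rule idealI_cring)
      fix x y assume xy: "x \<in> {x \<in> carrier R. N x ^ E \<le> (1/2) ^ l}" "y \<in> {x \<in> carrier R. N x ^ E \<le> (1/2) ^ l}"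
      have "N (x \<oplus> y) ^ E \<le> max (N x) (N y) ^ E"
        using norm_add[of x y] norm_nonneg xy by (intro power_mono) auto
      also have "\<dots> \<le> (1/2) ^ l" using xy by (auto simp: max_def)
      finally show "x \<oplus> y \<in> {x \<in> carrier R. N x ^ E \<le> (1/2) ^ l}" using xy by simp
    next
      fix r x assume rx: "r \<in> carrier R" "x \<in> {x \<in> carrier R. N x ^ E \<le> (1/2) ^ l}"
      have "N (r \<otimes> x) ^ E \<le> N x ^ E" using norm_mult_le[of r x] norm_nonneg rx by (intro power_mono) auto
      then show "r \<otimes> x \<in> {x \<in> carrier R. N x ^ E \<le> (1/2) ^ l}" using rx by simp
    qed (use E(1) in \<open>auto simp: norm_zero power_0_left\<close>)
    show ?case unfolding ideal_pow_Suc
    proof (rule ideal_prod_least[OF pw])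
      fix a b assume ab: "a \<in> ideal_pow R (I n) j" "b \<in> I n"
      have a: "a \<in> carrier R" "N a ^ E \<le> (1/2) ^ ((n * E + 1) * j)" using Suc ab(1) by auto
      have b: "b \<in> carrier R" "N b ^ E \<le> (1/2) ^ (n * E + 1)"
        using ab(2) E(2)[of b n] by (auto simp: I_def open_level_def)
      have "N (a \<otimes> b) ^ E = N a ^ E * N b ^ E" using norm_mult[OF a(1) b(1)] by (simp add: power_mult_distrib)
      also have "\<dots> \<le> (1/2) ^ ((n * E + 1) * j) * (1/2) ^ (n * E + 1)"
        using a b norm_nonneg by (intro mult_mono) auto
      also have "\<dots> = (1/2) ^ ((n * E + 1) * Suc j)" by (simp flip: power_add add: algebra_simps)
      finally show "a \<otimes> b \<in> {x \<in> carrier R. N x ^ E \<le> (1/2) ^ ((n * E + 1) * Suc j)}"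
        using a b by simp
    qed
  qed
  have "enat (\<Sum>b\<in>?S. card (exponents d (Suc n * b))) \<le> ideal_length ?B ?A"
  proof (rule ideal_length_indexed_levels[OF fin A B BA, where t = "\<lambda>b. (1/2) ^ (n * j + b)"])
    show "inj_on (\<lambda>b. (1/2 :: real) ^ (n * j + b)) ?S"
      by (rule inj_onI) (simp add: power_inject_exp')
    fix b assume b: "b \<in> ?S"
    have bj: "b \<le> j" using b E(1) le_less_trans[of b "b * E" j] by (cases E) auto
    have "?B \<subseteq> open_level ((1/2) ^ (n * j + b))"
    proof
      fix x assume "x \<in> ?B"
      then have x: "x \<in> carrier R" "N x ^ E \<le> (1/2) ^ ((n * E + 1) * j)" using I_small by auto
      \<comment> \<open>The two sides differ by exactly \<open>j - b * E\<close>; this is the origin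
        of the range of \<open>b\<close>.\<close>
      have "(n * j + b) * E < (n * E + 1) * j" using b by (simp add: algebra_simps)
      then have "(1/2 :: real) ^ ((n * E + 1) * j) < (1/2) ^ ((n * j + b) * E)"
        by (intro power_strict_decreasing) auto
      then have "N x ^ E < ((1/2) ^ (n * j + b)) ^ E" using x(2) by (simp add: power_mult)
      then have "N x < (1/2) ^ (n * j + b)" by (rule power_less_imp_less_base) simp
      then show "x \<in> open_level ((1/2) ^ (n * j + b))" using x(1) by (simp add: open_level_def)
    qed
    moreover have "enat (card (exponents d (Suc n * b))) \<le>
        ideal_length (?A \<inter> open_level ((1/2) ^ (n * j + b))) (?A \<inter> closed_level ((1/2) ^ (n * j + b)))"
    proof (rule ideal_length_level[OF A, of "(x1 [^] n) [^] (j - b)"])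
      show c: "(x1 [^] n) [^] (j - b) \<in> carrier R" using x1_carrier by simp
      have e: "N ((x1 [^] n) [^] (j - b)) = (1/2) ^ (n * (j - b))"
        using norm_pow[of "x1 [^] n" "j - b"] norm_x1_pow[of n] x1_carrier by (simp add: power_mult)
      then show "0 < N ((x1 [^] n) [^] (j - b))" by simp
      have s: "n * (j - b) + Suc n * b = n * j + b"
        using bj by (simp add: diff_mult_distrib2)
      show "(1/2) ^ (n * j + b) = N ((x1 [^] n) [^] (j - b)) * (1/2) ^ (Suc n * b)"
        by (simp only: e power_add[symmetric] s)
      fix \<alpha> assume "\<alpha> \<in> exponents d (Suc n * b)"
      then have "monomial xs \<alpha> \<in> ideal_pow R (ideal_pow R Q (Suc n)) b"
        using monomial_mem_Q_pow ideal_pow_pow[OF Q_ideal, of "Suc n" b] by simp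
      then have "monomial xs \<alpha> \<in> ideal_pow R (J n) b" using ideal_pow_mono[OF Q_pow_subset_J] by blast
      moreover have "(x1 [^] n) [^] (j - b) \<in> ideal_pow R (J n) (j - b)"
        by (rule nat_pow_mem_ideal_pow[OF J_ideal x1_pow_mem_J])
      ultimately have "(x1 [^] n) [^] (j - b) \<otimes> monomial xs \<alpha> \<in> ideal_pow R (J n) (j - b + b)"
        by (intro mult_mem_ideal_pow[OF J_ideal])
      then show "(x1 [^] n) [^] (j - b) \<otimes> monomial xs \<alpha> \<in> ?A" using bj by simp
    qed
    ultimately show "0 < (1/2 :: real) ^ (n * j + b) \<and> ?B \<subseteq> open_level ((1/2) ^ (n * j + b)) \<and>
        enat (card (exponents d (Suc n * b))) \<le>
        ideal_length (?A \<inter> open_level ((1/2) ^ (n * j + b))) (?A \<inter> closed_level ((1/2) ^ (n * j + b)))"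
      by simp
  qed
  moreover have cof: "cofinite ?B" using hilbert_samuel_eventually_poly_primary(2)[OF cofinite_I] .
  ultimately have "enat (\<Sum>b\<in>?S. card (exponents d (Suc n * b))) \<le> enat (the_enat (ideal_length ?B ?A))"
    using colength_diff(1)[OF cof A BA] by simp
  then have "real (\<Sum>b\<in>?S. card (exponents d (Suc n * b))) \<le> real (the_enat (ideal_length ?B ?A))"
    by (simp only: of_nat_le_iff enat_ord_simps)
  then show ?thesis using colength_diff(2)[OF cof A BA] by simp
qed

text \<open>The limit is taken along \<open>j = 2 * E * i\<close>, keeping only \<open>b\<close>
  from \<open>i\<close> to \<open>2 * i - 1\<close>. These are \<open>i\<close> values, each
  contributing at least \<open>((n+1) i / d)^(d-1)\<close>, and division by \<open>(2 E i)^d\<close>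
  cancels all powers of \<open>i\<close>.\<close>

lemma multiplicity_gap:
  assumes E: "E \<ge> 1" "\<And>n g. g \<in> carrier R \<Longrightarrow> N g < (1/2) ^ n \<Longrightarrow> N g ^ E \<le> (1/2) ^ (n * E + 1)"
  shows "fact d * (real (Suc n) / real d) ^ (d - 1) / (2 * real E) ^ d \<le>
    multiplicity_of_ideal R (I n) - multiplicity_of_ideal R (J n)"
proof (rule LIMSEQ_le_const)
  let ?u = "\<lambda>j. fact d * colength (ideal_pow R (I n) j) / real j ^ d -
    fact d * colength (ideal_pow R (J n) j) / real j ^ d"
  have "?u \<longlonglongrightarrow> multiplicity_of_ideal R (I n) - multiplicity_of_ideal R (J n)"
    using multiplicity_LIMSEQ[OF I_ideal Q_pow_subset_I] multiplicity_LIMSEQ[OF J_ideal Q_pow_subset_J]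
    by (rule tendsto_diff)
  moreover have "strict_mono (\<lambda>i. 2 * E * i)" using E(1) by (intro strict_monoI) simp
  ultimately show "(?u \<circ> (\<lambda>i. 2 * E * i)) \<longlonglongrightarrow> multiplicity_of_ideal R (I n) - multiplicity_of_ideal R (J n)"
    by (rule LIMSEQ_subseq_LIMSEQ)
  have "fact d * (real (Suc n) / real d) ^ (d - 1) / (2 * real E) ^ d \<le> ?u (2 * E * i)" if i: "i \<ge> 1" for i
  proof -
    let ?j = "2 * E * i" let ?q = "real (Suc n) / real d"
    have fin: "finite {b. b * E < ?j}"
    proof (rule finite_subset)
      show "{b. b * E < ?j} \<subseteq> {..<?j}"
      proof
        fix b assume "b \<in> {b. b * E < ?j}"
        then show "b \<in> {..<?j}" using E(1) le_less_trans[of b "b * E" ?j] by (cases E) auto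
      qed
    qed simp
    have e: "real (Suc n * i) / real d = real i * ?q" by (simp add: algebra_simps)
    have "real i ^ d = real i * real i ^ (d - 1)" using d_pos by (cases d) auto
    then have "real i ^ d * ?q ^ (d - 1) = real i * (real i * ?q) ^ (d - 1)"
      by (simp only: power_mult_distrib mult.assoc)
    also have "\<dots> = (\<Sum>b\<in>{i..<2 * i}. (real (Suc n * i) / real d) ^ (d - 1))"
      unfolding e by simp
    finally have "real i ^ d * ?q ^ (d - 1) = (\<Sum>b\<in>{i..<2 * i}. (real (Suc n * i) / real d) ^ (d - 1))" .
    also have "\<dots> \<le> (\<Sum>b\<in>{i..<2 * i}. real (card (exponents d (Suc n * b))))"
    proof (rule sum_mono)
      fix b assume "b \<in> {i..<2 * i}"
      then have "Suc n * i \<le> Suc n * b" by (intro mult_le_mono) auto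
      then have "real (Suc n * i) \<le> real (Suc n * b)" by (rule of_nat_mono)
      then have "(real (Suc n * i) / real d) ^ (d - 1) \<le> (real (Suc n * b) / real d) ^ (d - 1)"
        by (intro power_mono divide_right_mono) auto
      also have "\<dots> \<le> real (card (exponents d (Suc n * b)))" by (rule card_exponents_ge)
      finally show "(real (Suc n * i) / real d) ^ (d - 1) \<le> real (card (exponents d (Suc n * b)))" .
    qed
    also have "\<dots> \<le> (\<Sum>b\<in>{b. b * E < ?j}. real (card (exponents d (Suc n * b))))"
    proof (rule sum_mono2[OF fin])
      show "{i..<2 * i} \<subseteq> {b. b * E < ?j}" using E(1) by auto
    qed simp
    also have "\<dots> \<le> colength (ideal_pow R (I n) ?j) - colength (ideal_pow R (J n) ?j)"
      by (rule colength_pow_gap[OF E])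
    finally have "fact d * (real i ^ d * ?q ^ (d - 1)) / real ?j ^ d \<le>
        fact d * (colength (ideal_pow R (I n) ?j) - colength (ideal_pow R (J n) ?j)) / real ?j ^ d"
      by (intro divide_right_mono mult_left_mono) auto
    also have "\<dots> = ?u ?j" by (simp add: right_diff_distrib diff_divide_distrib)
    also have "fact d * (real i ^ d * ?q ^ (d - 1)) / real ?j ^ d = fact d * ?q ^ (d - 1) / (2 * real E) ^ d"
      using i by (simp add: power_mult_distrib)
    finally show ?thesis .
  qed
  then show "\<exists>N. \<forall>i\<ge>N. fact d * (real (Suc n) / real d) ^ (d - 1) / (2 * real E) ^ d \<le> (?u \<circ> (\<lambda>i. 2 * E * i)) i"
    by (intro exI[of _ 1]) simp
qed

text \<open>The constant \<open>c\<close> does not involve \<open>n\<close>, and for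
  \<open>d \<ge> 2\<close> the factor \<open>real (Suc n) ^ (d - 1)\<close> is at least
  \<open>n\<close>.\<close>

lemma multiplicity_gap_unbounded:
  assumes "d \<ge> 2"
  shows "\<exists>n. B < multiplicity_of_ideal R (I n) - multiplicity_of_ideal R (J n)"
proof -
  obtain E where E: "E \<ge> 1" "\<And>n g. g \<in> carrier R \<Longrightarrow> N g < (1/2) ^ n \<Longrightarrow> N g ^ E \<le> (1/2) ^ (n * E + 1)"
    using norm_gap by blast
  define c where "c = fact d / real d ^ (d - 1) / (2 * real E) ^ d"
  have c: "0 < c" using assms E(1) by (simp add: c_def)
  obtain n :: nat where n: "B / c < real n" using reals_Archimedean2 by blast
  have "B < c * real n" using n c by (simp add: field_simps)
  also have "real n \<le> real (Suc n) ^ (d - 1)"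
    using self_le_power[of "real (Suc n)" "d - 1"] assms by simp
  also have "c * real (Suc n) ^ (d - 1) = fact d * (real (Suc n) / real d) ^ (d - 1) / (2 * real E) ^ d"
    by (simp add: c_def power_divide)
  also have "\<dots> \<le> multiplicity_of_ideal R (I n) - multiplicity_of_ideal R (J n)"
    by (rule multiplicity_gap[OF E])
  finally show ?thesis using c by (auto intro: exI[of _ n])
qed

end

theorem theoremC:
  fixes R :: "('a, 'b) ring_scheme" and m :: "'a set" and d :: nat
  assumes "noetherian_local_ring R m"
    and "krull_dim R = enat d"
    and "d \<ge> 2"
  shows "(SUP (I, J) \<in> {(I, J). ideal I R \<and> ideal J R \<and> I \<subset> J \<and> ideal_radical R I = m}.
            ereal ((multiplicity_of_ideal R I - multiplicity_of_ideal R J) /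
                   (quotient_length R I - quotient_length R J))) = \<infinity>
       \<and> (algebraically_closed (R Quot m) \<longrightarrow>
          (SUP (I, J) \<in> {(I, J). ideal I R \<and> ideal J R \<and> I \<subset> J \<and> ideal_radical R I = m \<and>
                           integral_closure R I = I \<and> integral_closure R J = J}.
            ereal ((multiplicity_of_ideal R I - multiplicity_of_ideal R J) /
                   (quotient_length R I - quotient_length R J))) = \<infinity>)"
proof -
  interpret noetherian_local_ring R m by fact
  obtain xs k where xs: "length xs = d" "set xs \<subseteq> m" "ideal_pow R m k \<subseteq> Idl\<^bsub>R\<^esub> (set xs)"
    using ex_parameters[OF assms(2)] by blast
  interpret P: parameter_system R m xs d k
    using assms(2,3) xs by unfold_locales auto
  obtain N where N: "P.minimal_norm N" using P.ex_minimal_norm by blast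
  interpret V: normed_parameter_system R m xs d k N
    using N P.minimal_norm_mult[OF N] by unfold_locales (auto simp: P.minimal_norm_def)
  let ?r = "\<lambda>(I, J). ereal ((multiplicity_of_ideal R I - multiplicity_of_ideal R J) /
      (quotient_length R I - quotient_length R J))"
  \<comment> \<open>The denominators for these pairs are 1, so the multiplicity gap alone is
    unbounded. The index set \<open>S\<close> is left open because the same pairs settle both
    suprema.\<close>
  have unbounded: "(SUP p \<in> S. ?r p) = \<infinity>" if S: "\<And>n. (V.I n, V.J n) \<in> S" for S
  proof (rule SUP_PInfty)
    fix B :: nat
    obtain n where n: "real B < multiplicity_of_ideal R (V.I n) - multiplicity_of_ideal R (V.J n)"
      using V.multiplicity_gap_unbounded[OF assms(3)] by blast
    have "ereal (real B) \<le> ?r (V.I n, V.J n)"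
      using n V.quotient_length_I_J[of n] by simp
    then show "\<exists>p\<in>S. ereal (real B) \<le> ?r p" using S by blast
  qed
  have mem: "ideal (V.I n) R \<and> ideal (V.J n) R \<and> V.I n \<subset> V.J n \<and> ideal_radical R (V.I n) = m" for n
    using V.I_ideal V.J_ideal V.I_psubset_J V.radical_I by blast
  show ?thesis
  proof (intro conjI impI)
    show "(SUP (I, J) \<in> {(I, J). ideal I R \<and> ideal J R \<and> I \<subset> J \<and> ideal_radical R I = m}.
        ereal ((multiplicity_of_ideal R I - multiplicity_of_ideal R J) /
          (quotient_length R I - quotient_length R J))) = \<infinity>"
      by (rule unbounded) (use mem in simp)
    assume "algebraically_closed (R Quot m)"
    then show "(SUP (I, J) \<in> {(I, J). ideal I R \<and> ideal J R \<and> I \<subset> J \<and> ideal_radical R I = m \<and>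
          integral_closure R I = I \<and> integral_closure R J = J}.
        ereal ((multiplicity_of_ideal R I - multiplicity_of_ideal R J) /
          (quotient_length R I - quotient_length R J))) = \<infinity>"
      by (intro unbounded) (use mem V.integral_closure_I V.integral_closure_J in simp)
  qed
qed

end
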